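(* Let $1<p<\infty$ and let $g\in\Lambda\left(p,\frac1p\right)$. Let $X$ be one of the following spaces: $H^p$ with $1<p\le2$; or $A^p_\alpha$ with $1<p<\infty$ and $-1<\alpha<p-2$; or $\mathcal{D}^p_\alpha$ with $1<p<\infty$ and $p-2<\alpha\le p-1$. Then there is a constant $C>0$ such that $$\|\mathcal{H}_g(f)\|_X\le C\,\|\widetilde{\mathcal{H}}(f)\|_X\quad\text{for all } f\in X,$$ where $\mathcal{H}_g$ is the generalized Hilbert operator and $\widetilde{\mathcal{H}}$ the sublinear Hilbert operator.
   Context: $\mathbb{D}$ is the open unit disc, $dA=\frac1\pi dx\,dy$. For analytic $f$ in $\mathbb{D}$, $M_p(r,f)=\left(\frac1{2\pi}\int_0^{2\pi}|f(re^{it})|^p\,dt\right)^{1/p}$; $H^p$ is the Hardy space of analytic $f$ with $\|f\|_{H^p}=\sup_{0<r<1}M_p(r,f)<\infty$. For $\alpha>-1$, $A^p_\alpha$ is the weighted Bergman space of analytic $f$ with $\|f\|_{A^p_\alpha}=\left((\alpha+1)\int_{\mathbb{D}}|f(z)|^p(1-|z|^2)^\alpha\,dA(z)\right)^{1/p}<\infty$, and $\mathcal{D}^p_\alpha$ is the space of analytic $f$ with $\|f\|_{\mathcal{D}^p_\alpha}^p=|f(0)|^p+\|f'\|_{A^p_\alpha}^p<\infty$. For analytic $f$ with $\int_0^1|f(t)|\,dt<\infty$ (which holds for all $f$ in the spaces $X$ considered), $\mathcal{H}_g(f)(z)=\int_0^1 f(t)g'(tz)\,dt$ and $\widetilde{\mathcal{H}}(f)(z)=\int_0^1\frac{|f(t)|}{1-tz}\,dt$,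 $z\in\mathbb{D}$. Mean Lipschitz spaces: for $1\le p<\infty$ and $0<\alpha\le1$, $\Lambda(p,\alpha)$ is the set of $g\in H^p$ whose boundary function satisfies $\omega_p(g,t)=O(t^\alpha)$ as $t\to0$, where $\omega_p(g,t)=\sup_{0<h\le t}\left(\int_0^{2\pi}|g(e^{i(\theta+h)})-g(e^{i\theta})|^p\frac{d\theta}{2\pi}\right)^{1/p}$. Equivalently (Hardy–Littlewood), $\Lambda(p,\alpha)=\{g\in H^p: M_p(r,g')=O((1-r)^{\alpha-1}),\ r\to1^-\}$. *)

theory Defs
  imports "HOL-Analysis.Analysis"
begin

abbreviation unit_disc :: "complex set"
  where "unit_disc \<equiv> ball 0 1"

(* All norms take values in [0,\<infinity>], so that an infinite norm is not confused with 0.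
   ennpowr is used for exponents a > 0 only. *)
definition ennpowr :: "ennreal \<Rightarrow> real \<Rightarrow> ennreal"
  where "ennpowr x a = (if x = \<infinity> then \<infinity> else ennreal (enn2real x powr a))"

definition int_mean :: "real \<Rightarrow> real \<Rightarrow> (complex \<Rightarrow> complex) \<Rightarrow> ennreal"
  where "int_mean p r f =
    ennpowr (ennreal (1 / (2 * pi)) *
      (\<integral>\<^sup>+t\<in>{0..2 * pi}. ennreal (norm (f (of_real r * cis t)) powr p) \<partial>lborel)) (1 / p)"

definition hardy_norm :: "real \<Rightarrow> (complex \<Rightarrow> complex) \<Rightarrow> ennreal"
  where "hardy_norm p f = (SUP r\<in>{0<..<1}. int_mean p r f)"

definition hardy_space :: "real \<Rightarrow> (complex \<Rightarrow> complex) set"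
  where "hardy_space p = {f. f holomorphic_on unit_disc \<and> hardy_norm p f < \<infinity>}"

(* The area measure is normalised, dA = dx dy / pi, whence the factor 1 / pi. *)
definition bergman_norm :: "real \<Rightarrow> real \<Rightarrow> (complex \<Rightarrow> complex) \<Rightarrow> ennreal"
  where "bergman_norm p \<alpha> f =
    ennpowr (ennreal ((\<alpha> + 1) / pi) *
      (\<integral>\<^sup>+z\<in>unit_disc. ennreal (norm (f z) powr p * (1 - (norm z)\<^sup>2) powr \<alpha>) \<partial>lborel)) (1 / p)"

definition bergman_space :: "real \<Rightarrow> real \<Rightarrow> (complex \<Rightarrow> complex) set"
  where "bergman_space p \<alpha> = {f. f holomorphic_on unit_disc \<and> bergman_norm p \<alpha> f < \<infinity>}"

definition dirichlet_norm :: "real \<Rightarrow> real \<Rightarrow> (complex \<Rightarrow> complex) \<Rightarrow> ennreal"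
  where "dirichlet_norm p \<alpha> f =
    ennpowr (ennreal (norm (f 0) powr p) + ennpowr (bergman_norm p \<alpha> (deriv f)) p) (1 / p)"

definition dirichlet_space :: "real \<Rightarrow> real \<Rightarrow> (complex \<Rightarrow> complex) set"
  where "dirichlet_space p \<alpha> = {f. f holomorphic_on unit_disc \<and> dirichlet_norm p \<alpha> f < \<infinity>}"

(* phi is (a Borel version of) the radial boundary function of g. By Fatou's theorem every
   g in a Hardy space has one; it is unique up to a null set of the circle. *)
definition is_boundary_function :: "(complex \<Rightarrow> complex) \<Rightarrow> (complex \<Rightarrow> complex) \<Rightarrow> bool"
  where "is_boundary_function g \<phi> \<longleftrightarrow>
    \<phi> \<in> borel_measurable borel \<and>
    (AE \<theta> in lborel. ((\<lambda>r. g (of_real r * cis \<theta>)) \<longlongrightarrow> \<phi> (cis \<theta>)) (at_left 1))"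

(* The integral modulus of continuity of a function on the unit circle. *)
definition modulus_cont :: "real \<Rightarrow> (complex \<Rightarrow> complex) \<Rightarrow> real \<Rightarrow> ennreal"
  where "modulus_cont p \<phi> t =
    (SUP h\<in>{0<..t}.
      ennpowr (ennreal (1 / (2 * pi)) *
        (\<integral>\<^sup>+\<theta>\<in>{0..2 * pi}. ennreal (norm (\<phi> (cis (\<theta> + h)) - \<phi> (cis \<theta>)) powr p) \<partial>lborel)) (1 / p))"

definition mean_lipschitz :: "real \<Rightarrow> real \<Rightarrow> (complex \<Rightarrow> complex) set"
  where "mean_lipschitz p \<alpha> = {g. g \<in> hardy_space p \<and>
    (\<exists>\<phi>. is_boundary_function g \<phi> \<and>
      (\<exists>K. \<forall>\<^sub>F t in at_right 0. modulus_cont p \<phi> t \<le> ennreal (K * t powr \<alpha>)))}"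

definition gen_hilbert :: "(complex \<Rightarrow> complex) \<Rightarrow> (complex \<Rightarrow> complex) \<Rightarrow> complex \<Rightarrow> complex"
  where "gen_hilbert g f z = (LINT t:{0..<1}|lborel. f (of_real t) * deriv g (of_real t * z))"

definition sub_hilbert :: "(complex \<Rightarrow> complex) \<Rightarrow> complex \<Rightarrow> complex"
  where "sub_hilbert f z =
    (LINT t:{0..<1}|lborel. of_real (norm (f (of_real t))) / (1 - of_real t * z))"

end

theory Submission
  imports Defs "HOL-Complex_Analysis.Complex_Analysis"
begin

text \<open>
  Put \<open>a t = \<bar>f t\<bar>\<close> on \<open>[0,1)\<close> and \<open>\<Phi>\<^sub>b(r) = \<integral> a t (1 - t r)\<^bsup>-b\<^esup> dt\<close>, so that \<open>\<Phi>\<^sub>1\<close> is the sublinear Hilbert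
  transform \<open>F\<close> of \<open>f\<close> on the radius. Representing \<open>g'\<close> and \<open>g''\<close> by the boundary function of \<open>g\<close> gives the
  growth \<open>O((1 - r)\<^bsup>1/p - n\<^esup>)\<close> of the \<open>p\<close>-means of the \<open>n\<close>-th derivative, and Minkowski's inequality then bounds the
  \<open>p\<close>-means of \<open>H\<^sub>g f\<close> and of its derivative by \<open>\<Phi>\<^bsub>1 - 1/p\<^esub>\<close> and \<open>\<Phi>\<^bsub>2 - 1/p\<^esub>\<close>. A weighted Hardy inequality trades the
  loss of \<open>1/p\<close> in the exponent for one power of \<open>1 - r\<close>:
  \<open>\<integral> (1 - r)\<^bsup>\<alpha>\<^esup> \<Phi>\<^bsub>b - 1/p\<^esub>\<^sup>p dr \<le> C \<integral> (1 - r)\<^bsup>\<alpha> + 1\<^esup> \<Phi>\<^sub>b\<^sup>p dr\<close>. The extra power is the width of the arc around the radius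
  on which \<open>\<bar>F\<bar>\<close> (or \<open>\<bar>F'\<bar>\<close>) is comparable with its value on the radius, so the right-hand side is dominated by the
  Bergman (or Dirichlet) norm of \<open>F\<close>.

  For \<open>H\<^sup>p\<close> with \<open>p \<le> 2\<close> one has \<open>\<bar>F(r e\<^bsup>i(1 - s)\<^esup>)\<bar> \<ge> \<Phi>\<^sub>1(s) / 8\<close> for \<open>s \<le> r\<close>, whence \<open>\<integral> \<Phi>\<^sub>1\<^sup>p\<close> is dominated by the Hardy
  norm of \<open>F\<close>, and \<open>H\<^sub>g f\<close> is controlled through the Littlewood--Paley estimate of \<open>H\<^sup>p\<close> by \<open>\<integral> (1 - r)\<^bsup>p - 1\<^esup> M\<^sub>p(r, h')\<^sup>p dr\<close>.
  In logarithmic coordinates \<open>x = ln r\<close> the mean \<open>m\<close> of \<open>\<bar>h\<bar>\<^sup>p\<close> is convex, and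
  \<open>\<bar>a + b\<bar>\<^sup>p \<le> \<bar>a\<bar>\<^sup>p + p \<bar>a\<bar>\<^bsup>p - 2\<^esup> Re (cnj a b) + 6 \<bar>b\<bar>\<^sup>p\<close>, whose middle term has mean zero over circles, bounds its second
  differences at scale \<open>\<bar>x\<bar>\<close> by means of \<open>\<bar>h'\<bar>\<^sup>p\<close>; these are summed over a geometric grid.
\<close>

text \<open>Integral means enter as p-th powers of nonnegative, possibly infinite integrals, so
  Tonelli applies freely. Minkowski's inequality accordingly takes the form of Jensen's inequality
  against an explicit finite weight (\<open>jensen_powr_nn_integral\<close>); each use hinges on the
  choice of that weight.

  Upper bounds may put absolute values inside because the comparison operator has the positive
  density |f|: its Stieltjes kernel has no cancellation near the radius, so the same quantities also
  bound it from below. For area integrals an arc of length comparable to 1 - r suffices. The Hardy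
  norm has no integration in r, so there each angle \<theta> must test the value at a different
  radius, 1 - \<theta>.

  The obstacle in the Hardy case is p < 2: the Laplacian of |h|^p is a multiple of |h|^(p-2) |h'|^2,
  singular at the zeros of h. Finite second differences of the circular means avoid it, since their
  error is the p-th power of an increment of h and requires no lower bound on |h|.\<close>

lemma ennpowr_ennreal: "0 \<le> x \<Longrightarrow> ennpowr (ennreal x) a = ennreal (x powr a)"
  by (simp add: ennpowr_def)

lemma ennpowr_ennpowr_inverse:
  assumes "0 < a"
  shows "ennpowr (ennpowr x (1 / a)) a = x"
  using assms by (cases x) (auto simp: ennpowr_def powr_powr)

lemma ennpowr_mono_mult:
  assumes "0 < a" "0 < K" "x \<le> ennreal K * y"
  shows "ennpowr x a \<le> ennreal (K powr a) * ennpowr y a"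
proof (cases y)
  case (real r)
  then have "x \<le> ennreal (K * r)" using assms by (simp add: ennreal_mult)
  then obtain s where s: "x = ennreal s" "0 \<le> s" "s \<le> K * r"
    using real assms by (cases x) (auto simp: ennreal_le_iff top_unique)
  then have "s powr a \<le> (K * r) powr a" using assms by (intro powr_mono2) auto
  then show ?thesis
    using s real assms by (simp add: ennpowr_ennreal powr_mult ennreal_mult[symmetric] ennreal_leI)
next
  case top
  then show ?thesis using assms by (simp add: ennpowr_def ennreal_mult_top)
qed

section \<open>Young's and Jensen's inequalities for p-th powers\<close>

lemma young_powr:
  fixes u c p :: real
  assumes "1 < p" "0 \<le> u" "0 \<le> c"
  shows "u * c powr (p - 1) \<le> u powr p / p + (1 - 1 / p) * c powr p"
proof (cases "u = 0 \<or> c = 0")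
  case False
  then have pos: "0 < u" "0 < c" using assms by auto
  \<comment> \<open>The tangent of the convex function x^p at 1, taken at u / c; multiplying by c^p
    restores homogeneity and gives Young's inequality with conjugate exponents p and p / (p -
    1).\<close>
  have "(u / c) powr p \<ge> 1 + p * (u / c - 1)"
  proof (cases "u / c = 1")
    case False
    have c1: "convex_on {0<..} (\<lambda>x::real. x powr p)" using assms by (intro powr_convex) auto
    have "((\<lambda>x::real. x powr p) has_real_derivative p * 1 powr (p - 1)) (at 1 within {0<..})"
      using has_real_derivative_powr[of 1 p] by (auto intro: has_field_derivative_at_within)
    from convex_on_imp_above_tangent[OF c1 _ _ _ this] pos
    have "(u/c) powr p - 1 powr p \<ge> (p * 1 powr (p-1)) * (u/c - 1)"
      by (auto simp: interior_open convex_connected)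
    then show ?thesis by simp
  qed simp
  then have "c powr p * (1 + p * (u / c - 1)) \<le> c powr p * (u / c) powr p"
    by (intro mult_left_mono) auto
  also have "\<dots> = u powr p" using pos by (simp add: powr_divide)
  also have "c powr p * (1 + p * (u / c - 1)) = p * (u * c powr (p-1)) - (p - 1) * c powr p"
  proof -
    have "c powr p = c * c powr (p - 1)" using pos powr_add[of c 1 "p-1"] by simp
    then show ?thesis using pos by (simp add: field_simps)
  qed
  finally show ?thesis using assms by (simp add: field_simps)
qed (use assms in auto)

text \<open>Young's inequality with one well-chosen constant, integrated against \<open>w\<close>.
  The number \<open>X\<close> stands for any finite lower bound of the integral of u w, so that this
  integral may be infinite, and \<open>W\<close> for any upper bound of the total weight, so that no
  normalisation is required.\<close>

lemma jensen_powr_nn_integral: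
  fixes u w :: "'a \<Rightarrow> real"
  assumes p: "1 < p" and [measurable]: "u \<in> borel_measurable M" "w \<in> borel_measurable M"
    and nn: "\<And>x. 0 \<le> u x" "\<And>x. 0 \<le> w x" and W: "0 < W" and X: "0 \<le> X"
    and wW: "(\<integral>\<^sup>+x. ennreal (w x) \<partial>M) \<le> ennreal W"
    and le: "ennreal X \<le> (\<integral>\<^sup>+x. ennreal (u x * w x) \<partial>M)"
  shows "ennreal (X powr p) \<le> ennreal (W powr (p - 1)) * (\<integral>\<^sup>+x. ennreal (u x powr p * w x) \<partial>M)"
proof (cases "(\<integral>\<^sup>+x. ennreal (u x powr p * w x) \<partial>M)")
  case top
  then show ?thesis using W by (simp add: ennreal_mult_top)
next
  case (real R)
  \<comment> \<open>The weighted mean value; for it c^(p-1) X = c^p W, and the two sides of Young's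
    inequality balance.\<close>
  define c where "c = X / W"
  have c: "0 \<le> c" using W X by (simp add: c_def)
  have "ennreal (c powr (p - 1) * X) \<le> ennreal (c powr (p-1)) * (\<integral>\<^sup>+x. ennreal (u x * w x) \<partial>M)"
    using le X by (simp add: ennreal_mult mult_left_mono)
  also have "\<dots> = (\<integral>\<^sup>+x. ennreal (c powr (p-1)) * ennreal (u x * w x) \<partial>M)"
    by (simp add: nn_integral_cmult)
  also have "\<dots> \<le> (\<integral>\<^sup>+x. ennreal (1 / p) * ennreal (u x powr p * w x) 
      + ennreal ((1 - 1 / p) * c powr p) * ennreal (w x) \<partial>M)"
  proof (intro nn_integral_mono)
    fix x
    have "c powr (p-1) * (u x * w x) = (u x * c powr (p-1)) * w x" by simp
    also have "\<dots> \<le> (u x powr p / p + (1 - 1 / p) * c powr p) * w x"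
      using young_powr[OF p nn(1) c] nn(2) by (intro mult_right_mono) auto
    also have "\<dots> = 1 / p * (u x powr p * w x) + ((1 - 1 / p) * c powr p) * w x"
      by (simp add: algebra_simps)
    finally show "ennreal (c powr (p-1)) * ennreal (u x * w x) \<le> ennreal (1 / p) * ennreal (u x powr p * w x) 
      + ennreal ((1 - 1 / p) * c powr p) * ennreal (w x)"
      using p nn by (simp add: ennreal_mult[symmetric] ennreal_plus[symmetric] ennreal_leI del: ennreal_plus)
  qed
  also have "\<dots> = ennreal (1 / p) * ennreal R + ennreal ((1 - 1 / p) * c powr p) * (\<integral>\<^sup>+x. ennreal (w x) \<partial>M)"
    using real by (simp add: nn_integral_add nn_integral_cmult)
  also have "\<dots> \<le> ennreal (1 / p) * ennreal R + ennreal ((1 - 1 / p) * c powr p) * ennreal W"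
    by (intro add_left_mono mult_left_mono wW) auto
  also have "\<dots> = ennreal (R / p + (1 - 1 / p) * c powr p * W)"
    using p W real by (simp add: ennreal_mult[symmetric] ennreal_plus[symmetric] del: ennreal_plus)
  finally have "c powr (p - 1) * X \<le> R / p + (1 - 1 / p) * c powr p * W"
    using p W real by (subst (asm) ennreal_le_iff) auto
  moreover have "c powr (p - 1) * X = c powr p * W"
  proof (cases "X = 0")
    case False
    then have "0 < c" using X W by (simp add: c_def)
    then have "c powr p = c * c powr (p - 1)" using powr_add[of c 1 "p-1"] by simp
    then show ?thesis using W by (simp add: c_def)
  qed (use p in \<open>simp add: c_def\<close>)
  ultimately have "c powr p * W \<le> R / p + (1 - 1 / p) * (c powr p * W)" by simp
  then have "c powr p * W \<le> R" using p by (simp add: field_simps)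
  moreover have "X powr p = W powr (p - 1) * (c powr p * W)"
  proof -
    have "W powr p = W * W powr (p - 1)" using W powr_add[of W 1 "p-1"] by simp
    moreover have "X = c * W" using W by (simp add: c_def)
    ultimately show ?thesis using c W by (simp add: powr_mult)
  qed
  ultimately have "X powr p \<le> W powr (p - 1) * R" by (simp add: mult_left_mono)
  then show ?thesis using real by (simp add: ennreal_mult[symmetric] ennreal_leI)
qed

section \<open>Periodic functions and polar coordinates\<close>

lemma nn_integral_Ico_Icc:
  fixes v :: "real \<Rightarrow> ennreal"
  shows "(\<integral>\<^sup>+x\<in>{a..b}. v x \<partial>lborel) = (\<integral>\<^sup>+x\<in>{a..<b}. v x \<partial>lborel)"
proof (rule nn_integral_cong_AE)
  show "AE x in lborel. v x * indicator {a..b} x = v x * indicator {a..<b} x"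
    using AE_lborel_singleton[of b] by eventually_elim (auto simp: indicator_def)
qed

lemma nn_integral_Ico_split:
  fixes v :: "real \<Rightarrow> ennreal"
  assumes [measurable]: "v \<in> borel_measurable borel" and "a \<le> b" "b \<le> c"
  shows "(\<integral>\<^sup>+x\<in>{a..<c}. v x \<partial>lborel) = (\<integral>\<^sup>+x\<in>{a..<b}. v x \<partial>lborel) + (\<integral>\<^sup>+x\<in>{b..<c}. v x \<partial>lborel)"
  by (subst nn_integral_add[symmetric]) (use assms in \<open>auto intro!: nn_integral_cong simp: indicator_def\<close>)

lemma nn_integral_Ico_shift:
  fixes v :: "real \<Rightarrow> ennreal"
  assumes [measurable]: "v \<in> borel_measurable borel"
  shows "(\<integral>\<^sup>+x\<in>{a..<b}. v (x + c) \<partial>lborel) = (\<integral>\<^sup>+x\<in>{a+c..<b+c}. v x \<partial>lborel)"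
  by (subst (2) nn_integral_real_affine[where c=1 and t=c])
     (auto intro!: nn_integral_cong simp: indicator_def add_ac)

lemma nn_integral_periodic:
  fixes v :: "real \<Rightarrow> ennreal"
  assumes [measurable]: "v \<in> borel_measurable borel" and P: "0 < P" and per: "\<And>x. v (x + P) = v x"
  shows "(\<integral>\<^sup>+x\<in>{a..a+P}. v x \<partial>lborel) = (\<integral>\<^sup>+x\<in>{0..P}. v x \<partial>lborel)"
proof -
  have pern: "v (x + of_nat n * P) = v x" for n x
  proof (induction n)
    case (Suc n)
    have "v (x + of_nat (Suc n) * P) = v ((x + of_nat n * P) + P)" by (simp add: algebra_simps)
    then show ?case using per Suc by simp
  qed simp
  have peri: "v (x + of_int n * P) = v x" for n x
  proof (cases "n \<ge> 0")
    case True
    then show ?thesis using pern[of x "nat n"] by simp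
  next
    case False
    then show ?thesis using pern[of "x + of_int n * P" "nat (- n)"] by simp
  qed
  \<comment> \<open>Moving the interval by whole periods makes it start at \<open>b\<close> in
    [0, P]; the part beyond \<open>P\<close> is then wrapped around to [0, b).\<close>
  define n where "n = \<lfloor>a / P\<rfloor>"
  define b where "b = a - of_int n * P"
  have b: "0 \<le> b" "b \<le> P"
    using floor_divide_lower[OF P, of a] floor_divide_upper[OF P, of a]
    by (simp_all add: b_def n_def algebra_simps)
  have "(\<integral>\<^sup>+x\<in>{a..<a+P}. v x \<partial>lborel) = (\<integral>\<^sup>+x\<in>{b..<b+P}. v (x + of_int n * P) \<partial>lborel)"
    by (subst nn_integral_Ico_shift) (auto simp: b_def algebra_simps)
  also have "\<dots> = (\<integral>\<^sup>+x\<in>{b..<P}. v x \<partial>lborel) + (\<integral>\<^sup>+x\<in>{0+P..<b+P}. v x \<partial>lborel)"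
    using b by (simp add: peri nn_integral_Ico_split[of v b P "b+P"])
  also have "(\<integral>\<^sup>+x\<in>{0+P..<b+P}. v x \<partial>lborel) = (\<integral>\<^sup>+x\<in>{0..<b}. v x \<partial>lborel)"
    by (subst nn_integral_Ico_shift[symmetric]) (auto simp: per)
  also have "(\<integral>\<^sup>+x\<in>{b..<P}. v x \<partial>lborel) + (\<integral>\<^sup>+x\<in>{0..<b}. v x \<partial>lborel) = (\<integral>\<^sup>+x\<in>{0..<P}. v x \<partial>lborel)"
    using b by (simp add: nn_integral_Ico_split[of v 0 b P] add_ac)
  finally show ?thesis by (simp add: nn_integral_Ico_Icc)
qed

lemma nn_integral_periodic_shift:
  fixes v :: "real \<Rightarrow> ennreal"
  assumes [measurable]: "v \<in> borel_measurable borel" and P: "0 < P" and per: "\<And>x. v (x + P) = v x"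
  shows "(\<integral>\<^sup>+x\<in>{0..P}. v (x + c) \<partial>lborel) = (\<integral>\<^sup>+x\<in>{0..P}. v x \<partial>lborel)"
proof -
  have "(\<integral>\<^sup>+x\<in>{0..P}. v (x + c) \<partial>lborel) = (\<integral>\<^sup>+x\<in>{c..c+P}. v x \<partial>lborel)"
    unfolding nn_integral_Ico_Icc by (subst nn_integral_Ico_shift) (auto simp: add_ac)
  then show ?thesis using nn_integral_periodic[OF assms, of c] by simp
qed

section \<open>Area measure in the complex plane and polar coordinates\<close>

lemma lborel_complex_eq: "lborel = distr (lborel \<Otimes>\<^sub>M lborel) borel (\<lambda>(x, y). Complex x y)"
proof (rule lborel_eqI)
  have [measurable]: "(\<lambda>(x, y). Complex x y) \<in> borel_measurable (lborel \<Otimes>\<^sub>M lborel)"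
    unfolding lborel_prod
    by (auto simp: case_prod_unfold Complex_eq intro!: borel_measurable_continuous_onI continuous_intros)
  fix l u :: complex
  assume le: "\<And>b. b \<in> Basis \<Longrightarrow> l \<bullet> b \<le> u \<bullet> b"
  have eq: "(\<lambda>(x, y). Complex x y) -` box l u \<inter> space (lborel \<Otimes>\<^sub>M lborel) = {Re l<..<Re u} \<times> {Im l<..<Im u}"
    by (auto simp: box_def Basis_complex_def space_pair_measure)
  show "emeasure (distr (lborel \<Otimes>\<^sub>M lborel) borel (\<lambda>(x, y). Complex x y)) (box l u) = (\<Prod>b\<in>Basis. (u - l) \<bullet> b)"
    using le[of 1] le[of \<i>]
    by (subst emeasure_distr) (auto simp: eq lborel.emeasure_pair_measure_Times Basis_complex_def ennreal_mult)
qed simp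

lemma nn_integral_lborel_complex:
  fixes v :: "complex \<Rightarrow> ennreal"
  assumes [measurable]: "v \<in> borel_measurable borel"
  shows "(\<integral>\<^sup>+z. v z \<partial>lborel) = (\<integral>\<^sup>+x. \<integral>\<^sup>+y. v (Complex x y) \<partial>lborel \<partial>lborel)"
    and "(\<integral>\<^sup>+z. v z \<partial>lborel) = (\<integral>\<^sup>+y. \<integral>\<^sup>+x. v (Complex x y) \<partial>lborel \<partial>lborel)"
proof -
  have m: "(\<lambda>(x, y). Complex x y) \<in> borel_measurable (lborel \<Otimes>\<^sub>M lborel)"
    unfolding lborel_prod
    by (auto simp: case_prod_unfold Complex_eq intro!: borel_measurable_continuous_onI continuous_intros)
  have m2: "case_prod (\<lambda>x y. v (Complex x y)) \<in> borel_measurable (lborel \<Otimes>\<^sub>M lborel)"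
    using measurable_compose[OF m assms] by (simp add: case_prod_unfold)
  show *: "(\<integral>\<^sup>+z. v z \<partial>lborel) = (\<integral>\<^sup>+x. \<integral>\<^sup>+y. v (Complex x y) \<partial>lborel \<partial>lborel)"
    using m m2 by (subst lborel_complex_eq) (simp add: nn_integral_distr lborel.nn_integral_fst[symmetric] case_prod_unfold)
  show "(\<integral>\<^sup>+z. v z \<partial>lborel) = (\<integral>\<^sup>+y. \<integral>\<^sup>+x. v (Complex x y) \<partial>lborel \<partial>lborel)"
    unfolding * using lborel_pair.Fubini'[OF m2] by simp
qed

text \<open>On every horizontal (respectively vertical) line a shear is a translation, so Fubini
  reduces the claim to the real line.\<close>

lemma nn_integral_complex_shear:
  fixes v :: "complex \<Rightarrow> ennreal"
  assumes [measurable]: "v \<in> borel_measurable borel"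
  shows "(\<integral>\<^sup>+z. v (z + of_real (a * Im z)) \<partial>lborel) = (\<integral>\<^sup>+z. v z \<partial>lborel)"
    and "(\<integral>\<^sup>+z. v (z + \<i> * of_real (a * Re z)) \<partial>lborel) = (\<integral>\<^sup>+z. v z \<partial>lborel)"
proof -
  have [measurable]: "(\<lambda>z. v (z + of_real (a * Im z))) \<in> borel_measurable borel"
    by (intro measurable_compose[OF _ assms] borel_measurable_continuous_onI continuous_intros)
  have [measurable]: "(\<lambda>z. v (z + \<i> * of_real (a * Re z))) \<in> borel_measurable borel"
    by (intro measurable_compose[OF _ assms] borel_measurable_continuous_onI continuous_intros)
  have m: "(\<lambda>x. v (Complex x y)) \<in> borel_measurable borel" "(\<lambda>x. v (Complex y x)) \<in> borel_measurable borel" for y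
    by (auto intro!: measurable_compose[OF _ assms] borel_measurable_continuous_onI continuous_intros simp: Complex_eq)
  have e1: "Complex x y + of_real (a * y) = Complex (a * y + 1 * x) y" for x y
    by (simp add: complex_eq_iff)
  have e2: "Complex x y + \<i> * of_real (a * x) = Complex x (a * x + 1 * y)" for x y
    by (simp add: complex_eq_iff)
  show "(\<integral>\<^sup>+z. v (z + of_real (a * Im z)) \<partial>lborel) = (\<integral>\<^sup>+z. v z \<partial>lborel)"
    by (simp add: nn_integral_lborel_complex(2) e1 nn_integral_real_affine[OF m(1), symmetric, where c=1, simplified]
        del: mult_1 of_real_mult complex_add)
  show "(\<integral>\<^sup>+z. v (z + \<i> * of_real (a * Re z)) \<partial>lborel) = (\<integral>\<^sup>+z. v z \<partial>lborel)"
    by (simp add: nn_integral_lborel_complex(1) e2 del: mult_1 of_real_mult complex_add)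
      (simp add: nn_integral_real_affine[OF m(2), where c=1, symmetric, simplified])
qed

lemma nn_integral_complex_rotate:
  fixes v :: "complex \<Rightarrow> ennreal"
  assumes v: "v \<in> borel_measurable borel" and c: "norm c = 1"
  shows "(\<integral>\<^sup>+z. v (c * z) \<partial>lborel) = (\<integral>\<^sup>+z. v z \<partial>lborel)"
proof -
  have main: "(\<integral>\<^sup>+z. v (c * z) \<partial>lborel) = (\<integral>\<^sup>+z. v z \<partial>lborel)"
    if v: "v \<in> borel_measurable borel" and c: "norm c = 1" "c \<noteq> -1" for v :: "complex \<Rightarrow> ennreal" and c
  proof -
    define x y where "x = Re c" and "y = Im c"
    have xy: "x\<^sup>2 + y\<^sup>2 = 1" using c by (simp add: cmod_def x_def y_def)
    have x1: "1 + x \<noteq> 0"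
    proof
      assume "1 + x = 0"
      then have "x = -1" by simp
      with xy have "y = 0" by simp
      with \<open>x = -1\<close> c show False by (auto simp: x_def y_def complex_eq_iff)
    qed
    \<comment> \<open>Minus the tangent of half the angle of \<open>c\<close>. The two outer shears
      have slope \<open>a\<close>, the middle one has the sine \<open>y\<close> as its
      slope.\<close>
    define a where "a = - y / (1 + x)"
    have a1: "1 + a * y = x"
      using x1 xy by (simp add: a_def field_simps power2_eq_square)
    have a2: "a * (1 + x) = - y" using x1 by (simp add: a_def)
    \<comment> \<open>a rotation is the product of three shears\<close>
    define S where "S = (\<lambda>z. z + of_real (a * Im z))"
    define T where "T = (\<lambda>z. z + \<i> * of_real (y * Re z))"
    have eq: "c * z = S (T (S z))" for z
    proof (rule complex_eqI)
      show "Im (c * z) = Im (S (T (S z)))"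
        unfolding S_def T_def by (simp add: x_def[symmetric] y_def[symmetric] a1[symmetric] algebra_simps)
    next
      have "Re (S (T (S z))) = (1 + a * y) * Re z + (a * (1 + (1 + a * y))) * Im z"
        unfolding S_def T_def by (simp add: algebra_simps)
      also have "\<dots> = x * Re z - y * Im z" by (simp only: a1 a2)
      finally show "Re (c * z) = Re (S (T (S z)))"
        by (simp add: x_def y_def)
    qed
    have m: "S \<in> borel_measurable borel" "T \<in> borel_measurable borel"
      unfolding S_def T_def by (intro borel_measurable_continuous_onI continuous_intros)+
    have mv: "(\<lambda>z. v (S z)) \<in> borel_measurable borel" "(\<lambda>z. v (S (T z))) \<in> borel_measurable borel"
      using m v by measurable
    show ?thesis
      using nn_integral_complex_shear(1)[OF mv(2), of a] nn_integral_complex_shear(2)[OF mv(1), of y]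
        nn_integral_complex_shear(1)[OF v, of a]
      by (simp add: eq) (simp add: S_def T_def)
  qed
  show ?thesis
  proof (cases "c = -1")
    \<comment> \<open>The half turn, where 1 + x vanishes, is two quarter turns.\<close>
    case True
    have "\<i> \<noteq> -1" by (simp add: complex_eq_iff)
    moreover have "(\<lambda>z. v (\<i> * z)) \<in> borel_measurable borel" using v by measurable
    ultimately show ?thesis
      using True main[of "\<lambda>z. v (\<i> * z)" \<i>] main[of v \<i>] v by (simp add: mult.assoc[symmetric])
  qed (use main v c in blast)
qed

text \<open>The image of area under the modulus and the measure with density 2 pi r agree on all
  half lines {x<..}: for 0 \<le> x < 1 both give the area of the annulus outside radius x. Finite
  values on half lines determine the measure.\<close>

lemma nn_integral_disc_radial:
  fixes A :: "real \<Rightarrow> ennreal"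
  assumes [measurable]: "A \<in> borel_measurable borel"
  shows "(\<integral>\<^sup>+z\<in>unit_disc. A (norm z) \<partial>lborel) = (\<integral>\<^sup>+r\<in>{0..<1}. A r * ennreal (2 * pi * r) \<partial>lborel)"
proof -
  let ?M = "distr (density lborel (indicator unit_disc)) borel (norm :: complex \<Rightarrow> real)"
  let ?N = "density lborel (\<lambda>r. ennreal (2 * pi * r) * indicator {0..<1} r)"
  have M: "emeasure ?M {x<..} = ennreal (if x < 0 then pi else if x < 1 then pi - pi * x\<^sup>2 else 0)" for x
  proof -
    have "emeasure ?M {x<..} = emeasure lborel (unit_disc - cball 0 x)"
    proof -
      have "norm -` {x<..} = - cball (0::complex) x" by auto
      then have "emeasure ?M {x<..} = emeasure (density lborel (indicator unit_disc)) (- cball 0 x)"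
        by (subst emeasure_distr) auto
      also have "\<dots> = (\<integral>\<^sup>+z. indicator unit_disc z * indicator (- cball 0 x) z \<partial>lborel)"
        by (rule emeasure_density) (auto intro!: borel_measurable_indicator)
      also have "\<dots> = (\<integral>\<^sup>+z. indicator (unit_disc - cball 0 x) z \<partial>lborel)"
        by (rule nn_integral_cong) (auto simp: indicator_def)
      also have "\<dots> = emeasure lborel (unit_disc - cball 0 x)" by (rule nn_integral_indicator) simp
      finally show ?thesis .
    qed
    also have "\<dots> = ennreal (if x < 0 then pi else if x < 1 then pi - pi * x\<^sup>2 else 0)"
    proof -
      consider "x < 0" | "0 \<le> x" "x < 1" | "1 \<le> x" by linarith
      then show ?thesis
      proof cases
        case 1
        then show ?thesis by (simp add: emeasure_ball eval_unit_ball_vol)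
      next
        case 2
        then show ?thesis
          by (subst emeasure_Diff) (auto simp: emeasure_ball emeasure_cball eval_unit_ball_vol ennreal_minus)
      next
        case 3
        then have empty: "unit_disc - cball 0 x = {}" by auto
        show ?thesis using 3 by (subst empty) simp
      qed
    qed
    finally show ?thesis .
  qed
  have N: "emeasure ?N {x<..} = ennreal (if x < 0 then pi else if x < 1 then pi - pi * x\<^sup>2 else 0)" for x
  proof -
    define y where "y = min 1 (max x 0)"
    have "emeasure ?N {x<..} = (\<integral>\<^sup>+r. ennreal (2 * pi * r) * indicator {0..<1} r * indicator {x<..} r \<partial>lborel)"
      by (subst emeasure_density) auto
    also have "\<dots> = (\<integral>\<^sup>+r. ennreal (2 * pi * r) * indicator {y..1} r \<partial>lborel)"
    proof (rule nn_integral_cong_AE)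
      show "AE r in lborel. ennreal (2 * pi * r) * indicator {0..<1} r * indicator {x<..} r =
          ennreal (2 * pi * r) * indicator {y..1} r"
        using AE_lborel_singleton[of 1] AE_lborel_singleton[of x] AE_lborel_singleton[of 0]
        by eventually_elim (auto simp: y_def indicator_def)
    qed
    also have "\<dots> = ennreal (pi * 1\<^sup>2 - pi * y\<^sup>2)"
      by (intro nn_integral_FTC_Icc) (auto simp: y_def intro!: derivative_eq_intros)
    finally show ?thesis by (auto simp: y_def max_def min_def)
  qed
  have "?M = ?N"
    by (rule measure_eqI_lessThan) (simp_all only: M N sets_distr sets_density sets_lborel, auto)
  have "(\<integral>\<^sup>+z\<in>unit_disc. A (norm z) \<partial>lborel) = (\<integral>\<^sup>+r. A r \<partial>?M)"
    by (subst nn_integral_distr, simp, simp, subst nn_integral_density)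
      (auto intro!: borel_measurable_indicator simp: mult.commute)
  also have "\<dots> = (\<integral>\<^sup>+r\<in>{0..<1}. A r * ennreal (2 * pi * r) \<partial>lborel)"
    unfolding \<open>?M = ?N\<close> by (simp add: nn_integral_density mult_ac)
  finally show ?thesis .
qed

text \<open>Rotation invariance takes the place of a change of variables: averaging the integral
  over all rotations replaces \<open>v\<close> by its circular mean, which is radial and covered by
  \<open>nn_integral_disc_radial\<close>. The factor 2 pi cancels at the end.\<close>

lemma nn_integral_disc_polar:
  fixes v :: "complex \<Rightarrow> ennreal"
  assumes v[measurable]: "v \<in> borel_measurable borel"
  shows "(\<integral>\<^sup>+z\<in>unit_disc. v z \<partial>lborel) =
    (\<integral>\<^sup>+r\<in>{0..<1}. (\<integral>\<^sup>+t\<in>{0..2 * pi}. v (of_real r * cis t) \<partial>lborel) * ennreal r \<partial>lborel)"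
proof -
  define A where "A r = (\<integral>\<^sup>+t\<in>{0..2 * pi}. v (of_real r * cis t) \<partial>lborel)" for r
  have [measurable]: "cis \<in> borel_measurable borel"
    by (intro borel_measurable_continuous_onI continuous_intros)
  have [measurable]: "unit_disc \<in> sets borel" by simp
  have [measurable]: "A \<in> borel_measurable borel" unfolding A_def by measurable
  have avg: "(\<integral>\<^sup>+t\<in>{0..2 * pi}. v (cis t * z) \<partial>lborel) = A (norm z)" for z
  proof -
    have "v (cis t * z) = v (of_real (norm z) * cis (t + Arg z))" for t
      by (subst rcis_cmod_Arg[of z, symmetric]) (simp add: rcis_def cis_mult[symmetric] mult_ac)
    then show ?thesis unfolding A_def
      using nn_integral_periodic_shift[of "\<lambda>t. v (of_real (norm z) * cis t)" "2 * pi" "Arg z"]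
      by (simp add: cis_mult[symmetric])
  qed
  have rot: "(\<integral>\<^sup>+z. v z * indicator unit_disc z \<partial>lborel) =
      (\<integral>\<^sup>+z. v (cis t * z) * indicator unit_disc z \<partial>lborel)" for t
  proof -
    have "(\<lambda>z. v z * indicator unit_disc z) \<in> borel_measurable borel"
      by (intro borel_measurable_times_ennreal borel_measurable_indicator) (use v in auto)
    from nn_integral_complex_rotate[OF this, of "cis t"] show ?thesis
      by (simp add: indicator_def norm_mult)
  qed
  have "ennreal (2 * pi) * (\<integral>\<^sup>+z\<in>unit_disc. v z \<partial>lborel) =
      (\<integral>\<^sup>+t\<in>{0..2 * pi}. (\<integral>\<^sup>+z. v z * indicator unit_disc z \<partial>lborel) \<partial>lborel)"
    by (subst nn_integral_cmult) (auto simp: mult_ac)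
  also have "\<dots> = (\<integral>\<^sup>+t\<in>{0..2 * pi}. (\<integral>\<^sup>+z. v (cis t * z) * indicator unit_disc z \<partial>lborel) \<partial>lborel)"
    by (simp only: rot[symmetric])
  also have "\<dots> = (\<integral>\<^sup>+t. (\<integral>\<^sup>+z. v (cis t * z) * indicator unit_disc z * indicator {0..2*pi} t \<partial>lborel) \<partial>lborel)"
    by (subst nn_integral_multc) auto
  also have "\<dots> = (\<integral>\<^sup>+z. (\<integral>\<^sup>+t. v (cis t * z) * indicator unit_disc z * indicator {0..2*pi} t \<partial>lborel) \<partial>lborel)"
    by (rule lborel_pair.Fubini'[symmetric]) measurable
  also have "\<dots> = (\<integral>\<^sup>+z. (\<integral>\<^sup>+t\<in>{0..2*pi}. v (cis t * z) \<partial>lborel) * indicator unit_disc z \<partial>lborel)"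
    by (subst nn_integral_multc[symmetric]) (auto simp: mult_ac)
  also have "\<dots> = (\<integral>\<^sup>+r\<in>{0..<1}. A r * ennreal (2 * pi * r) \<partial>lborel)"
    by (simp add: avg nn_integral_disc_radial)
  also have "\<dots> = ennreal (2 * pi) * (\<integral>\<^sup>+r\<in>{0..<1}. A r * ennreal r \<partial>lborel)"
  proof -
    have "ennreal (2 * pi * r) = ennreal (2 * pi) * ennreal r" for r
      by (rule ennreal_mult') simp
    then show ?thesis by (subst nn_integral_cmult[symmetric]) (simp_all only: mult_ac, measurable)
  qed
  finally show ?thesis
    unfolding A_def by (subst (asm) ennreal_mult_cancel_left) auto
qed

section \<open>A Hardy inequality\<close>

lemma nn_integral_powr_0:
  assumes "-1 < \<gamma>" "0 \<le> c"
  shows "(\<integral>\<^sup>+u\<in>{0..c}. ennreal (u powr \<gamma>) \<partial>lborel) = ennreal (c powr (\<gamma> + 1) / (\<gamma> + 1))"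
proof -
  have "((\<lambda>u. if u \<in> {0..c} then u powr \<gamma> else 0) has_integral (c powr (\<gamma> + 1) / (\<gamma> + 1))) UNIV"
    using has_integral_powr_from_0[OF assms] by (subst has_integral_restrict_UNIV)
  then have "(\<integral>\<^sup>+u. ennreal (if u \<in> {0..c} then u powr \<gamma> else 0) \<partial>lborel) = ennreal (c powr (\<gamma> + 1) / (\<gamma> + 1))"
    by (intro nn_integral_has_integral_lborel) auto
  moreover have "(\<integral>\<^sup>+u\<in>{0..c}. ennreal (u powr \<gamma>) \<partial>lborel) =
      (\<integral>\<^sup>+u. ennreal (if u \<in> {0..c} then u powr \<gamma> else 0) \<partial>lborel)"
    by (rule nn_integral_cong) (auto simp: indicator_def)
  ultimately show ?thesis by simp
qed

lemma nn_integral_one_minus_powr: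
  assumes "-1 < \<gamma>" "s \<le> 1"
  shows "(\<integral>\<^sup>+r\<in>{s..<1}. ennreal ((1 - r) powr \<gamma>) \<partial>lborel) = ennreal ((1 - s) powr (\<gamma> + 1) / (\<gamma> + 1))"
proof -
  have "(\<integral>\<^sup>+r\<in>{s..1}. ennreal ((1 - r) powr \<gamma>) \<partial>lborel) = (\<integral>\<^sup>+u\<in>{0..1-s}. ennreal (u powr \<gamma>) \<partial>lborel)"
    by (subst nn_integral_real_affine[where c="-1" and t=1]) (auto intro!: nn_integral_cong simp: indicator_def)
  also have "\<dots> = ennreal ((1 - s) powr (\<gamma> + 1) / (\<gamma> + 1))"
    using assms by (intro nn_integral_powr_0) auto
  finally show ?thesis by (simp only: nn_integral_Ico_Icc)
qed

lemma powr_add_le: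
  fixes x y p :: real
  assumes "0 \<le> x" "0 \<le> y" "0 < p"
  shows "(x + y) powr p \<le> 2 powr p * (x powr p + y powr p)"
proof -
  have "(x + y) powr p \<le> (2 * max x y) powr p" using assms by (intro powr_mono2) auto
  also have "\<dots> = 2 powr p * (max x y powr p)" using assms by (simp add: powr_mult)
  also have "\<dots> \<le> 2 powr p * (x powr p + y powr p)" by (intro mult_left_mono) (auto simp: max_def)
  finally show ?thesis .
qed

definition Phi :: "(real \<Rightarrow> real) \<Rightarrow> real \<Rightarrow> real \<Rightarrow> real"
  where "Phi a b r = (LINT t|lborel. a t * (1 - t * r) powr (- b))"

text \<open>Models |f| on the radius, extended by zero off [0,1). Finite mass means that f is
  integrable along the radius.\<close>

locale radial_mass =
  fixes a :: "real \<Rightarrow> real"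
  assumes integrable_mass: "integrable lborel a"
    and mass_nonneg: "0 \<le> a t"
    and mass_supp: "t \<notin> {0..<1} \<Longrightarrow> a t = 0"
begin

lemma mass_measurable [measurable]: "a \<in> borel_measurable borel"
  using integrable_mass by (simp add: integrable_iff_bounded)

lemma kernel_bounds:
  fixes t r :: real
  assumes "t \<in> {0..<1}" "0 \<le> r" "r < 1"
  shows "1 - r \<le> 1 - t * r" "1 - t * r \<le> 1" "0 < 1 - t * r"
  using assms mult_left_le_one_le[of r t] mult_nonneg_nonneg[of t r] by auto

lemma integrable_mass_times:
  fixes k :: "real \<Rightarrow> 'b::{banach, second_countable_topology, real_normed_algebra_1}"
  assumes [measurable]: "k \<in> borel_measurable borel" and "\<And>t. t \<in> {0..<1} \<Longrightarrow> norm (k t) \<le> B"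
  shows "integrable lborel (\<lambda>t. of_real (a t) * k t)"
proof (rule Bochner_Integration.integrable_bound[where f="\<lambda>t. B * a t"])
  show "AE t in lborel. norm (of_real (a t) * k t) \<le> norm (B * a t)"
  proof (intro AE_I2)
    fix t
    show "norm (of_real (a t) * k t) \<le> norm (B * a t)"
    proof (cases "t \<in> {0..<1}")
      case True
      have "norm (of_real (a t) * k t) \<le> a t * norm (k t)"
        using norm_mult_ineq[of "of_real (a t)" "k t"] mass_nonneg[of t] by simp
      also have "\<dots> \<le> a t * \<bar>B\<bar>" using assms(2)[OF True] mass_nonneg by (intro mult_left_mono) auto
      finally show ?thesis using mass_nonneg[of t] by (simp add: abs_mult mult.commute)
    qed (simp add: mass_supp)
  qed
qed (use integrable_mass in auto)

lemma Phi_integrable: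
  assumes "0 \<le> r" "r < 1" "0 \<le> b"
  shows "integrable lborel (\<lambda>t. a t * (1 - t * r) powr (- b))"
proof -
  have "integrable lborel (\<lambda>t. of_real (a t) * (1 - t * r) powr (- b))"
  proof (rule integrable_mass_times)
    fix t :: real assume "t \<in> {0..<1}"
    then show "norm ((1 - t * r) powr (- b)) \<le> (1 - r) powr (- b)"
      using kernel_bounds[of t r] assms by (auto intro!: powr_mono2')
  qed measurable
  then show ?thesis by simp
qed

lemma Phi_nonneg: "0 \<le> Phi a b r"
  unfolding Phi_def by (intro integral_nonneg_AE AE_I2) (simp add: mass_nonneg)

lemma Phi_measurable [measurable]: "Phi a b \<in> borel_measurable borel"
  unfolding Phi_def by measurable

lemma Phi_0: "0 \<le> r \<Longrightarrow> r < 1 \<Longrightarrow> Phi a 0 r = integral\<^sup>L lborel a"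
  unfolding Phi_def
proof (intro Bochner_Integration.integral_cong refl)
  fix t assume "0 \<le> r" "r < 1"
  then show "a t * (1 - t * r) powr - 0 = a t"
    using kernel_bounds(3)[of t r] mass_supp[of t] by (cases "t \<in> {0..<1}") auto
qed

lemma Phi_eq_nn_integral:
  assumes "0 \<le> r" "r < 1" "0 \<le> b"
  shows "ennreal (Phi a b r) = (\<integral>\<^sup>+t. ennreal (a t * (1 - t * r) powr (- b)) \<partial>lborel)"
  unfolding Phi_def using Phi_integrable[OF assms]
  by (intro nn_integral_eq_integral[symmetric]) (auto simp: mass_nonneg)

lemma Phi_mono:
  assumes "0 \<le> r" "r \<le> s" "s < 1" "0 \<le> b"
  shows "Phi a b r \<le> Phi a b s"
  unfolding Phi_def
proof (intro integral_mono Phi_integrable)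
  fix t
  show "a t * (1 - t * r) powr - b \<le> a t * (1 - t * s) powr - b"
  proof (cases "t \<in> {0..<1}")
    case True
    then show ?thesis using kernel_bounds[of t s] assms mult_left_mono[of r s t]
      by (intro mult_left_mono powr_mono2') (auto simp: mass_nonneg)
  qed (simp add: mass_supp)
qed (use assms in auto)

lemma Phi_mono_exp:
  assumes "0 \<le> r" "r < 1" "0 \<le> b" "b \<le> c"
  shows "Phi a b r \<le> Phi a c r"
  unfolding Phi_def
proof (intro integral_mono Phi_integrable)
  fix t
  show "a t * (1 - t * r) powr - b \<le> a t * (1 - t * r) powr - c"
  proof (cases "t \<in> {0..<1}")
    case True
    then show ?thesis using kernel_bounds[of t r] assms
      by (intro mult_left_mono powr_mono') (auto simp: mass_nonneg)
  qed (simp add: mass_supp)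
qed (use assms in auto)

lemma mass_le_Phi:
  assumes "0 \<le> r" "r < 1" "0 \<le> b"
  shows "integral\<^sup>L lborel a \<le> Phi a b r"
  using Phi_mono_exp[of r 0 b] Phi_0[of r] assms by simp

text \<open>The kernel (1 - t r)^(-(b - q)) is 1 plus the integral of its derivative over [0, r].
  Since 1 - s \<le> 1 - t s and q \<le> 1, the factor (1 - t s)^(q - 1) in that derivative is at
  most (1 - s)^(q - 1), which no longer involves t. Tonelli then leaves \<open>Phi a b s\<close>
  under a one-dimensional integral.\<close>

lemma Phi_le_integral:
  assumes r: "0 \<le> r" "r < 1" and q: "q \<le> 1" "q \<le> b" "0 \<le> b"
  shows "ennreal (Phi a (b - q) r) \<le> ennreal (integral\<^sup>L lborel a) +
    ennreal (b - q) * (\<integral>\<^sup>+s\<in>{0..r}. ennreal (Phi a b s * (1 - s) powr (q - 1)) \<partial>lborel)"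
proof -
  let ?k = "\<lambda>t s. (1 - t * s) powr (- b) * (1 - s) powr (q - 1)"
  have k: "ennreal ((1 - t * r) powr (- (b - q))) \<le>
      1 + ennreal (b - q) * (\<integral>\<^sup>+s\<in>{0..r}. ennreal (?k t s) \<partial>lborel)" if t: "t \<in> {0..<1}" for t
  proof -
    let ?d = "\<lambda>s. if s \<in> {0..r} then (b - q) * t * (1 - t * s) powr (- (b - q) - 1) else 0"
    have le: "?d s \<le> (b - q) * ?k t s" if "s \<in> {0..r}" for s
    proof -
      have "(1 - t * s) powr (q - 1) \<le> (1 - s) powr (q - 1)"
        using kernel_bounds[of t s] t that r q by (intro powr_mono2') auto
      then have "t * ((1 - t * s) powr (- b) * (1 - t * s) powr (q - 1)) \<le> 1 * ?k t s"
        using t by (intro mult_mono) auto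
      moreover have "(1 - t * s) powr (- (b - q) - 1) = (1 - t * s) powr (- b) * (1 - t * s) powr (q - 1)"
        by (simp add: powr_add[symmetric] algebra_simps)
      ultimately have "(b - q) * (t * (1 - t * s) powr (- (b - q) - 1)) \<le> (b - q) * ?k t s"
        using q by (intro mult_left_mono) auto
      then show ?thesis using that by (simp add: mult_ac)
    qed
    have "(\<integral>\<^sup>+s. ennreal (?d s) * indicator {0..r} s \<partial>lborel) =
        ennreal ((1 - t * r) powr (- (b - q)) - (1 - t * 0) powr (- (b - q)))"
    proof (rule nn_integral_FTC_Icc)
      fix s assume s: "s \<in> {0..r}"
      then have pos: "0 < 1 - t * s" using kernel_bounds[of t s] t r by auto
      have "((\<lambda>s. 1 - t * s) has_real_derivative - t) (at s)" by (auto intro!: derivative_eq_intros)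
      from DERIV_fun_powr[OF this pos, of "- (b - q)"]
      show "((\<lambda>s. (1 - t * s) powr (- (b - q))) has_real_derivative ?d s) (at s)"
        using s by (simp add: algebra_simps)
      show "0 \<le> ?d s" using q t by auto
    qed (use r in auto)
    then have "ennreal ((1 - t * r) powr (- (b - q)) - 1) = (\<integral>\<^sup>+s. ennreal (?d s) * indicator {0..r} s \<partial>lborel)"
      by simp
    also have "\<dots> \<le> (\<integral>\<^sup>+s. ennreal (b - q) * (ennreal (?k t s) * indicator {0..r} s) \<partial>lborel)"
    proof (rule nn_integral_mono)
      fix s
      show "ennreal (?d s) * indicator {0..r} s \<le> ennreal (b - q) * (ennreal (?k t s) * indicator {0..r} s)"
        using le[of s] q by (auto simp: indicator_def ennreal_mult'[symmetric] intro!: ennreal_leI)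
    qed
    also have "\<dots> = ennreal (b - q) * (\<integral>\<^sup>+s\<in>{0..r}. ennreal (?k t s) \<partial>lborel)"
      by (rule nn_integral_cmult) measurable
    finally have *: "ennreal ((1 - t * r) powr (- (b - q)) - 1) \<le> \<dots>" .
    have "1 \<le> (1 - t * r) powr (- (b - q))"
      using powr_mono'[of "-(b-q)" 0 "1 - t * r"] kernel_bounds[of t r] t r q by auto
    then have "ennreal ((1 - t * r) powr (- (b - q))) = 1 + ennreal ((1 - t * r) powr (- (b - q)) - 1)"
      by (simp add: ennreal_plus[symmetric] ennreal_1[symmetric] del: ennreal_plus ennreal_1)
    then show ?thesis using * by (simp add: add_left_mono)
  qed
  have "ennreal (Phi a (b - q) r) = (\<integral>\<^sup>+t. ennreal (a t) * ennreal ((1 - t * r) powr (- (b - q))) \<partial>lborel)"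
    using r q by (subst Phi_eq_nn_integral) (auto simp: ennreal_mult mass_nonneg)
  also have "\<dots> \<le> (\<integral>\<^sup>+t. ennreal (a t) + ennreal (b - q) * (\<integral>\<^sup>+s. ennreal (a t) * (ennreal (?k t s) * indicator {0..r} s) \<partial>lborel) \<partial>lborel)"
  proof (rule nn_integral_mono)
    fix t
    show "ennreal (a t) * ennreal ((1 - t * r) powr (- (b - q))) \<le> ennreal (a t) + ennreal (b - q) * (\<integral>\<^sup>+s. ennreal (a t) * (ennreal (?k t s) * indicator {0..r} s) \<partial>lborel)"
    proof (cases "t \<in> {0..<1}")
      case True
      have "ennreal (a t) * ennreal ((1 - t * r) powr (- (b - q))) \<le> ennreal (a t) * (1 + ennreal (b - q) * (\<integral>\<^sup>+s\<in>{0..r}. ennreal (?k t s) \<partial>lborel))"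
        using k[OF True] by (rule mult_left_mono) simp
      then show ?thesis by (subst nn_integral_cmult) (auto simp: algebra_simps)
    qed (simp add: mass_supp)
  qed
  also have "\<dots> = (\<integral>\<^sup>+t. ennreal (a t) \<partial>lborel) + ennreal (b - q) * (\<integral>\<^sup>+t. \<integral>\<^sup>+s. ennreal (a t) * (ennreal (?k t s) * indicator {0..r} s) \<partial>lborel \<partial>lborel)"
    by (subst nn_integral_add, measurable, subst nn_integral_cmult, measurable)
  also have "(\<integral>\<^sup>+t. ennreal (a t) \<partial>lborel) = ennreal (integral\<^sup>L lborel a)"
    using integrable_mass by (intro nn_integral_eq_integral) (auto simp: mass_nonneg)
  also have "(\<integral>\<^sup>+t. \<integral>\<^sup>+s. ennreal (a t) * (ennreal (?k t s) * indicator {0..r} s) \<partial>lborel \<partial>lborel) =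
      (\<integral>\<^sup>+s. \<integral>\<^sup>+t. ennreal (a t) * (ennreal (?k t s) * indicator {0..r} s) \<partial>lborel \<partial>lborel)"
    by (rule lborel_pair.Fubini'[symmetric]) measurable
  also have "\<dots> = (\<integral>\<^sup>+s\<in>{0..r}. ennreal (Phi a b s * (1 - s) powr (q - 1)) \<partial>lborel)"
  proof (rule nn_integral_cong)
    fix s
    show "(\<integral>\<^sup>+t. ennreal (a t) * (ennreal (?k t s) * indicator {0..r} s) \<partial>lborel) = ennreal (Phi a b s * (1 - s) powr (q - 1)) * indicator {0..r} s"
    proof (cases "s \<in> {0..r}")
      case True
      then have "(\<integral>\<^sup>+t. ennreal (a t) * (ennreal (?k t s) * indicator {0..r} s) \<partial>lborel)
        = (\<integral>\<^sup>+t. ennreal (a t * (1 - t * s) powr (- b)) * ennreal ((1 - s) powr (q - 1)) \<partial>lborel)"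
        by (intro nn_integral_cong) (auto simp: ennreal_mult mass_nonneg mult_ac)
      also have "\<dots> = ennreal (Phi a b s) * ennreal ((1 - s) powr (q - 1))"
        using True r q by (subst nn_integral_multc) (auto simp: Phi_eq_nn_integral)
      finally show ?thesis using True by (simp add: ennreal_mult Phi_nonneg)
    qed simp
  qed
  finally show ?thesis .
qed

text \<open>Jensen's inequality for the integral bound of \<open>Phi_le_integral\<close>. The weight
  has mass of order (1 - r)^(1 - d), and (d - 1) (p - 1) = e turns the Jensen factor into (1 -
  r)^(-e). With q = 1 / p the power of 1 - s left under the integral is (q - 1 + d) p - d, which is
  again e. Subtracting the total mass removes the constant term, which has no decay to gain
  from.\<close>

lemma Phi_hardy_pointwise:
  assumes p: "1 < p" and e: "0 < e" and b: "1 / p < b" and r: "0 \<le> r" "r < 1"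
  shows "ennreal ((Phi a (b - 1 / p) r - integral\<^sup>L lborel a) powr p) \<le>
    ennreal (((b - 1 / p) * (p - 1) / e) powr (p - 1) * (b - 1 / p) * (1 - r) powr (- e)) *
      (\<integral>\<^sup>+s\<in>{0..r}. ennreal (Phi a b s powr p * (1 - s) powr e) \<partial>lborel)"
proof -
  define q where "q = 1 / p"
  have q: "0 < q" "q < 1" "q < b" using p b by (auto simp: q_def)
  define c where "c = b - q"
  have c: "0 < c" using q by (simp add: c_def)
  \<comment> \<open>the Schur-type test weight \<open>(1 - s) powr (- d)\<close>\<close>
  define d where "d = 1 + e / (p - 1)"
  have d: "1 < d" "(d - 1) * (p - 1) = e" using p e by (auto simp: d_def)
  define w where "w s = (if s \<in> {0..r} then c * (1 - s) powr (- d) else 0)" for s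
  define u where "u s = (if s \<in> {0..r} then Phi a b s * (1 - s) powr (q - 1 + d) else 0)" for s
  define Y where "Y = Phi a (b - q) r - integral\<^sup>L lborel a"
  define W where "W = c / (d - 1) * (1 - r) powr (1 - d)"
  have W: "0 < W" using c d r by (simp add: W_def)
  have Y: "0 \<le> Y" using mass_le_Phi[of r "b - q"] r q by (simp add: Y_def)
  have [measurable]: "w \<in> borel_measurable borel" "u \<in> borel_measurable borel"
    unfolding w_def u_def by measurable
  have "(\<integral>\<^sup>+s. ennreal (w s) * indicator {0..r} s \<partial>lborel) = ennreal (c / (d - 1) * (1 - r) powr (1 - d) - c / (d - 1) * (1 - 0) powr (1 - d))"
  proof (rule nn_integral_FTC_Icc)
    fix s assume s: "s \<in> {0..r}"
    then have pos: "0 < 1 - s" using r by auto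
    have "((\<lambda>s. 1 - s) has_real_derivative - 1) (at s)" by (auto intro!: derivative_eq_intros)
    from DERIV_cmult[OF DERIV_fun_powr[OF this pos, of "1 - d"], of "c / (d - 1)"]
    show "((\<lambda>s. c / (d - 1) * (1 - s) powr (1 - d)) has_real_derivative w s) (at s)"
      by (rule DERIV_cong) (use s d in \<open>simp add: w_def field_simps\<close>)
    show "0 \<le> w s" using c by (simp add: w_def)
  qed (use r in auto)
  also have "\<dots> \<le> ennreal W" using c d by (auto simp: W_def intro!: ennreal_leI)
  also have "(\<integral>\<^sup>+s. ennreal (w s) * indicator {0..r} s \<partial>lborel) = (\<integral>\<^sup>+s. ennreal (w s) \<partial>lborel)"
    by (rule nn_integral_cong) (auto simp: w_def indicator_def)
  finally have wW: "(\<integral>\<^sup>+s. ennreal (w s) \<partial>lborel) \<le> ennreal W" .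
  have "ennreal (integral\<^sup>L lborel a) + ennreal Y = ennreal (Phi a (b - q) r)"
    using Y mass_nonneg by (subst ennreal_plus[symmetric]) (auto simp: Y_def)
  also have "\<dots> \<le> ennreal (integral\<^sup>L lborel a) + ennreal (b - q) * (\<integral>\<^sup>+s\<in>{0..r}. ennreal (Phi a b s * (1 - s) powr (q - 1)) \<partial>lborel)"
    using r q by (intro Phi_le_integral) auto
  finally have "ennreal Y \<le> ennreal c * (\<integral>\<^sup>+s\<in>{0..r}. ennreal (Phi a b s * (1 - s) powr (q - 1)) \<partial>lborel)"
    by (simp add: c_def)
  also have "\<dots> = (\<integral>\<^sup>+s. ennreal c * (ennreal (Phi a b s * (1 - s) powr (q - 1)) * indicator {0..r} s) \<partial>lborel)"
    by (rule nn_integral_cmult[symmetric]) measurable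
  also have "\<dots> = (\<integral>\<^sup>+s. ennreal (u s * w s) \<partial>lborel)"
  proof (rule nn_integral_cong)
    fix s
    have "(1 - s) powr (q - 1) = (1 - s) powr (q - 1 + d) * (1 - s) powr (- d)"
      by (simp add: powr_add[symmetric])
    then show "ennreal c * (ennreal (Phi a b s * (1 - s) powr (q - 1)) * indicator {0..r} s) = ennreal (u s * w s)"
      using c by (auto simp: u_def w_def indicator_def ennreal_mult'[symmetric] mult_ac)
  qed
  finally have "ennreal Y \<le> (\<integral>\<^sup>+s. ennreal (u s * w s) \<partial>lborel)" .
  then have "ennreal (Y powr p) \<le> ennreal (W powr (p - 1)) * (\<integral>\<^sup>+s. ennreal (u s powr p * w s) \<partial>lborel)"
    using W Y p wW c by (intro jensen_powr_nn_integral) (auto simp: u_def w_def Phi_nonneg)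
  also have "(\<integral>\<^sup>+s. ennreal (u s powr p * w s) \<partial>lborel) = (\<integral>\<^sup>+s. ennreal c * (ennreal (Phi a b s powr p * (1 - s) powr e) * indicator {0..r} s) \<partial>lborel)"
  proof (rule nn_integral_cong)
    fix s
    have "(q - 1 + d) * p - d = e" using d p by (simp add: q_def field_simps)
    then have "((1 - s) powr (q - 1 + d)) powr p * (1 - s) powr (- d) = (1 - s) powr e"
      by (simp add: powr_powr powr_add[symmetric])
    then show "ennreal (u s powr p * w s) = ennreal c * (ennreal (Phi a b s powr p * (1 - s) powr e) * indicator {0..r} s)"
      using c p by (auto simp: u_def w_def indicator_def ennreal_mult'[symmetric] powr_mult Phi_nonneg mult_ac)
  qed
  also have "\<dots> = ennreal c * (\<integral>\<^sup>+s\<in>{0..r}. ennreal (Phi a b s powr p * (1 - s) powr e) \<partial>lborel)"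
    by (rule nn_integral_cmult) measurable
  also have "ennreal (W powr (p - 1)) * (ennreal c * (\<integral>\<^sup>+s\<in>{0..r}. ennreal (Phi a b s powr p * (1 - s) powr e) \<partial>lborel))
     = ennreal ((c * (p - 1) / e) powr (p - 1) * c * (1 - r) powr (- e)) * (\<integral>\<^sup>+s\<in>{0..r}. ennreal (Phi a b s powr p * (1 - s) powr e) \<partial>lborel)"
  proof -
    have "c / (d - 1) = c * (p - 1) / e" by (simp add: d_def)
    moreover have "(1 - d) * (p - 1) = - e" using d(2) by (simp add: algebra_simps)
    moreover have "W powr (p - 1) = (c / (d - 1)) powr (p - 1) * ((1 - r) powr (1 - d)) powr (p - 1)"
      unfolding W_def by (rule powr_mult)
    ultimately have "W powr (p - 1) = (c * (p - 1) / e) powr (p - 1) * (1 - r) powr (- e)"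
      by (simp add: powr_powr)
    then show ?thesis using c by (simp add: mult.assoc[symmetric] ennreal_mult'[symmetric] ennreal_mult''[symmetric]) (simp add: mult_ac)
  qed
  finally show ?thesis by (simp add: Y_def c_def q_def)
qed

end

lemma Phi_hardy:
  assumes p: "1 < p" and \<alpha>: "-1 < \<alpha>" and b: "1 / p < b"
  shows "\<exists>K>0. \<forall>a. radial_mass a \<longrightarrow>
    (\<integral>\<^sup>+r\<in>{0..<1}. ennreal ((1 - r) powr \<alpha> * Phi a (b - 1 / p) r powr p) \<partial>lborel) \<le>
      ennreal K * (\<integral>\<^sup>+r\<in>{0..<1}. ennreal ((1 - r) powr (\<alpha> + 1) * Phi a b r powr p) \<partial>lborel)"
proof -
  \<comment> \<open>The r-integral of (1 - r)^(\<alpha> - e) over [s,1) must converge, so e <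
    \<alpha> + 1; at the midpoint it equals (1 - s)^e / e, and the two powers multiply to (1 -
    s)^(\<alpha> + 1).\<close>
  define e where "e = (\<alpha> + 1) / 2"
  have e: "0 < e" using \<alpha> by (simp add: e_def)
  have b0: "0 < b" using b p by (smt (verit) divide_pos_pos)
  define L where "L = ((b - 1 / p) * (p - 1) / e) powr (p - 1) * (b - 1 / p)"
  have L: "0 < L" using p e b by (simp add: L_def)
  \<comment> \<open>The factor 2^p splits \<open>Phi\<close> into the constant mass \<open>A\<close>
    and the rest \<open>Y\<close>. The first summand compares the integrals of the constant under
    the weights with exponents \<alpha> and \<alpha> + 1, the second is the Hardy estimate of
    \<open>Y\<close>. Nothing here depends on the mass \<open>a\<close>.\<close>
  define K where "K = 2 powr p * ((\<alpha> + 2) / (\<alpha> + 1) + L / e)"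
  have "0 < (\<alpha> + 2) / (\<alpha> + 1)" "0 < L / e" using L e \<alpha> by auto
  then have K: "0 < K" unfolding K_def by (intro mult_pos_pos add_pos_pos) auto
  show ?thesis
  proof (intro exI[of _ K] conjI K allI impI)
    fix a assume "radial_mass a"
    then interpret radial_mass a .
    define A where "A = integral\<^sup>L lborel a"
    have A: "0 \<le> A" unfolding A_def by (intro integral_nonneg_AE AE_I2 mass_nonneg)
    define R where "R = (\<integral>\<^sup>+r\<in>{0..<1}. ennreal ((1 - r) powr (\<alpha> + 1) * Phi a b r powr p) \<partial>lborel)"
    define Y where "Y r = Phi a (b - 1 / p) r - A" for r
    have [measurable]: "Y \<in> borel_measurable borel" unfolding Y_def by measurable
    have Y: "0 \<le> Y r" if "0 \<le> r" "r < 1" for r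
      using mass_le_Phi[of r "b - 1/p"] that b by (simp add: Y_def A_def)
    have A_int: "(\<integral>\<^sup>+r\<in>{0..<1}. ennreal ((1 - r) powr \<gamma> * A powr p) \<partial>lborel) = ennreal (A powr p / (\<gamma> + 1))"
      if "-1 < \<gamma>" for \<gamma>
    proof -
      have "(\<integral>\<^sup>+r\<in>{0..<1}. ennreal ((1 - r) powr \<gamma> * A powr p) \<partial>lborel) =
          (\<integral>\<^sup>+r. ennreal (A powr p) * (ennreal ((1 - r) powr \<gamma>) * indicator {0..<1} r) \<partial>lborel)"
        by (rule nn_integral_cong) (simp add: ennreal_mult mult_ac)
      also have "\<dots> = ennreal (A powr p) * ennreal ((1 - 0) powr (\<gamma> + 1) / (\<gamma> + 1))"
        using that by (subst nn_integral_cmult) (simp_all only: nn_integral_one_minus_powr, auto)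
      finally show ?thesis using that by (simp add: ennreal_mult'[symmetric])
    qed
    have "ennreal (A powr p / (\<alpha> + 1)) = ennreal ((\<alpha> + 2) / (\<alpha> + 1)) * ennreal (A powr p / (\<alpha> + 1 + 1))"
    proof -
      have "\<alpha> + 1 + 1 = \<alpha> + 2" by simp
      then have "A powr p / (\<alpha> + 1) = (\<alpha> + 2) / (\<alpha> + 1) * (A powr p / (\<alpha> + 1 + 1))"
        using \<alpha> by (simp only:) simp
      then show ?thesis using \<alpha> by (simp only: ennreal_mult'[symmetric] divide_nonneg_nonneg)
    qed
    also have "\<dots> \<le> ennreal ((\<alpha> + 2) / (\<alpha> + 1)) * R"
    proof (rule mult_left_mono)
      show "ennreal (A powr p / (\<alpha> + 1 + 1)) \<le> R"
        unfolding R_def using \<alpha> A p b0 mass_le_Phi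
        by (subst A_int[symmetric])
          (auto intro!: nn_integral_mono ennreal_leI mult_left_mono powr_mono2 simp: indicator_def A_def)
    qed simp
    finally have part1: "ennreal (A powr p / (\<alpha> + 1)) \<le> ennreal ((\<alpha> + 2) / (\<alpha> + 1)) * R" .
    let ?g = "\<lambda>s. ennreal (Phi a b s powr p * (1 - s) powr e)"
    have "(\<integral>\<^sup>+r\<in>{0..<1}. ennreal ((1 - r) powr \<alpha> * Y r powr p) \<partial>lborel) \<le>
        (\<integral>\<^sup>+r. (\<integral>\<^sup>+s. ennreal L * (?g s * (ennreal ((1 - r) powr (\<alpha> - e)) * indicator {s..<1} r) * indicator {0..<1} s) \<partial>lborel) \<partial>lborel)"
    proof (rule nn_integral_mono)
      fix r
      show "ennreal ((1 - r) powr \<alpha> * Y r powr p) * indicator {0..<1} r \<le>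
        (\<integral>\<^sup>+s. ennreal L * (?g s * (ennreal ((1 - r) powr (\<alpha> - e)) * indicator {s..<1} r) * indicator {0..<1} s) \<partial>lborel)"
      proof (cases "r \<in> {0..<1}")
        case True
        have "ennreal ((1 - r) powr \<alpha> * Y r powr p) \<le> ennreal ((1 - r) powr \<alpha>) * (ennreal (L * (1 - r) powr (- e)) * (\<integral>\<^sup>+s\<in>{0..r}. ?g s \<partial>lborel))"
          using Phi_hardy_pointwise[OF p e b, of r] True
          by (subst ennreal_mult) (auto intro!: mult_left_mono simp: L_def Y_def A_def)
        also have "\<dots> = ennreal (L * (1 - r) powr (\<alpha> - e)) * (\<integral>\<^sup>+s\<in>{0..r}. ?g s \<partial>lborel)"
        proof -
          have "(1 - r) powr \<alpha> * (L * (1 - r) powr (- e)) = L * (1 - r) powr (\<alpha> - e)"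
            using powr_add[of "1 - r" \<alpha> "- e"] by simp
          then show ?thesis by (simp only: mult.assoc[symmetric] ennreal_mult'[symmetric] powr_ge_zero)
        qed
        also have "\<dots> = (\<integral>\<^sup>+s. ennreal (L * (1 - r) powr (\<alpha> - e)) * (?g s * indicator {0..r} s) \<partial>lborel)"
          by (rule nn_integral_cmult[symmetric]) measurable
        also have "\<dots> = (\<integral>\<^sup>+s. ennreal L * (?g s * (ennreal ((1 - r) powr (\<alpha> - e)) * indicator {s..<1} r) * indicator {0..<1} s) \<partial>lborel)"
          using True L by (intro nn_integral_cong) (auto simp: indicator_def ennreal_mult mult_ac)
        finally show ?thesis using True by simp
      qed simp
    qed
    also have "\<dots> = (\<integral>\<^sup>+s. (\<integral>\<^sup>+r. ennreal L * (?g s * (ennreal ((1 - r) powr (\<alpha> - e)) * indicator {s..<1} r) * indicator {0..<1} s) \<partial>lborel) \<partial>lborel)"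
      by (rule lborel_pair.Fubini') (simp add: indicator_def[abs_def], measurable)
    also have "\<dots> = (\<integral>\<^sup>+s. ennreal (L / e) * (ennreal ((1 - s) powr (\<alpha> + 1) * Phi a b s powr p) * indicator {0..<1} s) \<partial>lborel)"
    proof (rule nn_integral_cong)
      fix s
      show "(\<integral>\<^sup>+r. ennreal L * (?g s * (ennreal ((1 - r) powr (\<alpha> - e)) * indicator {s..<1} r) * indicator {0..<1} s) \<partial>lborel) =
        ennreal (L / e) * (ennreal ((1 - s) powr (\<alpha> + 1) * Phi a b s powr p) * indicator {0..<1} s)"
      proof (cases "s \<in> {0..<1}")
        case True
        have "(\<integral>\<^sup>+r. ennreal L * (?g s * (ennreal ((1 - r) powr (\<alpha> - e)) * indicator {s..<1} r) * indicator {0..<1} s) \<partial>lborel)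
            = (\<integral>\<^sup>+r. (ennreal L * ?g s) * (ennreal ((1 - r) powr (\<alpha> - e)) * indicator {s..<1} r) \<partial>lborel)"
          using True by (intro nn_integral_cong) (simp add: mult_ac)
        also have "\<dots> = (ennreal L * ?g s) * ennreal ((1 - s) powr (\<alpha> - e + 1) / (\<alpha> - e + 1))"
        proof -
          have "-1 < \<alpha> - e" using \<alpha> by (simp add: e_def field_simps)
          then show ?thesis using True
            by (subst nn_integral_cmult, measurable, subst nn_integral_one_minus_powr) auto
        qed
        also have "\<alpha> - e + 1 = e" by (simp add: e_def field_simps)
        also have "(ennreal L * ?g s) * ennreal ((1 - s) powr e / e) = ennreal (L / e * ((1 - s) powr (\<alpha> + 1) * Phi a b s powr p))"
        proof -
          have "(1 - s) powr (\<alpha> + 1) = (1 - s) powr e * (1 - s) powr e" by (simp add: powr_add[symmetric] e_def)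
          then show ?thesis using L e by (simp add: ennreal_mult'[symmetric] mult_ac)
        qed
        finally show ?thesis using True L e by (simp add: ennreal_mult'[symmetric])
      qed simp
    qed
    also have "\<dots> = ennreal (L / e) * R"
      unfolding R_def by (rule nn_integral_cmult) measurable
    finally have part2: "(\<integral>\<^sup>+r\<in>{0..<1}. ennreal ((1 - r) powr \<alpha> * Y r powr p) \<partial>lborel) \<le> ennreal (L / e) * R" .
    have "(\<integral>\<^sup>+r\<in>{0..<1}. ennreal ((1 - r) powr \<alpha> * Phi a (b - 1 / p) r powr p) \<partial>lborel) \<le>
        (\<integral>\<^sup>+r. ennreal (2 powr p) * (ennreal ((1 - r) powr \<alpha> * A powr p) * indicator {0..<1} r + ennreal ((1 - r) powr \<alpha> * Y r powr p) * indicator {0..<1} r) \<partial>lborel)"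
    proof (rule nn_integral_mono)
      fix r
      show "ennreal ((1 - r) powr \<alpha> * Phi a (b - 1 / p) r powr p) * indicator {0..<1} r \<le>
        ennreal (2 powr p) * (ennreal ((1 - r) powr \<alpha> * A powr p) * indicator {0..<1} r + ennreal ((1 - r) powr \<alpha> * Y r powr p) * indicator {0..<1} r)"
      proof (cases "r \<in> {0..<1}")
        case True
        then have "Phi a (b - 1 / p) r powr p \<le> 2 powr p * (A powr p + Y r powr p)"
          using powr_add_le[of A "Y r" p] A Y[of r] p by (simp add: Y_def)
        then have "(1 - r) powr \<alpha> * Phi a (b - 1 / p) r powr p \<le> (1 - r) powr \<alpha> * (2 powr p * (A powr p + Y r powr p))"
          by (intro mult_left_mono) auto
        also have "\<dots> = 2 powr p * ((1 - r) powr \<alpha> * A powr p + (1 - r) powr \<alpha> * Y r powr p)"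
          by (simp add: algebra_simps)
        finally show ?thesis
          using True by (simp add: ennreal_mult'[symmetric] ennreal_plus[symmetric] ennreal_leI del: ennreal_plus)
      qed simp
    qed
    also have "\<dots> = ennreal (2 powr p) * (ennreal (A powr p / (\<alpha> + 1)) + (\<integral>\<^sup>+r\<in>{0..<1}. ennreal ((1 - r) powr \<alpha> * Y r powr p) \<partial>lborel))"
      by (subst nn_integral_cmult, measurable, subst nn_integral_add, measurable) (simp add: A_int[OF \<alpha>])
    also have "\<dots> \<le> ennreal (2 powr p) * (ennreal ((\<alpha> + 2) / (\<alpha> + 1)) * R + ennreal (L / e) * R)"
      by (intro mult_left_mono add_mono part1 part2) auto
    also have "\<dots> = ennreal K * R"
    proof -
      have "ennreal K = ennreal (2 powr p) * (ennreal ((\<alpha> + 2) / (\<alpha> + 1)) + ennreal (L / e))"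
        unfolding K_def using \<alpha> L e by (subst ennreal_plus[symmetric]) (auto simp: ennreal_mult')
      then show ?thesis by (simp only: distrib_right mult.assoc)
    qed
    finally show "(\<integral>\<^sup>+r\<in>{0..<1}. ennreal ((1 - r) powr \<alpha> * Phi a (b - 1 / p) r powr p) \<partial>lborel) \<le> ennreal K * R" .
  qed
qed

section \<open>Growth of the derivatives of a mean Lipschitz function\<close>

definition circ_int :: "real \<Rightarrow> real \<Rightarrow> (complex \<Rightarrow> complex) \<Rightarrow> ennreal"
  where "circ_int p r k = (\<integral>\<^sup>+t\<in>{0..2 * pi}. ennreal (norm (k (of_real r * cis t)) powr p) \<partial>lborel)"

lemma int_mean_eq: "int_mean p r k = ennpowr (ennreal (1 / (2 * pi)) * circ_int p r k) (1 / p)"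
  by (simp add: int_mean_def circ_int_def)

lemma ennpowr_le_ennreal:
  assumes "0 < p" "ennpowr x (1 / p) \<le> ennreal N" "0 \<le> N"
  shows "x \<le> ennreal (N powr p)"
proof (cases x)
  case (real y)
  then have "y powr (1 / p) \<le> N" using assms by (simp add: ennpowr_ennreal)
  then have "(y powr (1 / p)) powr p \<le> N powr p" using assms by (intro powr_mono2) auto
  then show ?thesis using real assms by (simp add: powr_powr ennreal_leI)
qed (use assms in \<open>simp add: ennpowr_def top_unique\<close>)

lemma int_mean_le_imp_circ_int_le:
  assumes "0 < p" "int_mean p r k \<le> ennreal N" "0 \<le> N"
  shows "circ_int p r k \<le> ennreal (2 * pi * N powr p)"
proof -
  have "ennreal (1 / (2 * pi)) * circ_int p r k \<le> ennreal (N powr p)"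
    using assms by (intro ennpowr_le_ennreal) (auto simp: int_mean_eq)
  then have "ennreal (2 * pi) * (ennreal (1 / (2 * pi)) * circ_int p r k) \<le> ennreal (2 * pi) * ennreal (N powr p)"
    by (rule mult_left_mono) simp
  moreover have "ennreal (2 * pi) * (ennreal (1 / (2 * pi)) * circ_int p r k) = circ_int p r k"
    by (subst mult.assoc[symmetric], subst ennreal_mult[symmetric]) auto
  ultimately show ?thesis by (simp add: ennreal_mult')
qed

section \<open>Cauchy integrals of boundary functions\<close>

definition arc :: "real measure" where "arc = density lborel (\<lambda>t. ennreal (indicator {0..2 * pi} t))"

lemma sets_arc [simp, measurable_cong]: "sets arc = sets borel"
  and space_arc [simp]: "space arc = UNIV"
  by (simp_all add: arc_def)

lemma nn_integral_arc:
  assumes "f \<in> borel_measurable borel"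
  shows "(\<integral>\<^sup>+t. f t \<partial>arc) = (\<integral>\<^sup>+t\<in>{0..2 * pi}. f t \<partial>lborel)"
  unfolding arc_def using assms
  by (subst nn_integral_density) (auto intro!: nn_integral_cong simp: indicator_def)

lemma emeasure_arc: "emeasure arc (space arc) = ennreal (2 * pi)"
proof -
  have "emeasure arc (space arc) = (\<integral>\<^sup>+t. 1 \<partial>arc)" by simp
  then show ?thesis by (subst (asm) nn_integral_arc) auto
qed

lemma finite_measure_arc: "finite_measure arc"
  by (rule finite_measureI) (simp only: emeasure_arc, simp)

lemma AE_arc: "AE t in lborel. P t \<Longrightarrow> AE t in arc. P t"
  unfolding arc_def by (subst AE_density) auto

lemma arc_integral_continuous:
  fixes f :: "real \<Rightarrow> complex"
  assumes "continuous_on UNIV f"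
  shows "integrable arc f" "integral\<^sup>L arc f = integral {0..2 * pi} f"
proof -
  have m: "f \<in> borel_measurable borel" using assms by (rule borel_measurable_continuous_onI)
  have c: "continuous_on {0..2*pi} f" using assms continuous_on_subset by blast
  have s: "set_integrable lborel {0..2*pi} f" by (rule borel_integrable_compact[OF compact_Icc c, unfolded scaleR_conv_of_real, folded scaleR_conv_of_real, folded set_integrable_def])
  show "integrable arc f" unfolding arc_def using s m
    by (subst integrable_density) (auto simp: set_integrable_def)
  show "integral\<^sup>L arc f = integral {0..2 * pi} f"
    using set_borel_integral_eq_integral(2)[OF s] m unfolding arc_def
    by (subst integral_density) (auto simp: set_lebesgue_integral_def)
qed

lemma higher_deriv_unit_circle:
  assumes k: "k holomorphic_on ball 0 R" and R: "1 < R" and z: "norm z < 1"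
  shows "(deriv ^^ n) k z =
    of_real (fact n / (2 * pi)) * (LINT t|arc. k (cis t) * (cis t / (cis t - z) ^ Suc n))"
proof -
  have sub: "cball (0::complex) 1 \<subseteq> ball 0 R" using R by auto
  have cont: "continuous_on UNIV (\<lambda>t. k (cis t) * (cis t / (cis t - z) ^ Suc n))"
  proof -
    have "continuous_on UNIV (\<lambda>t. k (cis t))"
      by (rule continuous_on_compose2[OF holomorphic_on_imp_continuous_on[OF k]])
        (use R in \<open>auto intro!: continuous_intros\<close>)
    moreover have "cis t - z \<noteq> 0" for t using z norm_cis[of t] by (metis less_irrefl right_minus_eq)
    ultimately show ?thesis by (auto intro!: continuous_intros)
  qed
  have "((\<lambda>u. k u / (u - z) ^ Suc n) has_contour_integral (2 * pi * \<i>) / fact n * (deriv ^^ n) k z) (circlepath 0 1)"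
    using k sub z holomorphic_on_subset[OF k, of "ball 0 1"] holomorphic_on_subset[OF k sub]
    by (intro Cauchy_has_contour_integral_higher_derivative_circlepath holomorphic_on_imp_continuous_on) auto
  then have "((\<lambda>t. k (cis t) / (cis t - z) ^ Suc n * \<i> * cis t) has_integral (2 * pi * \<i>) / fact n * (deriv ^^ n) k z) {0..2 * pi}"
    unfolding circlepath_def by (subst (asm) has_contour_integral_part_circlepath_iff) auto
  then have "((\<lambda>t. (- \<i>) * (k (cis t) / (cis t - z) ^ Suc n * \<i> * cis t)) has_integral (- \<i>) * ((2 * pi * \<i>) / fact n * (deriv ^^ n) k z)) {0..2 * pi}"
    by (rule has_integral_mult_right)
  moreover have "(- \<i>) * (k (cis t) / (cis t - z) ^ Suc n * \<i> * cis t) = k (cis t) * (cis t / (cis t - z) ^ Suc n)" for t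
    by (simp add: field_simps)
  moreover have "(- \<i>) * ((2 * pi * \<i>) / fact n * (deriv ^^ n) k z) = (2 * pi) / fact n * (deriv ^^ n) k z"
    by (simp add: field_simps)
  ultimately have "integral {0..2 * pi} (\<lambda>t. k (cis t) * (cis t / (cis t - z) ^ Suc n)) = (2 * pi) / fact n * (deriv ^^ n) k z"
    by (simp only: integral_unique)
  then show ?thesis
    using arc_integral_continuous(2)[OF cont] by (simp add: field_simps)
qed

text \<open>Fatou bounds the limit. A bound on p-th powers with p > 1 gives uniform integrability:
  where the difference exceeds a level N it is at most N^(1 - p) times its p-th power, and truncated
  at N it converges by dominated convergence, the measure being finite.\<close>

lemma L1_convergence_of_bounded_powr:
  fixes u :: "nat \<Rightarrow> 'a \<Rightarrow> complex"
  assumes fin: "finite_measure M" and p: "1 < p"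
    and [measurable]: "\<And>n. u n \<in> borel_measurable M" "v \<in> borel_measurable M"
    and lim: "AE x in M. (\<lambda>n. u n x) \<longlonglongrightarrow> v x"
    and bd: "\<And>n. (\<integral>\<^sup>+x. ennreal (norm (u n x) powr p) \<partial>M) \<le> ennreal B"
  shows "(\<integral>\<^sup>+x. ennreal (norm (v x) powr p) \<partial>M) \<le> ennreal B"
    and "(\<lambda>n. \<integral>\<^sup>+x. ennreal (norm (u n x - v x)) \<partial>M) \<longlonglongrightarrow> 0"
proof -
  interpret finite_measure M by (rule fin)
  have "(\<integral>\<^sup>+x. ennreal (norm (v x) powr p) \<partial>M) = (\<integral>\<^sup>+x. liminf (\<lambda>n. ennreal (norm (u n x) powr p)) \<partial>M)"
  proof (rule nn_integral_cong_AE)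
    show "AE x in M. ennreal (norm (v x) powr p) = liminf (\<lambda>n. ennreal (norm (u n x) powr p))"
      using lim
    proof eventually_elim
      case (elim x)
      have "(\<lambda>n. ennreal (norm (u n x) powr p)) \<longlonglongrightarrow> ennreal (norm (v x) powr p)"
        using elim p by (intro tendsto_ennrealI tendsto_powr2 tendsto_norm) auto
      then show ?case by (rule lim_imp_Liminf[symmetric, OF sequentially_bot])
    qed
  qed
  also have "\<dots> \<le> liminf (\<lambda>n. \<integral>\<^sup>+x. ennreal (norm (u n x) powr p) \<partial>M)"
    by (rule nn_integral_liminf) measurable
  also have "\<dots> \<le> ennreal B"
    by (rule order_trans[OF Liminf_mono[of _ "\<lambda>_. ennreal B"]]) (simp_all add: bd Liminf_const)
  finally show vB: "(\<integral>\<^sup>+x. ennreal (norm (v x) powr p) \<partial>M) \<le> ennreal B" .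
  define D where "D = 2 powr p * (max B 0 + max B 0)"
  have D: "0 \<le> D" by (simp add: D_def)
  have diff: "(\<integral>\<^sup>+x. ennreal (norm (u n x - v x) powr p) \<partial>M) \<le> ennreal D" for n
  proof -
    have "(\<integral>\<^sup>+x. ennreal (norm (u n x - v x) powr p) \<partial>M) \<le>
        (\<integral>\<^sup>+x. ennreal (2 powr p) * (ennreal (norm (u n x) powr p) + ennreal (norm (v x) powr p)) \<partial>M)"
    proof (rule nn_integral_mono)
      fix x
      have "norm (u n x - v x) powr p \<le> (norm (u n x) + norm (v x)) powr p"
        using p by (intro powr_mono2 norm_triangle_ineq4) auto
      also have "\<dots> \<le> 2 powr p * (norm (u n x) powr p + norm (v x) powr p)"
        using p by (intro powr_add_le) auto
      finally show "ennreal (norm (u n x - v x) powr p) \<le> ennreal (2 powr p) * (ennreal (norm (u n x) powr p) + ennreal (norm (v x) powr p))"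
        by (simp add: ennreal_mult'[symmetric] ennreal_plus[symmetric] ennreal_leI del: ennreal_plus)
    qed
    also have "\<dots> = ennreal (2 powr p) * ((\<integral>\<^sup>+x. ennreal (norm (u n x) powr p) \<partial>M) + (\<integral>\<^sup>+x. ennreal (norm (v x) powr p) \<partial>M))"
      by (subst nn_integral_cmult, measurable, subst nn_integral_add) auto
    also have "\<dots> \<le> ennreal (2 powr p) * (ennreal (max B 0) + ennreal (max B 0))"
      using bd[of n] vB by (intro mult_left_mono add_mono) (auto simp: max_def ennreal_neg split: if_splits)
    also have "\<dots> = ennreal D" unfolding D_def
      by (simp add: ennreal_mult'[symmetric] ennreal_plus[symmetric] del: ennreal_plus)
    finally show ?thesis .
  qed
  show "(\<lambda>n. \<integral>\<^sup>+x. ennreal (norm (u n x - v x)) \<partial>M) \<longlonglongrightarrow> 0"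
  proof (rule tendsto_zero_ennreal)
    fix \<epsilon> :: real assume \<epsilon>: "0 < \<epsilon>"
    \<comment> \<open>Solves N^(1 - p) = \<epsilon> / (2 (D + 1)), so that the part above the level
      contributes at most \<epsilon> / 2; the summand 1 allows D = 0.\<close>
    define N where "N = (2 * (D + 1) / \<epsilon>) powr (1 / (p - 1))"
    have N: "0 < N" using \<epsilon> D by (simp add: N_def)
    have "1 / (p - 1) * (1 - p) = - 1" using p by (simp add: field_simps)
    then have "N powr (1 - p) = (2 * (D + 1) / \<epsilon>) powr (- 1)"
      by (simp only: N_def powr_powr)
    also have "\<dots> = \<epsilon> / (2 * (D + 1))" using \<epsilon> D by (simp add: powr_minus_divide)
    finally have "N powr (1 - p) * D = \<epsilon> / 2 * (D / (D + 1))" by simp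
    also have "\<dots> \<le> \<epsilon> / 2" using \<epsilon> D by (intro mult_left_le) auto
    finally have ND: "N powr (1 - p) * D \<le> \<epsilon> / 2" .
    have "(\<lambda>n. \<integral>\<^sup>+x. ennreal (min (norm (u n x - v x)) N) \<partial>M) \<longlonglongrightarrow> (\<integral>\<^sup>+x. 0 \<partial>M)"
    proof (rule nn_integral_dominated_convergence[where w="\<lambda>_. ennreal N"])
      show "(\<integral>\<^sup>+x. ennreal N \<partial>M) < \<infinity>" by (simp add: emeasure_eq_measure ennreal_mult_less_top)
      show "AE x in M. (\<lambda>n. ennreal (min (norm (u n x - v x)) N)) \<longlonglongrightarrow> 0"
        using lim
      proof eventually_elim
        case (elim x)
        have "(\<lambda>n. norm (u n x - v x)) \<longlonglongrightarrow> 0"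
          using elim by (simp add: LIM_zero tendsto_norm_zero)
        then have "(\<lambda>n. min (norm (u n x - v x)) N) \<longlonglongrightarrow> min 0 N" by (intro tendsto_min) auto
        then show ?case using N tendsto_ennrealI by (fastforce simp: min_def)
      qed
    qed (auto intro!: AE_I2 ennreal_leI)
    then have "(\<lambda>n. \<integral>\<^sup>+x. ennreal (min (norm (u n x - v x)) N) \<partial>M) \<longlonglongrightarrow> 0" by simp
    then have "\<forall>\<^sub>F n in sequentially. (\<integral>\<^sup>+x. ennreal (min (norm (u n x - v x)) N) \<partial>M) < ennreal (\<epsilon> / 2)"
      using \<epsilon> by (intro order_tendstoD(2)) auto
    then show "\<forall>\<^sub>F n in sequentially. (\<integral>\<^sup>+x. ennreal (norm (u n x - v x)) \<partial>M) < ennreal \<epsilon>"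
    proof eventually_elim
      case (elim n)
      have "(\<integral>\<^sup>+x. ennreal (norm (u n x - v x)) \<partial>M) \<le>
          (\<integral>\<^sup>+x. ennreal (min (norm (u n x - v x)) N) + ennreal (N powr (1 - p)) * ennreal (norm (u n x - v x) powr p) \<partial>M)"
      proof (rule nn_integral_mono)
        fix x
        define y where "y = norm (u n x - v x)"
        have "y \<le> min y N + N powr (1 - p) * y powr p"
        proof (cases "y \<le> N")
          case False
          then have "y = y powr (1 - p) * y powr p" using N by (simp add: powr_add[symmetric])
          also have "\<dots> \<le> N powr (1 - p) * y powr p"
            using False N p by (intro mult_right_mono powr_mono2') auto
          finally show ?thesis using N False by simp
        qed (simp add: y_def)
        then have "ennreal y \<le> ennreal (min y N + N powr (1 - p) * y powr p)" by (rule ennreal_leI)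
        also have "\<dots> = ennreal (min y N) + ennreal (N powr (1 - p)) * ennreal (y powr p)"
          using N by (simp add: ennreal_mult' y_def)
        finally show "ennreal (norm (u n x - v x)) \<le> ennreal (min (norm (u n x - v x)) N) + ennreal (N powr (1 - p)) * ennreal (norm (u n x - v x) powr p)"
          by (simp only: y_def)
      qed
      also have "\<dots> = (\<integral>\<^sup>+x. ennreal (min (norm (u n x - v x)) N) \<partial>M) + ennreal (N powr (1 - p)) * (\<integral>\<^sup>+x. ennreal (norm (u n x - v x) powr p) \<partial>M)"
        by (subst nn_integral_add, measurable, subst nn_integral_cmult) auto
      also have "\<dots> \<le> (\<integral>\<^sup>+x. ennreal (min (norm (u n x - v x)) N) \<partial>M) + ennreal (N powr (1 - p)) * ennreal D"
        by (intro add_left_mono mult_left_mono diff) auto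
      also have "\<dots> \<le> (\<integral>\<^sup>+x. ennreal (min (norm (u n x - v x)) N) \<partial>M) + ennreal (\<epsilon> / 2)"
        using ND by (intro add_left_mono) (simp add: ennreal_mult'[symmetric] ennreal_leI)
      also have "\<dots> < ennreal (\<epsilon> / 2) + ennreal (\<epsilon> / 2)"
      proof -
        have "x < ennreal (\<epsilon> / 2) \<Longrightarrow> x + ennreal (\<epsilon> / 2) < ennreal (\<epsilon> / 2) + ennreal (\<epsilon> / 2)" for x
          using \<epsilon> by (cases x) (auto simp: ennreal_plus[symmetric] ennreal_less_iff simp del: ennreal_plus)
        then show ?thesis using elim by blast
      qed
      also have "\<dots> = ennreal \<epsilon>" using \<epsilon> by (simp add: ennreal_plus[symmetric] del: ennreal_plus)
      finally show ?case .
    qed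
  qed
qed


text \<open>Cauchy's formula holds for the dilates of \<open>g\<close>, which are holomorphic beyond
  the closed disc. Their boundary values are bounded in L^p and converge almost everywhere, hence in
  L^1, and the Cauchy kernel is bounded for fixed z, so the formula passes to the limit.\<close>

lemma higher_deriv_boundary_integral:
  assumes p: "1 < p" and g: "g holomorphic_on unit_disc" and z: "norm z < 1"
    and u [measurable]: "u \<in> borel_measurable borel"
    and bd: "\<And>r. 0 < r \<Longrightarrow> r < 1 \<Longrightarrow> circ_int p r g \<le> ennreal B"
    and lim: "AE t in lborel. ((\<lambda>r. g (of_real r * cis t)) \<longlongrightarrow> u t) (at_left 1)"
  shows "integrable arc u"
    and "(\<integral>\<^sup>+t\<in>{0..2 * pi}. ennreal (norm (u t) powr p) \<partial>lborel) \<le> ennreal B"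
    and "(deriv ^^ n) g z = of_real (fact n / (2 * pi)) * (LINT t|arc. u t * (cis t / (cis t - z) ^ Suc n))"
proof -
  \<comment> \<open>The shift by two keeps every radius strictly between 0 and 1.\<close>
  define \<rho> where "\<rho> m = 1 - inverse (real (Suc (Suc m)))" for m
  have \<rho>: "0 < \<rho> m" "\<rho> m < 1" for m by (auto simp: \<rho>_def field_simps)
  have \<rho>_lim: "\<rho> \<longlonglongrightarrow> 1" 
    using tendsto_diff[OF tendsto_const LIMSEQ_Suc[OF LIMSEQ_inverse_real_of_nat], of 1]
    by (simp add: \<rho>_def[abs_def] add.commute)
  define v where "v m t = g (of_real (\<rho> m) * cis t)" for m t
  have v_cont: "continuous_on UNIV (v m)" for m
    unfolding v_def by (rule continuous_on_compose2[OF holomorphic_on_imp_continuous_on[OF g]])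
      (use \<rho>[of m] in \<open>auto intro!: continuous_intros simp: norm_mult\<close>)
  have v_meas [measurable]: "v m \<in> borel_measurable borel" for m
    by (rule borel_measurable_continuous_onI[OF v_cont])
  have v_bd: "(\<integral>\<^sup>+t. ennreal (norm (v m t) powr p) \<partial>arc) \<le> ennreal B" for m
  proof -
    have "(\<lambda>t. ennreal (norm (v m t) powr p)) \<in> borel_measurable borel" by measurable
    then show ?thesis using nn_integral_arc bd[OF \<rho>] by (simp add: circ_int_def v_def)
  qed
  have v_lim: "AE t in arc. (\<lambda>m. v m t) \<longlonglongrightarrow> u t"
  proof (rule AE_arc)
    have "filterlim \<rho> (at_left 1) sequentially"
      using \<rho>_lim \<rho>(2) less_imp_neq[OF \<rho>(2)] by (auto simp: filterlim_at intro!: always_eventually)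
    note \<rho>_left = this
    show "AE t in lborel. (\<lambda>m. v m t) \<longlonglongrightarrow> u t"
      using lim unfolding v_def by eventually_elim (rule filterlim_compose[OF _ \<rho>_left])
  qed
  have "\<And>m. v m \<in> borel_measurable arc" "u \<in> borel_measurable arc" by measurable
  note L1 = L1_convergence_of_bounded_powr[OF finite_measure_arc p this v_lim v_bd]
  show up: "(\<integral>\<^sup>+t\<in>{0..2 * pi}. ennreal (norm (u t) powr p) \<partial>lborel) \<le> ennreal B"
    using L1(1) nn_integral_arc[of "\<lambda>t. ennreal (norm (u t) powr p)"] by simp
  have conv: "(\<lambda>m. \<integral>\<^sup>+t. ennreal (norm (v m t - u t)) \<partial>arc) \<longlonglongrightarrow> 0" by (rule L1(2))
  show int_u: "integrable arc u"
  proof (rule integrableI_bounded)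
    have "(\<integral>\<^sup>+t. ennreal (norm (u t)) \<partial>arc) \<le> (\<integral>\<^sup>+t. 1 + ennreal (norm (u t) powr p) \<partial>arc)"
    proof (rule nn_integral_mono)
      fix t
      have "norm (u t) \<le> 1 + norm (u t) powr p"
      proof (cases "norm (u t) \<le> 1")
        case False
        then have "norm (u t) powr 1 \<le> norm (u t) powr p" using p by (intro powr_mono) auto
        then show ?thesis using False by simp
      qed (simp add: add_increasing2)
      then show "ennreal (norm (u t)) \<le> 1 + ennreal (norm (u t) powr p)"
        by (simp add: ennreal_plus[symmetric] ennreal_1[symmetric] ennreal_leI del: ennreal_plus ennreal_1)
    qed
    also have "\<dots> = emeasure arc (space arc) + (\<integral>\<^sup>+t. ennreal (norm (u t) powr p) \<partial>arc)"
      by (subst nn_integral_add) auto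
    also have "\<dots> < \<infinity>"
      unfolding emeasure_arc using le_less_trans[OF L1(1)] by (auto simp: less_top)
    finally show "(\<integral>\<^sup>+t. ennreal (norm (u t)) \<partial>arc) < \<infinity>" .
  qed measurable
  let ?K = "\<lambda>t. cis t / (cis t - z) ^ Suc n"
  have nz: "cis t - z \<noteq> 0" for t using z norm_cis[of t] by (metis less_irrefl right_minus_eq)
  have K_cont: "continuous_on UNIV ?K" using nz by (intro continuous_intros) auto
  have K_meas [measurable]: "?K \<in> borel_measurable borel" by (rule borel_measurable_continuous_onI[OF K_cont])
  define b where "b = 1 / (1 - norm z) ^ Suc n"
  have K_bd: "norm (?K t) \<le> b" for t
  proof -
    have "1 - norm z \<le> norm (cis t - z)" using norm_triangle_ineq2[of "cis t" z] by simp
    then have "(1 - norm z) ^ Suc n \<le> norm (cis t - z) ^ Suc n" using z by (intro power_mono) auto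
    moreover have "0 < (1 - norm z) ^ Suc n" using z by (intro zero_less_power) simp
    moreover have "norm (?K t) = 1 / norm (cis t - z) ^ Suc n"
      by (simp only: norm_divide norm_power norm_cis)
    ultimately show ?thesis unfolding b_def by (simp only: frac_le zero_le_one order_refl)
  qed
  have int_mult: "integrable arc (\<lambda>t. f t * ?K t)" if "integrable arc f" for f :: "real \<Rightarrow> complex"
  proof (rule Bochner_Integration.integrable_bound)
    show "integrable arc (\<lambda>t. of_real b * f t)" using that by simp
    show "(\<lambda>t. f t * ?K t) \<in> borel_measurable arc" using that by measurable
    have "0 \<le> b" using K_bd[of 0] norm_ge_zero order_trans by blast
    then have "norm (f t * ?K t) \<le> norm (of_real b * f t)" for t
    proof -
      have "norm (f t * ?K t) = norm (f t) * norm (?K t)" by (rule norm_mult)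
      also have "\<dots> \<le> norm (f t) * b" by (intro mult_left_mono K_bd) simp
      also have "\<dots> = norm (of_real b * f t)" using \<open>0 \<le> b\<close> by (simp add: norm_mult)
      finally show ?thesis .
    qed
    then show "AE t in arc. norm (f t * ?K t) \<le> norm (of_real b * f t)" by simp
  qed
  have "(\<lambda>m. LINT t|arc. v m t * ?K t) \<longlonglongrightarrow> (LINT t|arc. u t * ?K t)"
  proof (rule tendsto_L1_int)
    show "integrable arc (\<lambda>t. v m t * ?K t)" for m
      by (rule int_mult) (rule arc_integral_continuous(1)[OF v_cont])
    show "integrable arc (\<lambda>t. u t * ?K t)" by (rule int_mult[OF int_u])
    have b0: "0 \<le> b" using K_bd[of 0] norm_ge_zero order_trans by blast
    have le: "(\<integral>\<^sup>+t. ennreal (norm (v m t * ?K t - u t * ?K t)) \<partial>arc) \<le> ennreal b * (\<integral>\<^sup>+t. ennreal (norm (v m t - u t)) \<partial>arc)" for m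
    proof -
      have "(\<integral>\<^sup>+t. ennreal (norm (v m t * ?K t - u t * ?K t)) \<partial>arc) \<le> (\<integral>\<^sup>+t. ennreal b * ennreal (norm (v m t - u t)) \<partial>arc)"
      proof (rule nn_integral_mono)
        fix t
        have "norm (v m t * ?K t - u t * ?K t) = norm (v m t - u t) * norm (?K t)"
          by (simp only: left_diff_distrib[symmetric] norm_mult)
        also have "\<dots> \<le> norm (v m t - u t) * b" by (intro mult_left_mono K_bd) simp
        finally show "ennreal (norm (v m t * ?K t - u t * ?K t)) \<le> ennreal b * ennreal (norm (v m t - u t))"
          using b0 by (simp add: ennreal_mult'[symmetric] ennreal_leI mult.commute[of b] del: power_Suc)
      qed
      also have "\<dots> = ennreal b * (\<integral>\<^sup>+t. ennreal (norm (v m t - u t)) \<partial>arc)" by (rule nn_integral_cmult) measurable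
      finally show ?thesis .
    qed
    have up: "(\<lambda>m. ennreal b * (\<integral>\<^sup>+t. ennreal (norm (v m t - u t)) \<partial>arc)) \<longlonglongrightarrow> 0"
      using ennreal_tendsto_cmult[OF _ conv, of "ennreal b"] by simp
    show "(\<lambda>m. \<integral>\<^sup>+t. ennreal (norm (v m t * ?K t - u t * ?K t)) \<partial>arc) \<longlonglongrightarrow> 0"
    proof (rule tendsto_sandwich[OF _ _ tendsto_const up])
      show "\<forall>\<^sub>F m in sequentially. 0 \<le> (\<integral>\<^sup>+t. ennreal (norm (v m t * ?K t - u t * ?K t)) \<partial>arc)"
        by (intro always_eventually allI zero_le)
      show "\<forall>\<^sub>F m in sequentially. (\<integral>\<^sup>+t. ennreal (norm (v m t * ?K t - u t * ?K t)) \<partial>arc)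
          \<le> ennreal b * (\<integral>\<^sup>+t. ennreal (norm (v m t - u t)) \<partial>arc)"
        by (intro always_eventually allI le)
    qed
  qed
  then have lim1: "(\<lambda>m. of_real (fact n / (2 * pi)) * (LINT t|arc. v m t * ?K t)) \<longlonglongrightarrow> of_real (fact n / (2 * pi)) * (LINT t|arc. u t * ?K t)"
    by (intro tendsto_intros)
  \<comment> \<open>The chain rule for the dilation produces the power of the radius, which tends to
    1.\<close>
  have eq: "of_real (fact n / (2 * pi)) * (LINT t|arc. v m t * ?K t) = of_real (\<rho> m) ^ n * (deriv ^^ n) g (of_real (\<rho> m) * z)" for m
  proof -
    have in_disc: "of_real (\<rho> m) * w \<in> unit_disc" if "w \<in> ball 0 (1 / \<rho> m)" for w
      using that \<rho>[of m] by (simp add: norm_mult field_simps)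
    have "norm z * \<rho> m < 1 * 1" using z \<rho>[of m] by (intro mult_strict_mono) auto
    then have z': "z \<in> ball 0 (1 / \<rho> m)" using \<rho>[of m] by (simp add: field_simps)
    have "(\<lambda>w. g (of_real (\<rho> m) * w)) holomorphic_on ball 0 (1 / \<rho> m)"
      by (rule holomorphic_on_compose_gen[OF _ g, unfolded o_def])
        (intro holomorphic_intros, use in_disc in blast)
    then have "(deriv ^^ n) (\<lambda>w. g (of_real (\<rho> m) * w)) z = of_real (fact n / (2 * pi)) * (LINT t|arc. v m t * ?K t)"
      unfolding v_def using \<rho>[of m] z by (intro higher_deriv_unit_circle) auto
    moreover have "(deriv ^^ n) (\<lambda>w. g (of_real (\<rho> m) * w)) z = of_real (\<rho> m) ^ n * (deriv ^^ n) g (of_real (\<rho> m) * z)"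
      by (rule higher_deriv_compose_linear[OF g _ _ z']) (use in_disc in auto)
    ultimately show ?thesis by simp
  qed
  have "isCont ((deriv ^^ n) g) z"
    using holomorphic_higher_deriv[OF g, of n] z
    by (intro continuous_on_interior[OF holomorphic_on_imp_continuous_on]) (auto simp: interior_open)
  moreover have "(\<lambda>m. of_real (\<rho> m) * z) \<longlonglongrightarrow> of_real 1 * z" using \<rho>_lim by (intro tendsto_intros)
  ultimately have "(\<lambda>m. (deriv ^^ n) g (of_real (\<rho> m) * z)) \<longlonglongrightarrow> (deriv ^^ n) g z"
    using isCont_tendsto_compose by fastforce
  then have "(\<lambda>m. of_real (\<rho> m) ^ n * (deriv ^^ n) g (of_real (\<rho> m) * z)) \<longlonglongrightarrow> of_real 1 ^ n * (deriv ^^ n) g z"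
    using \<rho>_lim by (intro tendsto_intros)
  then show "(deriv ^^ n) g z = of_real (fact n / (2 * pi)) * (LINT t|arc. u t * ?K t)"
    using lim1 unfolding eq by (intro LIMSEQ_unique) auto
qed

section \<open>From the Lipschitz condition on the boundary to growth of derivatives\<close>

lemma sin_ge_half:
  assumes "0 \<le> x" "x \<le> pi / 2"
  shows "x / 2 \<le> sin x"
proof (cases "x \<le> pi / 3")
  case True
  have "sin x - x / 2 \<ge> sin 0 - 0 / 2"
  proof (rule DERIV_nonneg_imp_nondecreasing[OF assms(1)])
    fix y assume y: "0 \<le> y" "y \<le> x"
    have "cos y \<ge> cos (pi / 3)" using y True by (intro cos_monotone_0_pi_le) auto
    then have "0 \<le> cos y - 1 / 2" by (simp add: cos_60)
    moreover have "((\<lambda>x. sin x - x / 2) has_real_derivative cos y - 1 / 2) (at y)"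
      by (auto intro!: derivative_eq_intros)
    ultimately show "\<exists>d. ((\<lambda>x. sin x - x / 2) has_real_derivative d) (at y) \<and> 0 \<le> d" by blast
  qed
  then show ?thesis by simp
next
  \<comment> \<open>Beyond pi / 3 the derivative bound cos \<ge> 1 / 2 fails, but sin x is at least
    sqrt 3 / 2 \<ge> 0.85 there while x / 2 < 0.8.\<close>
  case False
  have "sin (pi / 3) \<le> sin x" using False assms by (intro sin_monotone_2pi_le) auto
  moreover have "17 / 10 \<le> sqrt 3" by (rule real_le_rsqrt) (simp add: power2_eq_square)
  moreover have "x < 1.6" using assms pi_less_4 pi_approx by simp
  ultimately show ?thesis by (simp add: sin_60)
qed

text \<open>Let x be the norm on the right. Then 1 - r \<le> x, and |s| / 2 \<le> |cis s - 1| \<le>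
  x + (1 - r) \<le> 2 x. Adding 1 - r \<le> x and |s| \<le> 4 x gives the constant 5.\<close>

lemma norm_cis_diff_ge:
  assumes "0 \<le> r" "r < 1" "\<bar>s\<bar> \<le> pi"
  shows "(1 - r + \<bar>s\<bar>) / 5 \<le> norm (cis s - of_real r)"
proof -
  have 1: "1 - r \<le> norm (cis s - of_real r)"
    using norm_triangle_ineq2[of "cis s" "of_real r"] assms by simp
  have "norm (cis s - 1) \<le> norm (cis s - of_real r) + norm (of_real r - 1 :: complex)"
    using norm_triangle_ineq[of "cis s - of_real r" "of_real r - 1"] by simp
  moreover have "norm (of_real r - 1 :: complex) = 1 - r"
    using assms by (metis abs_minus_commute abs_of_nonneg diff_ge_0_iff_ge less_eq_real_def norm_of_real of_real_1 of_real_diff)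
  moreover have "\<bar>s\<bar> / 2 \<le> norm (cis s - 1)"
  proof -
    have "\<bar>sin (s / 2)\<bar> = sin (\<bar>s\<bar> / 2)"
      using assms sin_ge_zero[of "\<bar>s\<bar> / 2"] by (cases "s \<ge> 0") auto
    then show ?thesis using sin_ge_half[of "\<bar>s\<bar> / 2"] assms dist_exp_i_1[of s]
      by (simp add: cis_conv_exp)
  qed
  moreover have "c \<le> x + d \<Longrightarrow> d = 1 - r \<Longrightarrow> b / 2 \<le> c \<Longrightarrow> 1 - r \<le> x \<Longrightarrow> (1 - r + b) / 5 \<le> x" for b c d x :: real
    by simp
  ultimately show ?thesis using 1 by blast
qed

lemma nn_integral_abs_kernel:
  fixes \<delta> q :: real and n :: nat
  assumes \<delta>: "0 < \<delta>" and q: "q < real n"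
  shows "(\<integral>\<^sup>+s\<in>{-pi..pi}. ennreal ((\<delta> + \<bar>s\<bar>) powr (q - real n - 1)) \<partial>lborel) \<le>
    ennreal (2 / (real n - q) * \<delta> powr (q - real n))"
proof -
  let ?k = "\<lambda>s. (\<delta> + \<bar>s\<bar>) powr (q - real n - 1)"
  have half: "(\<integral>\<^sup>+s\<in>{0..pi}. ennreal (?k s) \<partial>lborel) \<le> ennreal (1 / (real n - q) * \<delta> powr (q - real n))"
  proof -
    have "(\<integral>\<^sup>+s. ennreal (?k s) * indicator {0..pi} s \<partial>lborel) =
        ennreal ((- 1 / (real n - q)) * (\<delta> + pi) powr (q - real n) - (- 1 / (real n - q)) * (\<delta> + 0) powr (q - real n))"
    proof (rule nn_integral_FTC_Icc)
      fix s assume s: "s \<in> {0..pi}"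
      then have pos: "0 < \<delta> + s" using \<delta> by auto
      have "((\<lambda>s. \<delta> + s) has_real_derivative 1) (at s)" by (auto intro!: derivative_eq_intros)
      from DERIV_cmult[OF DERIV_fun_powr[OF this pos, of "q - real n"], of "- 1 / (real n - q)"]
      show "((\<lambda>s. (- 1 / (real n - q)) * (\<delta> + s) powr (q - real n)) has_real_derivative ?k s) (at s)"
      proof (rule DERIV_cong)
        have "- 1 / (real n - q) * (q - real n) = 1" using q by (simp add: field_simps)
        then show "- 1 / (real n - q) * ((q - real n) * (\<delta> + s) powr (q - real n - of_nat 1) * 1) = ?k s"
          using s by (simp only: mult.assoc[symmetric]) simp
      qed
    qed (use \<delta> in auto)
    also have "\<dots> \<le> ennreal (1 / (real n - q) * \<delta> powr (q - real n))"
      using q by (intro ennreal_leI) simp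
    finally show ?thesis .
  qed
  have refl: "(\<integral>\<^sup>+s\<in>{-pi..0}. ennreal (?k s) \<partial>lborel) = (\<integral>\<^sup>+s\<in>{0..pi}. ennreal (?k s) \<partial>lborel)"
    by (subst nn_integral_real_affine[where c="-1" and t=0]) (auto intro!: nn_integral_cong simp: indicator_def)
  have "(\<integral>\<^sup>+s\<in>{-pi..pi}. ennreal (?k s) \<partial>lborel) \<le>
      (\<integral>\<^sup>+s. ennreal (?k s) * indicator {-pi..0} s + ennreal (?k s) * indicator {0..pi} s \<partial>lborel)"
    by (intro nn_integral_mono) (auto simp: indicator_def)
  also have "\<dots> = (\<integral>\<^sup>+s\<in>{-pi..0}. ennreal (?k s) \<partial>lborel) + (\<integral>\<^sup>+s\<in>{0..pi}. ennreal (?k s) \<partial>lborel)"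
    by (rule nn_integral_add) measurable
  also have "\<dots> \<le> ennreal (1 / (real n - q) * \<delta> powr (q - real n)) + ennreal (1 / (real n - q) * \<delta> powr (q - real n))"
    unfolding refl by (intro add_mono half)
  also have "\<dots> = ennreal (2 / (real n - q) * \<delta> powr (q - real n))"
  proof -
    have "0 \<le> 1 / (real n - q) * \<delta> powr (q - real n)" using q by simp
    then show ?thesis by (simp add: ennreal_plus[symmetric] del: ennreal_plus)
  qed
  finally show ?thesis .
qed

text \<open>For n \<ge> 1 the Cauchy kernel has mean zero, so \<open>u\<close> may be replaced by
  its increments from the base angle, which are small exactly where the kernel is large. Jensen's
  inequality and integration over the base angle bring in the Lipschitz hypothesis, stated for p-th
  powers and thus linear in |h|.\<close>

lemma circ_int_growth:
  fixes u :: "real \<Rightarrow> complex"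
  assumes p: "1 < p" and n: "1 \<le> n" and c: "0 < c" and K: "0 \<le> K"
    and u [measurable]: "u \<in> borel_measurable borel" and per: "\<And>t. u (t + 2 * pi) = u t"
    and int_u: "integrable arc u"
    and D: "\<And>z. norm z < 1 \<Longrightarrow> D z = of_real c * (LINT t|arc. u t * (cis t / (cis t - z) ^ Suc n))"
    and lip: "\<And>h. \<bar>h\<bar> \<le> pi \<Longrightarrow> (\<integral>\<^sup>+t\<in>{0..2*pi}. ennreal (norm (u (t + h) - u t) powr p) \<partial>lborel) \<le> ennreal (K * \<bar>h\<bar>)"
  shows "\<exists>C>0. \<forall>r. 0 \<le> r \<longrightarrow> r < 1 \<longrightarrow> circ_int p r D \<le> ennreal (C * (1 - r) powr (1 - real n * p))"
proof -
  define q where "q = 1 / p"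
  have q: "0 < q" "q < 1" using p by (auto simp: q_def)
  have nq: "q < real n" using q n by linarith
  define c1 where "c1 = c * 5 ^ Suc n"
  have c1: "0 < c1" using c by (simp add: c1_def)
  define L where "L = c1 * (2 / (real n - q))"
  have L: "0 < L" using c1 nq by (simp add: L_def)
  \<comment> \<open>K + 1 instead of K keeps the constant positive when K = 0.\<close>
  define C where "C = (K + 1) * L powr p"
  have C: "0 < C" using K L by (simp add: C_def)
  show ?thesis
  proof (intro exI[of _ C] conjI C allI impI)
    fix r :: real assume r: "0 \<le> r" "r < 1"
    define \<delta> where "\<delta> = 1 - r"
    have \<delta>: "0 < \<delta>" using r by (simp add: \<delta>_def)
    define W where "W = L * \<delta> powr (q - real n)"
    have W: "0 < W" using L \<delta> by (simp add: W_def)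
    \<comment> \<open>The kernel bound times |s|^(1/p). The increments are divided by |s|^(1/p) in
      return; after the p-th power this is the factor 1 / |s| that cancels the Lipschitz bound. The
      power of 5 in \<open>c1\<close> comes from \<open>norm_cis_diff_ge\<close>.\<close>
    define w where "w s = (if s \<in> {-pi..pi} then c1 * (\<bar>s\<bar> powr q * (\<delta> + \<bar>s\<bar>) powr (- real n - 1)) else 0)" for s
    have w0: "0 \<le> w s" for s using c1 by (simp add: w_def)
    have [measurable]: "w \<in> borel_measurable borel" unfolding w_def by measurable
    have wW: "(\<integral>\<^sup>+s. ennreal (w s) \<partial>lborel) \<le> ennreal W"
    proof -
      have "(\<integral>\<^sup>+s. ennreal (w s) \<partial>lborel) \<le> (\<integral>\<^sup>+s. ennreal c1 * (ennreal ((\<delta> + \<bar>s\<bar>) powr (q - real n - 1)) * indicator {-pi..pi} s) \<partial>lborel)"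
      proof (rule nn_integral_mono)
        fix s
        have "\<bar>s\<bar> powr q * (\<delta> + \<bar>s\<bar>) powr (- real n - 1) \<le> (\<delta> + \<bar>s\<bar>) powr q * (\<delta> + \<bar>s\<bar>) powr (- real n - 1)"
          using q \<delta> by (intro mult_right_mono powr_mono2) auto
        also have "\<dots> = (\<delta> + \<bar>s\<bar>) powr (q + (- real n - 1))" by (rule powr_add[symmetric])
        also have "q + (- real n - 1) = q - real n - 1" by simp
        finally show "ennreal (w s) \<le> ennreal c1 * (ennreal ((\<delta> + \<bar>s\<bar>) powr (q - real n - 1)) * indicator {-pi..pi} s)"
          using c1 by (auto simp: w_def indicator_def ennreal_mult'[symmetric] intro!: ennreal_leI mult_left_mono)
      qed
      also have "\<dots> = ennreal c1 * (\<integral>\<^sup>+s\<in>{-pi..pi}. ennreal ((\<delta> + \<bar>s\<bar>) powr (q - real n - 1)) \<partial>lborel)"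
        by (rule nn_integral_cmult) measurable
      also have "\<dots> \<le> ennreal c1 * ennreal (2 / (real n - q) * \<delta> powr (q - real n))"
        by (intro mult_left_mono nn_integral_abs_kernel \<delta> nq) auto
      also have "\<dots> = ennreal W" using c1 by (simp add: W_def L_def ennreal_mult'[symmetric] mult_ac)
      finally show ?thesis .
    qed
    have nz: "cis t - z \<noteq> 0" if "norm z < 1" for t z using that norm_cis[of t] by (metis less_irrefl right_minus_eq)
    have pointwise: "ennreal (norm (D (of_real r * cis t)) powr p) \<le>
       ennreal (W powr (p - 1)) * (\<integral>\<^sup>+s. ennreal (norm (u (t + s) - u t) powr p * (w s / \<bar>s\<bar>)) \<partial>lborel)" for t
    proof -
      define z where "z = of_real r * cis t"
      have z: "norm z < 1" using r by (simp add: z_def norm_mult)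
      let ?k = "\<lambda>s. cis s / (cis s - z) ^ Suc n"
      have k_cont: "continuous_on UNIV ?k" using nz[OF z] by (intro continuous_intros) auto
      have k_meas [measurable]: "?k \<in> borel_measurable borel" by (rule borel_measurable_continuous_onI[OF k_cont])
      have k_int: "integrable arc ?k" by (rule arc_integral_continuous(1)[OF k_cont])
      have k_norm: "norm (?k s) = 1 / norm (cis s - z) ^ Suc n" for s
        by (simp only: norm_divide norm_power norm_cis)
      have uk_int: "integrable arc (\<lambda>s. u s * ?k s)"
      proof (rule Bochner_Integration.integrable_bound)
        show "integrable arc (\<lambda>s. of_real (1 / (1 - r) ^ Suc n) * u s)" using int_u by simp
        have "norm (u s * ?k s) \<le> norm (of_real (1 / (1 - r) ^ Suc n) * u s)" for s
        proof -
          have "1 - r \<le> norm (cis s - z)" using norm_triangle_ineq2[of "cis s" z] r by (simp add: z_def norm_mult)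
          then have "(1 - r) ^ Suc n \<le> norm (cis s - z) ^ Suc n" using r by (intro power_mono) auto
          moreover have "0 < (1 - r) ^ Suc n" using r by (intro zero_less_power) simp
          ultimately have "norm (?k s) \<le> 1 / (1 - r) ^ Suc n" unfolding k_norm by (intro frac_le) auto
          then have "norm (u s) * norm (?k s) \<le> norm (u s) * (1 / (1 - r) ^ Suc n)" by (intro mult_left_mono) auto
          moreover have "norm (of_real (1 / (1 - r) ^ Suc n) :: complex) = 1 / (1 - r) ^ Suc n"
            unfolding norm_of_real using r by (intro abs_of_nonneg divide_nonneg_nonneg zero_le_power) auto
          ultimately show ?thesis by (simp only: norm_mult mult.commute)
        qed
        then show "AE s in arc. norm (u s * ?k s) \<le> norm (of_real (1 / (1 - r) ^ Suc n) * u s)" by simp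
      qed measurable
      \<comment> \<open>Cauchy's formula for the constant function 1, whose n-th derivative
        vanishes.\<close>
      have "0 = of_real (fact n / (2 * pi)) * (LINT s|arc. (\<lambda>_. 1) (cis s) * ?k s)"
        using higher_deriv_unit_circle[of "\<lambda>_. 1" 2 z n] z n by simp
      then have "(LINT s|arc. ?k s) = 0" by simp
      then have zero: "(LINT s|arc. u t * ?k s) = 0" by (simp only: integral_mult_right_zero mult_zero_right)
      then have "D z = of_real c * (LINT s|arc. u s * ?k s - u t * ?k s)"
        unfolding D[OF z] Bochner_Integration.integral_diff[OF uk_int integrable_mult_right[OF k_int]] zero
        by (simp del: power_Suc)
      also have "\<dots> = of_real c * (LINT s|arc. (u s - u t) * ?k s)"
        by (simp only: left_diff_distrib)
      finally have Dz: "D z = of_real c * (LINT s|arc. (u s - u t) * ?k s)" .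
      have int': "integrable arc (\<lambda>s. (u s - u t) * ?k s)"
        using uk_int k_int unfolding left_diff_distrib
        by (intro Bochner_Integration.integrable_diff integrable_mult_right) auto
      let ?U = "\<lambda>s. norm (u (t + s) - u t)"
      let ?v = "\<lambda>s. ennreal (norm ((u s - u t) * ?k s))"
      have v_per: "?v (s + 2 * pi) = ?v s" for s using per[of s] by (simp add: cis_mult[symmetric] cis_2pi)
      have v_meas: "?v \<in> borel_measurable borel" by measurable
      have "ennreal (norm (D z)) \<le> ennreal c * (\<integral>\<^sup>+s. ?v s \<partial>arc)"
        unfolding Dz using integral_norm_bound_ennreal[OF int'] c
        by (simp add: norm_mult ennreal_mult' mult_left_mono del: power_Suc)
      also have "(\<integral>\<^sup>+s. ?v s \<partial>arc) = (\<integral>\<^sup>+s\<in>{0..2*pi}. ?v s \<partial>lborel)"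
        by (rule nn_integral_arc[OF v_meas])
      \<comment> \<open>The period is centred at the base angle, so that the remaining offset
        satisfies |s| \<le> pi as the kernel estimate requires.\<close>
      also have "\<dots> = (\<integral>\<^sup>+s\<in>{t-pi..t-pi+2*pi}. ?v s \<partial>lborel)"
        using nn_integral_periodic[OF v_meas _ v_per, of "t - pi"] by simp
      also have "\<dots> = (\<integral>\<^sup>+s\<in>{-pi..<pi}. ?v (s + t) \<partial>lborel)"
        unfolding nn_integral_Ico_Icc by (subst nn_integral_Ico_shift[OF v_meas]) (simp add: algebra_simps)
      also have "\<dots> \<le> (\<integral>\<^sup>+s\<in>{-pi..pi}. ?v (s + t) \<partial>lborel)"
        by (intro nn_integral_mono) (auto simp: indicator_def)
      also have "ennreal c * \<dots> = (\<integral>\<^sup>+s. ennreal c * (?v (s + t) * indicator {-pi..pi} s) \<partial>lborel)"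
        by (rule nn_integral_cmult[symmetric]) measurable
      also have "\<dots> \<le> (\<integral>\<^sup>+s. ennreal ((?U s / \<bar>s\<bar> powr q) * w s) \<partial>lborel)"
      proof (rule nn_integral_mono)
        fix s
        show "ennreal c * (?v (s + t) * indicator {-pi..pi} s) \<le> ennreal ((?U s / \<bar>s\<bar> powr q) * w s)"
        proof (cases "s \<in> {-pi..pi} \<and> s \<noteq> 0")
          case True
          have "norm (cis (s + t) - z) = norm (cis t * (cis s - of_real r))"
            by (simp add: z_def cis_mult[symmetric] algebra_simps)
          also have "\<dots> = norm (cis s - of_real r)" by (simp add: norm_mult)
          also have "\<dots> \<ge> (\<delta> + \<bar>s\<bar>) / 5" unfolding \<delta>_def using r True by (intro norm_cis_diff_ge) auto
          finally have ge: "(\<delta> + \<bar>s\<bar>) / 5 \<le> norm (cis (s + t) - z)" .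
          then have "((\<delta> + \<bar>s\<bar>) / 5) ^ Suc n \<le> norm (cis (s + t) - z) ^ Suc n" using \<delta> by (intro power_mono) auto
          moreover have pos: "0 < ((\<delta> + \<bar>s\<bar>) / 5) ^ Suc n" using \<delta> by (intro zero_less_power) simp
          ultimately have "norm (?k (s + t)) \<le> 1 / ((\<delta> + \<bar>s\<bar>) / 5) ^ Suc n" unfolding k_norm by (intro frac_le) auto
          also have "\<dots> = 5 ^ Suc n * (\<delta> + \<bar>s\<bar>) powr (- real n - 1)"
          proof -
            have "(\<delta> + \<bar>s\<bar>) powr (- real n - 1) = (\<delta> + \<bar>s\<bar>) powr (- real (Suc n))"
              by (rule arg_cong[where f="\<lambda>x. (\<delta> + \<bar>s\<bar>) powr x"]) simp
            also have "\<dots> = 1 / (\<delta> + \<bar>s\<bar>) ^ Suc n" using \<delta> by (subst powr_minus_divide, subst powr_realpow) auto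
            finally show ?thesis by (simp only: power_divide) simp
          qed
          finally have "?U s * norm (?k (s + t)) \<le> ?U s * (5 ^ Suc n * (\<delta> + \<bar>s\<bar>) powr (- real n - 1))"
            by (intro mult_left_mono) auto
          then have "c * (?U s * norm (?k (s + t))) \<le> c * (?U s * (5 ^ Suc n * (\<delta> + \<bar>s\<bar>) powr (- real n - 1)))"
            by (rule mult_left_mono) (use c in simp)
          also have "\<dots> = (?U s / \<bar>s\<bar> powr q) * w s"
            using True by (simp add: w_def c1_def)
          finally have "ennreal (c * (?U s * norm (?k (s + t)))) \<le> ennreal ((?U s / \<bar>s\<bar> powr q) * w s)"
            by (rule ennreal_leI)
          moreover have "?v (s + t) = ennreal (?U s * norm (?k (s + t)))"
            by (simp only: norm_mult add.commute)
          ultimately show ?thesis using True c by (simp add: ennreal_mult' del: power_Suc)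
        qed auto
      qed
      finally have "ennreal (norm (D z)) \<le> (\<integral>\<^sup>+s. ennreal ((?U s / \<bar>s\<bar> powr q) * w s) \<partial>lborel)"
        by (rule order_trans) (auto intro!: mult_left_mono)
      then have "ennreal (norm (D z) powr p) \<le> ennreal (W powr (p - 1)) * (\<integral>\<^sup>+s. ennreal ((?U s / \<bar>s\<bar> powr q) powr p * w s) \<partial>lborel)"
        using p W w0 wW by (intro jensen_powr_nn_integral) auto
      moreover have "(?U s / \<bar>s\<bar> powr q) powr p * w s = ?U s powr p * (w s / \<bar>s\<bar>)" for s
        using p by (simp add: powr_divide powr_powr q_def)
      ultimately show ?thesis by (simp only: z_def)
    qed
    have "circ_int p r D \<le> (\<integral>\<^sup>+t. ennreal (W powr (p - 1)) * (\<integral>\<^sup>+s. ennreal (norm (u (t + s) - u t) powr p * (w s / \<bar>s\<bar>)) * indicator {0..2*pi} t \<partial>lborel) \<partial>lborel)"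
      unfolding circ_int_def using pointwise by (intro nn_integral_mono) (auto simp: indicator_def)
    also have "\<dots> = ennreal (W powr (p - 1)) * (\<integral>\<^sup>+t. (\<integral>\<^sup>+s. ennreal (norm (u (t + s) - u t) powr p * (w s / \<bar>s\<bar>)) * indicator {0..2*pi} t \<partial>lborel) \<partial>lborel)"
      by (rule nn_integral_cmult) measurable
    also have "(\<integral>\<^sup>+t. (\<integral>\<^sup>+s. ennreal (norm (u (t + s) - u t) powr p * (w s / \<bar>s\<bar>)) * indicator {0..2*pi} t \<partial>lborel) \<partial>lborel)
      = (\<integral>\<^sup>+s. (\<integral>\<^sup>+t. ennreal (norm (u (t + s) - u t) powr p * (w s / \<bar>s\<bar>)) * indicator {0..2*pi} t \<partial>lborel) \<partial>lborel)"
      by (rule lborel_pair.Fubini'[symmetric]) measurable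
    also have "\<dots> \<le> (\<integral>\<^sup>+s. ennreal (K + 1) * ennreal (w s) \<partial>lborel)"
    proof (rule nn_integral_mono)
      fix s
      show "(\<integral>\<^sup>+t. ennreal (norm (u (t + s) - u t) powr p * (w s / \<bar>s\<bar>)) * indicator {0..2*pi} t \<partial>lborel) \<le> ennreal (K + 1) * ennreal (w s)"
      proof (cases "s \<in> {-pi..pi} \<and> s \<noteq> 0")
        case True
        have "(\<integral>\<^sup>+t. ennreal (norm (u (t + s) - u t) powr p * (w s / \<bar>s\<bar>)) * indicator {0..2*pi} t \<partial>lborel) =
          (\<integral>\<^sup>+t. ennreal (w s / \<bar>s\<bar>) * (ennreal (norm (u (t + s) - u t) powr p) * indicator {0..2*pi} t) \<partial>lborel)"
        proof (rule nn_integral_cong)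
          fix t
          have "ennreal (norm (u (t + s) - u t) powr p * (w s / \<bar>s\<bar>)) = ennreal (w s / \<bar>s\<bar>) * ennreal (norm (u (t + s) - u t) powr p)"
            using w0[of s] by (subst mult.commute, intro ennreal_mult') simp
          then show "ennreal (norm (u (t + s) - u t) powr p * (w s / \<bar>s\<bar>)) * indicator {0..2*pi} t =
              ennreal (w s / \<bar>s\<bar>) * (ennreal (norm (u (t + s) - u t) powr p) * indicator {0..2*pi} t)"
            by (simp only: mult.assoc)
        qed
        also have "\<dots> = ennreal (w s / \<bar>s\<bar>) * (\<integral>\<^sup>+t\<in>{0..2*pi}. ennreal (norm (u (t + s) - u t) powr p) \<partial>lborel)"
          by (rule nn_integral_cmult) measurable
        also have "\<dots> \<le> ennreal (w s / \<bar>s\<bar>) * ennreal (K * \<bar>s\<bar>)"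
          using True by (intro mult_left_mono lip) auto
        also have "\<dots> = ennreal (w s * K)" using w0[of s] True by (simp add: ennreal_mult'[symmetric])
        also have "\<dots> \<le> ennreal ((K + 1) * w s)" using w0[of s] by (intro ennreal_leI) (simp add: algebra_simps)
        finally show ?thesis using K by (simp add: ennreal_mult')
      qed (auto simp: w_def)
    qed
    also have "\<dots> = ennreal (K + 1) * (\<integral>\<^sup>+s. ennreal (w s) \<partial>lborel)" by (rule nn_integral_cmult) measurable
    also have "\<dots> \<le> ennreal (K + 1) * ennreal W" by (intro mult_left_mono wW) simp
    also have "ennreal (W powr (p - 1)) * (ennreal (K + 1) * ennreal W) = ennreal (C * \<delta> powr (1 - real n * p))"
    proof -
      have "W powr (p - 1) * W = W powr p" using W powr_add[of W "p - 1" 1] by simp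
      also have "\<dots> = L powr p * \<delta> powr ((q - real n) * p)" using L \<delta> by (simp add: W_def powr_mult powr_powr)
      also have "(q - real n) * p = 1 - real n * p" using p by (simp add: q_def field_simps)
      finally have "W powr (p - 1) * ((K + 1) * W) = C * \<delta> powr (1 - real n * p)" by (simp add: C_def algebra_simps)
      moreover have "0 \<le> K + 1" using K by simp
      ultimately show ?thesis by (simp only: ennreal_mult'[symmetric] powr_ge_zero)
    qed
    finally show "circ_int p r D \<le> ennreal (C * (1 - r) powr (1 - real n * p))"
      by (simp add: \<delta>_def mult_left_mono)
  qed
qed


text \<open>The modulus of continuity controls only small positive shifts. Larger ones are covered
  by the L^p bound of the boundary function, negative ones by translating the period; then
  \<open>circ_int_growth\<close> applies to the Cauchy integral of the boundary function.\<close>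

lemma mean_lipschitz_growth:
  assumes p: "1 < p" and g: "g \<in> mean_lipschitz p (1 / p)" and n: "1 \<le> n"
  shows "\<exists>C>0. \<forall>r. 0 \<le> r \<longrightarrow> r < 1 \<longrightarrow> circ_int p r ((deriv ^^ n) g) \<le> ennreal (C * (1 - r) powr (1 - real n * p))"
proof -
  obtain \<phi> K where hol: "g holomorphic_on unit_disc" and fin: "hardy_norm p g < \<infinity>"
    and \<phi> [measurable]: "\<phi> \<in> borel_measurable borel"
    and lim: "AE t in lborel. ((\<lambda>r. g (of_real r * cis t)) \<longlongrightarrow> \<phi> (cis t)) (at_left 1)"
    and ev: "\<forall>\<^sub>F t in at_right 0. modulus_cont p \<phi> t \<le> ennreal (K * t powr (1 / p))"
    using g unfolding mean_lipschitz_def hardy_space_def is_boundary_function_def by blast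
  define u where "u t = \<phi> (cis t)" for t
  have [measurable]: "cis \<in> borel_measurable borel"
    by (intro borel_measurable_continuous_onI continuous_intros)
  have u [measurable]: "u \<in> borel_measurable borel" unfolding u_def by measurable
  have per: "u (t + 2 * pi) = u t" for t by (simp add: u_def cis_mult[symmetric] cis_2pi)
  obtain N where N: "hardy_norm p g = ennreal N" "0 \<le> N" using fin by (cases "hardy_norm p g") auto
  define B where "B = 2 * pi * N powr p"
  have B: "0 \<le> B" by (simp add: B_def)
  have bd: "circ_int p r g \<le> ennreal B" if "0 < r" "r < 1" for r
    unfolding B_def
  proof (rule int_mean_le_imp_circ_int_le)
    have "int_mean p r g \<le> hardy_norm p g" unfolding hardy_norm_def using that by (intro SUP_upper) auto
    then show "int_mean p r g \<le> ennreal N" using N by simp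
  qed (use p N in auto)
  note bi = higher_deriv_boundary_integral[OF p hol _ u bd lim[folded u_def]]
  have int_u: "integrable arc u" by (rule bi(1)[where z=0]) auto
  have up: "(\<integral>\<^sup>+t\<in>{0..2*pi}. ennreal (norm (u t) powr p) \<partial>lborel) \<le> ennreal B" by (rule bi(2)[where z=0]) auto
  define I where "I h = (\<integral>\<^sup>+t\<in>{0..2*pi}. ennreal (norm (u (t + h) - u t) powr p) \<partial>lborel)" for h
  obtain b where b: "0 < b" and mb: "\<And>t. 0 < t \<Longrightarrow> t < b \<Longrightarrow> modulus_cont p \<phi> t \<le> ennreal (K * t powr (1 / p))"
    using ev unfolding eventually_at_right_field by auto
  define K1 where "K1 = max K 0"
  have small: "I h \<le> ennreal (2 * pi * K1 powr p * h)" if h: "0 < h" "h < b" for h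
  proof -
    have "ennpowr (ennreal (1 / (2 * pi)) * I h) (1 / p) \<le> modulus_cont p \<phi> h"
      unfolding modulus_cont_def I_def u_def using h by (intro SUP_upper2[of h]) auto
    also have "\<dots> \<le> ennreal (K * h powr (1 / p))" using mb h by blast
    also have "\<dots> \<le> ennreal (K1 * h powr (1 / p))" by (intro ennreal_leI mult_right_mono) (auto simp: K1_def)
    finally have "ennreal (1 / (2 * pi)) * I h \<le> ennreal ((K1 * h powr (1 / p)) powr p)"
      using p by (intro ennpowr_le_ennreal) (auto simp: K1_def)
    also have "(K1 * h powr (1 / p)) powr p = K1 powr p * h" using p h by (simp add: powr_mult powr_powr)
    finally have "ennreal (2 * pi) * (ennreal (1 / (2 * pi)) * I h) \<le> ennreal (2 * pi) * ennreal (K1 powr p * h)"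
      by (rule mult_left_mono) simp
    moreover have "ennreal (2 * pi) * (ennreal (1 / (2 * pi)) * I h) = I h"
      by (subst mult.assoc[symmetric], subst ennreal_mult[symmetric]) auto
    moreover have "ennreal (2 * pi) * ennreal (K1 powr p * h) = ennreal (2 * pi * K1 powr p * h)"
      by (subst ennreal_mult'[symmetric]) (auto simp: mult_ac)
    ultimately show ?thesis by simp
  qed
  have all: "I h \<le> ennreal (2 powr p * (2 * B))" for h
  proof -
    have m: "(\<lambda>t. ennreal (norm (u t) powr p)) \<in> borel_measurable borel" by measurable
    have "I h \<le> (\<integral>\<^sup>+t. ennreal (2 powr p) * (ennreal (norm (u (t + h)) powr p) * indicator {0..2*pi} t + ennreal (norm (u t) powr p) * indicator {0..2*pi} t) \<partial>lborel)"
      unfolding I_def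
    proof (rule nn_integral_mono)
      fix t
      have "norm (u (t + h) - u t) powr p \<le> (norm (u (t + h)) + norm (u t)) powr p"
        using p by (intro powr_mono2 norm_triangle_ineq4) auto
      also have "\<dots> \<le> 2 powr p * (norm (u (t + h)) powr p + norm (u t) powr p)"
        using p by (intro powr_add_le) auto
      finally show "ennreal (norm (u (t + h) - u t) powr p) * indicator {0..2*pi} t \<le>
          ennreal (2 powr p) * (ennreal (norm (u (t + h)) powr p) * indicator {0..2*pi} t + ennreal (norm (u t) powr p) * indicator {0..2*pi} t)"
        by (auto simp: indicator_def ennreal_mult'[symmetric] ennreal_plus[symmetric] ennreal_leI simp del: ennreal_plus)
    qed
    also have "\<dots> = ennreal (2 powr p) * ((\<integral>\<^sup>+t\<in>{0..2*pi}. ennreal (norm (u (t + h)) powr p) \<partial>lborel) + (\<integral>\<^sup>+t\<in>{0..2*pi}. ennreal (norm (u t) powr p) \<partial>lborel))"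
      by (subst nn_integral_cmult, measurable, subst nn_integral_add) auto
    also have "(\<integral>\<^sup>+t\<in>{0..2*pi}. ennreal (norm (u (t + h)) powr p) \<partial>lborel) = (\<integral>\<^sup>+t\<in>{0..2*pi}. ennreal (norm (u t) powr p) \<partial>lborel)"
      by (rule nn_integral_periodic_shift[OF m]) (simp_all add: per)
    also have "ennreal (2 powr p) * ((\<integral>\<^sup>+t\<in>{0..2*pi}. ennreal (norm (u t) powr p) \<partial>lborel) + (\<integral>\<^sup>+t\<in>{0..2*pi}. ennreal (norm (u t) powr p) \<partial>lborel))
        \<le> ennreal (2 powr p) * (ennreal B + ennreal B)"
      by (intro mult_left_mono add_mono up) simp
    also have "\<dots> = ennreal (2 powr p * (2 * B))"
      using B by (simp add: ennreal_mult'[symmetric] ennreal_plus[symmetric] del: ennreal_plus)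
    finally show ?thesis .
  qed
  \<comment> \<open>The second entry makes the trivial bound on increments linear in h once h \<ge>
    b.\<close>
  define K2 where "K2 = max (2 * pi * K1 powr p) (2 powr p * (2 * B) / b)"
  have K2: "0 \<le> K2" using B b by (simp add: K2_def max_def)
  have pos: "I h \<le> ennreal (K2 * h)" if "0 < h" for h
  proof (cases "h < b")
    case True
    have "2 * pi * K1 powr p * h \<le> K2 * h" using that by (intro mult_right_mono) (auto simp: K2_def)
    then show ?thesis using small[OF that True] order_trans ennreal_leI by blast
  next
    case False
    have "2 powr p * (2 * B) = 2 powr p * (2 * B) / b * b" using b by simp
    also have "\<dots> \<le> K2 * h" using False b B K2 by (intro mult_mono) (auto simp: K2_def)
    finally show ?thesis using all[of h] order_trans ennreal_leI by blast
  qed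
  have lip: "I h \<le> ennreal (K2 * \<bar>h\<bar>)" for h
  proof -
    consider "h = 0" | "0 < h" | "h < 0" by linarith
    then show ?thesis
    proof cases
      case 1
      then show ?thesis using p by (simp add: I_def)
    next
      case 2
      then show ?thesis using pos[of h] by simp
    next
      case 3
      have "I h = (\<integral>\<^sup>+t\<in>{0..2*pi}. ennreal (norm (u (t + (- h) + h) - u (t + (- h))) powr p) \<partial>lborel)"
        unfolding I_def
      proof (rule nn_integral_periodic_shift[symmetric])
        fix x
        have "u (x + 2 * pi + h) = u (x + h)" using per[of "x + h"] by (simp add: add_ac)
        then show "ennreal (norm (u (x + 2 * pi + h) - u (x + 2 * pi)) powr p) = ennreal (norm (u (x + h) - u x) powr p)"
          by (simp add: per)
      qed simp_all
      also have "\<dots> = I (- h)" unfolding I_def by (simp add: norm_minus_commute)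
      finally show ?thesis using pos[of "- h"] 3 by simp
    qed
  qed
  have "0 < fact n / (2 * pi)" by simp
  from circ_int_growth[OF p n this K2 u per int_u, of "(deriv ^^ n) g"] show ?thesis
    using bi(3)[where n=n] lip unfolding I_def by blast
qed

section \<open>Transforms of measures on the radius\<close>

lemma disc_scale:
  fixes z :: complex
  assumes "0 \<le> t" "t \<le> 1" "norm z < 1"
  shows "norm (of_real t * z) < 1"
  using assms mult_left_le_one_le[of "norm z" t] by (simp add: norm_mult)

lemma borel_measurable_disc_cutoff:
  fixes k :: "complex \<Rightarrow> complex"
  assumes "continuous_on unit_disc k"
  shows "(\<lambda>z. indicator unit_disc z *\<^sub>R k z) \<in> borel_measurable borel"
  by (rule borel_measurable_continuous_on_indicator[OF _ assms]) auto

text \<open>The complex density is f on the radius, or t f(t) after one differentiation in z; both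
  are dominated by the same mass |f|.\<close>

locale radial_density = radial_mass a for a +
  fixes b :: "real \<Rightarrow> complex"
  assumes b_measurable [measurable]: "b \<in> borel_measurable borel"
    and b_le: "norm (b t) \<le> a t"
begin

lemma b_supp: "t \<notin> {0..<1} \<Longrightarrow> b t = 0"
  using b_le[of t] mass_supp[of t] by simp

definition transform :: "(complex \<Rightarrow> complex) \<Rightarrow> complex \<Rightarrow> complex"
  where "transform k z = (LINT t|lborel. b t * k (of_real t * z))"

lemma integrable_transform:
  assumes k: "continuous_on unit_disc k" and z: "norm z < 1"
  shows "integrable lborel (\<lambda>t. b t * k (of_real t * z))"
proof -
  have c: "continuous_on {0..1::real} (\<lambda>t. k (of_real t * z))"
    by (rule continuous_on_compose2[OF k]) (use disc_scale z in \<open>auto intro!: continuous_intros\<close>)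
  obtain B where B: "\<And>t. t \<in> {0..1::real} \<Longrightarrow> norm (k (of_real t * z)) \<le> B"
    using compact_imp_bounded[OF compact_continuous_image[OF c]] unfolding bounded_iff by blast
  have m: "(\<lambda>t. indicator {0..1} t *\<^sub>R k (of_real t * z)) \<in> borel_measurable borel"
    by (rule borel_measurable_continuous_on_indicator[OF _ c]) auto
  have eq: "b t * k (of_real t * z) = b t * (indicator {0..1} t *\<^sub>R k (of_real t * z))" for t
    using b_supp[of t] by (auto simp: indicator_def)
  show ?thesis
  proof (rule Bochner_Integration.integrable_bound[where f="\<lambda>t. \<bar>B\<bar> * a t"])
    show "integrable lborel (\<lambda>t. \<bar>B\<bar> * a t)" using integrable_mass by simp
    show "(\<lambda>t. b t * k (of_real t * z)) \<in> borel_measurable lborel"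
      unfolding eq using m by measurable
    have "norm (b t * k (of_real t * z)) \<le> norm (\<bar>B\<bar> * a t)" for t
    proof (cases "t \<in> {0..<1}")
      case True
      then have "norm (k (of_real t * z)) \<le> \<bar>B\<bar>" using B[of t] by auto
      then have "norm (b t) * norm (k (of_real t * z)) \<le> a t * \<bar>B\<bar>"
        by (intro mult_mono b_le) (auto simp: mass_nonneg)
      then show ?thesis using mass_nonneg[of t] by (simp add: norm_mult abs_mult mult.commute)
    qed (simp add: b_supp)
    then show "AE t in lborel. norm (b t * k (of_real t * z)) \<le> norm (\<bar>B\<bar> * a t)" by simp
  qed
qed

lemma radial_density_times_t: "radial_density a (\<lambda>t. b t * of_real t)"
proof
  fix t
  show "norm (b t * of_real t) \<le> a t"
  proof (cases "t \<in> {0..<1}")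
    case True
    then have "norm (b t) * \<bar>t\<bar> \<le> a t * 1" by (intro mult_mono b_le) (auto simp: mass_nonneg)
    then show ?thesis by (simp add: norm_mult)
  qed (simp add: b_supp mass_nonneg)
qed measurable

text \<open>Differentiation under the integral sign: the first-order Taylor error of k at t z is at
  most a constant times |w - z|^2, uniformly in t, and integrates to the mass times that. The inner
  derivative t is absorbed in the density.\<close>

lemma transform_has_field_derivative:
  assumes k: "k holomorphic_on unit_disc" and z: "norm z < 1"
  shows "(transform k has_field_derivative radial_density.transform (\<lambda>t. b t * of_real t) (deriv k) z) (at z)"
proof -
  interpret bt: radial_density a "\<lambda>t. b t * of_real t" by (rule radial_density_times_t)
  have ck: "continuous_on unit_disc k" by (rule holomorphic_on_imp_continuous_on[OF k])
  have hk: "deriv k holomorphic_on unit_disc" by (intro holomorphic_deriv k) auto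
  have ck1: "continuous_on unit_disc (deriv k)" by (rule holomorphic_on_imp_continuous_on[OF hk])
  have ck2: "continuous_on unit_disc (deriv (deriv k))"
    by (intro holomorphic_on_imp_continuous_on holomorphic_deriv hk) auto
  \<comment> \<open>A closed ball inside the disc that contains a neighbourhood of z and is mapped
    into itself by multiplication with t in [0,1); there the second derivative of k is
    bounded.\<close>
  define R where "R = (1 + norm z) / 2"
  have R: "norm z < R" "R < 1" using z by (auto simp: R_def)
  have sub: "cball (0::complex) R \<subseteq> unit_disc" using R by auto
  obtain B where B: "\<And>w. w \<in> cball 0 R \<Longrightarrow> norm (deriv (deriv k) w) \<le> B"
    using compact_imp_bounded[OF compact_continuous_image[OF continuous_on_subset[OF ck2 sub] compact_cball]]
    unfolding bounded_iff by blast
  have "0 \<le> R" using R norm_ge_zero[of z] by linarith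
  then have B0: "0 \<le> B" using B[of 0] order_trans[OF norm_ge_zero] by simp
  have dk: "(deriv k has_field_derivative deriv (deriv k) w) (at w within cball 0 R)"
       "(k has_field_derivative deriv k w) (at w within cball 0 R)" if "w \<in> cball 0 R" for w
    using that sub holomorphic_derivI[OF hk, of w] holomorphic_derivI[OF k, of w]
    by (auto intro: has_field_derivative_at_within)
  have taylor: "norm (k w' - (k w + deriv k w * (w' - w))) \<le> B * norm (w' - w) ^ 2"
    if "w \<in> cball 0 R" "w' \<in> cball 0 R" for w w'
  proof -
    have "((deriv ^^ i) k has_field_derivative (deriv ^^ Suc i) k x) (at x within cball 0 R)"
      if "x \<in> cball 0 R" "i \<le> 1" for i x
      using that dk by (cases i) auto
    from complex_Taylor[of "cball 0 R" 1 "\<lambda>i. (deriv ^^ i) k", OF convex_cball this _ that, of B] B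
    show ?thesis by (simp add: numeral_2_eq_2)
  qed
  define M where "M = integral\<^sup>L lborel a"
  have est: "norm (transform k w - transform k z - bt.transform (deriv k) z * (w - z)) \<le> B * M * norm (w - z) ^ 2"
    if w: "w \<in> ball 0 R" for w
  proof -
    have w1: "norm w < 1" using w R by auto
    note i1 = integrable_transform[OF ck w1] and i2 = integrable_transform[OF ck z]
      and i3 = integrable_mult_left[OF bt.integrable_transform[OF ck1 z], of "w - z"]
    have eq: "transform k w - transform k z - bt.transform (deriv k) z * (w - z) =
        (LINT t|lborel. b t * k (of_real t * w) - b t * k (of_real t * z) - b t * of_real t * deriv k (of_real t * z) * (w - z))"
      unfolding transform_def bt.transform_def using i1 i2 i3 by simp
    have "norm (LINT t|lborel. b t * k (of_real t * w) - b t * k (of_real t * z) - b t * of_real t * deriv k (of_real t * z) * (w - z))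
        \<le> (LINT t|lborel. B * norm (w - z) ^ 2 * a t)"
    proof (rule Bochner_Integration.integral_norm_bound_integral)
      fix t :: real
      show "norm (b t * k (of_real t * w) - b t * k (of_real t * z) - b t * of_real t * deriv k (of_real t * z) * (w - z)) \<le> B * norm (w - z) ^ 2 * a t"
      proof (cases "t \<in> {0..<1}")
        case True
        have in_ball: "of_real t * v \<in> cball 0 R" if "norm v \<le> R" for v :: complex
          using that True mult_left_le_one_le[of "norm v" t] by (auto simp: norm_mult)
        have "norm (k (of_real t * w) - (k (of_real t * z) + deriv k (of_real t * z) * (of_real t * w - of_real t * z)))
           \<le> B * norm (of_real t * w - of_real t * z) ^ 2"
          using w R by (intro taylor in_ball) auto
        also have "\<dots> \<le> B * norm (w - z) ^ 2"
        proof -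
          have "norm (of_real t * w - of_real t * z) = t * norm (w - z)"
            using True by (simp add: norm_mult right_diff_distrib[symmetric])
          also have "\<dots> \<le> norm (w - z)" using True by (intro mult_left_le_one_le) auto
          finally show ?thesis using B0 by (intro mult_left_mono power_mono) auto
        qed
        finally have "norm (b t) * norm (k (of_real t * w) - (k (of_real t * z) + deriv k (of_real t * z) * (of_real t * w - of_real t * z)))
          \<le> a t * (B * norm (w - z) ^ 2)"
          by (intro mult_mono b_le) (auto simp: mass_nonneg)
        then show ?thesis by (simp add: norm_mult[symmetric] algebra_simps)
      qed (simp add: b_supp mass_supp)
    next
      show "integrable lborel (\<lambda>t. B * norm (w - z) ^ 2 * a t)" using integrable_mass by simp
    qed (use i1 i2 i3 in auto)
    then show ?thesis unfolding eq M_def by (simp add: mult_ac)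
  qed
  show ?thesis
    unfolding has_field_derivative_iff
  proof (rule LIM_zero_cancel, rule Lim_null_comparison)
    have "\<forall>\<^sub>F w in at z. w \<in> ball 0 R"
      using R by (intro eventually_at_in_open') auto
    then show "\<forall>\<^sub>F w in at z. norm ((transform k w - transform k z) / (w - z) - bt.transform (deriv k) z) \<le> B * M * norm (w - z)"
      using eventually_neq_at_within[of z z UNIV]
    proof eventually_elim
      case (elim w)
      then have nz: "w - z \<noteq> 0" by simp
      have "(transform k w - transform k z) / (w - z) - bt.transform (deriv k) z = (transform k w - transform k z - bt.transform (deriv k) z * (w - z)) / (w - z)"
        using nz by (simp add: field_simps)
      then show ?case using est[OF elim(1)] nz
        by (simp add: norm_divide divide_le_eq power2_eq_square mult.assoc)
    qed
    have "((\<lambda>w. B * M * norm (w - z)) \<longlongrightarrow> B * M * norm (z - z)) (at z)" by (intro tendsto_intros)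
    then show "((\<lambda>w. B * M * norm (w - z)) \<longlongrightarrow> 0) (at z)" by simp
  qed
qed

lemma transform_holomorphic:
  assumes "k holomorphic_on unit_disc"
  shows "transform k holomorphic_on unit_disc"
  unfolding holomorphic_on_open[OF open_ball]
  using transform_has_field_derivative[OF assms] by (metis mem_ball_0)

text \<open>Minkowski's integral inequality in Jensen form. The p-mean of \<open>G\<close> on the
  circle of radius t r grows at most like (1 - t r)^(-\<beta>) with \<beta> = n - 1 / p; this power
  goes into the weight, whose mass is then \<open>Phi a \<beta> r\<close>, and the compensated
  function has p-th means at most \<open>C\<close>.\<close>

lemma circ_int_transform_le:
  assumes p: "1 < p" and G: "continuous_on unit_disc G" and n: "1 \<le> n" and C: "0 \<le> C"
    and gr: "\<And>r. 0 \<le> r \<Longrightarrow> r < 1 \<Longrightarrow> circ_int p r G \<le> ennreal (C * (1 - r) powr (1 - real n * p))"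
    and r: "0 \<le> r" "r < 1"
  shows "circ_int p r (transform G) \<le> ennreal (C * Phi a (real n - 1 / p) r powr p)"
proof -
  define \<beta> where "\<beta> = real n - 1 / p"
  have "1 / p < 1" using p by simp
  then have \<beta>: "0 < \<beta>" using n by (simp add: \<beta>_def)
  define W where "W = Phi a \<beta> r"
  \<comment> \<open>Extension by zero makes the integrand jointly measurable for Tonelli; on the
    circles in question nothing changes.\<close>
  define Gm where "Gm z = indicator unit_disc z *\<^sub>R G z" for z
  have [measurable]: "Gm \<in> borel_measurable borel"
    unfolding Gm_def by (rule borel_measurable_disc_cutoff[OF G])
  have [measurable]: "cis \<in> borel_measurable borel"
    by (intro borel_measurable_continuous_onI continuous_intros)
  have Gm: "Gm (of_real t * (of_real r * cis \<theta>)) = G (of_real t * (of_real r * cis \<theta>))" if "t \<in> {0..<1}" for t \<theta>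
  proof -
    have "norm (of_real t * (of_real r * cis \<theta>)) < 1"
      by (rule disc_scale) (use that r in \<open>auto simp: norm_mult\<close>)
    then show ?thesis by (simp add: Gm_def)
  qed
  define w where "w t = a t * (1 - t * r) powr (- \<beta>)" for t
  have [measurable]: "w \<in> borel_measurable borel" unfolding w_def by measurable
  have w0: "0 \<le> w t" for t by (simp add: w_def mass_nonneg)
  have wW: "(\<integral>\<^sup>+t. ennreal (w t) \<partial>lborel) = ennreal W"
    unfolding w_def W_def using r \<beta> by (simp add: Phi_eq_nn_integral)
  have W0: "0 \<le> W" by (simp add: W_def Phi_nonneg)
  let ?U = "\<lambda>\<theta> t. norm (Gm (of_real t * (of_real r * cis \<theta>))) * (1 - t * r) powr \<beta>"
  have pointwise: "ennreal (norm (transform G (of_real r * cis \<theta>)) powr p) \<le>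
      ennreal (W powr (p - 1)) * (\<integral>\<^sup>+t. ennreal (?U \<theta> t powr p * w t) \<partial>lborel)" for \<theta>
  proof -
    let ?z = "of_real r * cis \<theta>"
    have z: "norm ?z < 1" using r by (simp add: norm_mult)
    have "ennreal (norm (transform G ?z)) \<le> (\<integral>\<^sup>+t. ennreal (norm (b t * G (of_real t * ?z))) \<partial>lborel)"
      unfolding transform_def by (rule integral_norm_bound_ennreal[OF integrable_transform[OF G z]])
    also have "\<dots> \<le> (\<integral>\<^sup>+t. ennreal (?U \<theta> t * w t) \<partial>lborel)"
    proof (rule nn_integral_mono)
      fix t
      show "ennreal (norm (b t * G (of_real t * ?z))) \<le> ennreal (?U \<theta> t * w t)"
      proof (cases "t \<in> {0..<1}")
        case True
        have pos: "0 < 1 - t * r" using kernel_bounds(3)[OF True] r by simp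
        have "norm (b t) * norm (G (of_real t * ?z)) \<le> a t * norm (G (of_real t * ?z))"
          by (intro mult_right_mono b_le) auto
        also have "\<dots> = ?U \<theta> t * w t"
        proof -
          have "(1 - t * r) powr \<beta> * (1 - t * r) powr (- \<beta>) = 1" using pos by (simp add: powr_add[symmetric])
          then have "?U \<theta> t * w t = norm (Gm (of_real t * ?z)) * 1 * a t"
            unfolding w_def by algebra
          also have "\<dots> = a t * norm (G (of_real t * ?z))" using Gm[OF True, of \<theta>] by (simp only: mult_1_right mult.commute[of "a t"])
          finally show ?thesis by (rule sym)
        qed
        finally show ?thesis by (simp only: norm_mult ennreal_leI)
      qed (simp add: b_supp)
    qed
    finally have X: "ennreal (norm (transform G ?z)) \<le> (\<integral>\<^sup>+t. ennreal (?U \<theta> t * w t) \<partial>lborel)" .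
    show ?thesis
    proof (cases "W = 0")
      \<comment> \<open>Jensen's inequality was stated for positive total weight; here the weight
        vanishes almost everywhere.\<close>
      case True
      then have "AE t in lborel. ennreal (w t) = 0" using wW by (subst nn_integral_0_iff_AE[symmetric]) auto
      then have "AE t in lborel. ennreal (?U \<theta> t * w t) = 0"
      proof eventually_elim
        case (elim t)
        then have "w t = 0" using w0[of t] by (simp add: ennreal_eq_0_iff)
        then show ?case by simp
      qed
      then have "(\<integral>\<^sup>+t. ennreal (?U \<theta> t * w t) \<partial>lborel) = 0" by (subst nn_integral_0_iff_AE) auto
      then show ?thesis using X p by (simp add: ennreal_eq_0_iff)
    next
      case False
      then show ?thesis using X W0 w0 p wW by (intro jensen_powr_nn_integral) auto
    qed
  qed
  have "circ_int p r (transform G) \<le> (\<integral>\<^sup>+\<theta>. ennreal (W powr (p - 1)) * (\<integral>\<^sup>+t. ennreal (?U \<theta> t powr p * w t) * indicator {0..2*pi} \<theta> \<partial>lborel) \<partial>lborel)"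
    unfolding circ_int_def using pointwise by (intro nn_integral_mono) (auto simp: indicator_def)
  also have "\<dots> = ennreal (W powr (p - 1)) * (\<integral>\<^sup>+\<theta>. (\<integral>\<^sup>+t. ennreal (?U \<theta> t powr p * w t) * indicator {0..2*pi} \<theta> \<partial>lborel) \<partial>lborel)"
    by (rule nn_integral_cmult) measurable
  also have "(\<integral>\<^sup>+\<theta>. (\<integral>\<^sup>+t. ennreal (?U \<theta> t powr p * w t) * indicator {0..2*pi} \<theta> \<partial>lborel) \<partial>lborel) =
    (\<integral>\<^sup>+t. (\<integral>\<^sup>+\<theta>. ennreal (?U \<theta> t powr p * w t) * indicator {0..2*pi} \<theta> \<partial>lborel) \<partial>lborel)"
    by (rule lborel_pair.Fubini'[symmetric]) measurable
  finally have 1: "circ_int p r (transform G) \<le> ennreal (W powr (p - 1)) * (\<integral>\<^sup>+t. (\<integral>\<^sup>+\<theta>. ennreal (?U \<theta> t powr p * w t) * indicator {0..2*pi} \<theta> \<partial>lborel) \<partial>lborel)" .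
  have "(\<integral>\<^sup>+t. (\<integral>\<^sup>+\<theta>. ennreal (?U \<theta> t powr p * w t) * indicator {0..2*pi} \<theta> \<partial>lborel) \<partial>lborel) \<le> (\<integral>\<^sup>+t. ennreal C * ennreal (w t) \<partial>lborel)"
  proof (rule nn_integral_mono)
    fix t
    show "(\<integral>\<^sup>+\<theta>. ennreal (?U \<theta> t powr p * w t) * indicator {0..2*pi} \<theta> \<partial>lborel) \<le> ennreal C * ennreal (w t)"
    proof (cases "t \<in> {0..<1}")
      case True
      define y where "y = 1 - t * r"
      have y: "0 < y" using kernel_bounds(3)[OF True] r by (simp add: y_def)
      define c where "c = w t * y powr (\<beta> * p)"
      have c: "0 \<le> c" using w0[of t] by (simp add: c_def)
      have "(\<integral>\<^sup>+\<theta>. ennreal (?U \<theta> t powr p * w t) * indicator {0..2*pi} \<theta> \<partial>lborel) =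
          (\<integral>\<^sup>+\<theta>. ennreal c * (ennreal (norm (Gm (of_real t * (of_real r * cis \<theta>))) powr p) * indicator {0..2*pi} \<theta>) \<partial>lborel)"
      proof (rule nn_integral_cong)
        fix \<theta>
        have "?U \<theta> t powr p * w t = c * norm (Gm (of_real t * (of_real r * cis \<theta>))) powr p"
          by (simp add: powr_mult powr_powr c_def y_def[symmetric])
        then show "ennreal (?U \<theta> t powr p * w t) * indicator {0..2*pi} \<theta> =
            ennreal c * (ennreal (norm (Gm (of_real t * (of_real r * cis \<theta>))) powr p) * indicator {0..2*pi} \<theta>)"
          using c by (simp only: ennreal_mult' mult.assoc)
      qed
      also have "\<dots> = ennreal c * (\<integral>\<^sup>+\<theta>\<in>{0..2*pi}. ennreal (norm (Gm (of_real t * (of_real r * cis \<theta>))) powr p) \<partial>lborel)"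
        by (rule nn_integral_cmult) measurable
      also have "(\<integral>\<^sup>+\<theta>\<in>{0..2*pi}. ennreal (norm (Gm (of_real t * (of_real r * cis \<theta>))) powr p) \<partial>lborel) = circ_int p (t * r) G"
        unfolding circ_int_def by (rule nn_integral_cong) (simp add: Gm[OF True] mult.assoc)
      also have "ennreal c * circ_int p (t * r) G \<le> ennreal c * ennreal (C * y powr (1 - real n * p))"
        unfolding y_def using True r y by (intro mult_left_mono gr) (auto simp: y_def)
      also have "\<dots> = ennreal C * ennreal (w t)"
      proof -
        have "\<beta> * p + (1 - real n * p) = 0" using p by (simp add: \<beta>_def field_simps)
        then have "y powr (\<beta> * p) * y powr (1 - real n * p) = 1" using y by (simp add: powr_add[symmetric])
        then have "C * w t * (y powr (\<beta> * p) * y powr (1 - real n * p)) = C * w t" by simp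
        then have "c * (C * y powr (1 - real n * p)) = C * w t" by (simp add: c_def mult_ac)
        then show ?thesis using c C by (simp only: ennreal_mult'[symmetric])
      qed
      finally show ?thesis .
    qed (simp add: w_def mass_supp)
  qed
  also have "\<dots> = ennreal C * ennreal W" by (subst nn_integral_cmult) (auto simp: wW)
  finally have "ennreal (W powr (p - 1)) * (\<integral>\<^sup>+t. (\<integral>\<^sup>+\<theta>. ennreal (?U \<theta> t powr p * w t) * indicator {0..2*pi} \<theta> \<partial>lborel) \<partial>lborel)
     \<le> ennreal (W powr (p - 1)) * (ennreal C * ennreal W)"
    by (rule mult_left_mono) simp
  also have "\<dots> = ennreal (C * W powr p)"
  proof -
    have "W powr (p - 1) * W = W powr p"
      using W0 powr_add[of W "p - 1" 1] p by (cases "W = 0") auto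
    then have "W powr (p - 1) * (C * W) = C * W powr p" by (simp add: mult_ac)
    then show ?thesis using C W0 by (simp add: ennreal_mult'[symmetric])
  qed
  finally show ?thesis using 1 by (simp add: W_def \<beta>_def)
qed

end

section \<open>Lower bounds for Stieltjes transforms\<close>

text \<open>The real part alone is too small when 1 - \<rho> is much less than \<theta>, and the
  imaginary part alone when \<theta> is much less than 1 - \<rho>. Their sum has numerator at least
  (1 - \<rho>) + \<rho> \<theta> / 2 over the squared modulus N \<le> (1 - \<rho>)^2 + \<rho>
  \<theta>^2. A linear functional of the kernel is wanted because it can be integrated against the
  mass.\<close>

lemma inverse_one_minus_ge:
  fixes \<rho> \<theta> :: real
  assumes \<rho>: "0 \<le> \<rho>" "\<rho> < 1" and \<theta>: "0 \<le> \<theta>" "\<theta> \<le> 1"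
  shows "1 / (2 * ((1 - \<rho>) + \<theta>)) \<le> Re (1 / (1 - of_real \<rho> * cis \<theta>)) + Im (1 / (1 - of_real \<rho> * cis \<theta>))"
proof -
  define x y where "x = \<rho> * cos \<theta>" and "y = \<rho> * sin \<theta>"
  define N where "N = (1 - x)\<^sup>2 + y\<^sup>2"
  have sum: "Re (1 / (1 - of_real \<rho> * cis \<theta>)) + Im (1 / (1 - of_real \<rho> * cis \<theta>)) = (1 - x + y) / N"
    by (simp add: Re_divide Im_divide x_def y_def N_def add_divide_distrib diff_divide_distrib)
  have N_eq: "N = (1 - \<rho>)\<^sup>2 + 2 * \<rho> * (1 - cos \<theta>)"
  proof -
    have "x\<^sup>2 + y\<^sup>2 = \<rho>\<^sup>2"
      by (simp add: x_def y_def power_mult_distrib distrib_left[symmetric])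
    then show ?thesis by (simp add: N_def power2_diff x_def algebra_simps)
  qed
  have "1 - cos \<theta> \<le> \<theta>\<^sup>2 / 2"
  proof -
    have "(sin (\<theta> / 2))\<^sup>2 \<le> (\<theta> / 2)\<^sup>2"
      by (rule power2_le_iff_abs_le[THEN iffD2]) (use \<theta> abs_sin_x_le_abs_x[of "\<theta> / 2"] in auto)
    then show ?thesis using cos_double_sin[of "\<theta> / 2"] by (simp add: power2_eq_square)
  qed
  then have "\<rho> * (2 * (1 - cos \<theta>)) \<le> \<rho> * \<theta>\<^sup>2" using \<rho> by (intro mult_left_mono) auto
  then have N_le: "N \<le> (1 - \<rho>)\<^sup>2 + \<rho> * \<theta>\<^sup>2" unfolding N_eq by (simp only: mult_ac add_left_mono)
  have N_pos: "0 < N"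
  proof -
    have "0 < (1 - \<rho>)\<^sup>2" using \<rho> by simp
    moreover have "0 \<le> 2 * \<rho> * (1 - cos \<theta>)" using \<rho> by simp
    ultimately show ?thesis unfolding N_eq by (rule add_pos_nonneg)
  qed
  have "\<theta> / 2 \<le> sin \<theta>" using \<theta> pi_gt3 by (intro sin_ge_half) auto
  then have "\<rho> * (\<theta> / 2) \<le> y" unfolding y_def using \<rho> by (intro mult_left_mono) auto
  moreover have "x \<le> \<rho>" unfolding x_def using \<rho> by (intro mult_left_le) auto
  ultimately have num: "(1 - \<rho>) + \<rho> * \<theta> / 2 \<le> 1 - x + y" by simp
  have "N \<le> 2 * (((1 - \<rho>) + \<rho> * \<theta> / 2) * ((1 - \<rho>) + \<theta>))"
  proof -
    have "2 * (((1 - \<rho>) + \<rho> * \<theta> / 2) * ((1 - \<rho>) + \<theta>)) =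
        (1 - \<rho>)\<^sup>2 + \<rho> * \<theta>\<^sup>2 + ((1 - \<rho>)\<^sup>2 + 2 * (1 - \<rho>) * \<theta> + \<rho> * \<theta> * (1 - \<rho>))"
      by (simp add: power2_eq_square algebra_simps add_divide_distrib diff_divide_distrib)
    moreover have "0 \<le> (1 - \<rho>)\<^sup>2 + 2 * (1 - \<rho>) * \<theta> + \<rho> * \<theta> * (1 - \<rho>)" using \<rho> \<theta> by simp
    ultimately show ?thesis using N_le by linarith
  qed
  also have "\<dots> \<le> 2 * ((1 - x + y) * ((1 - \<rho>) + \<theta>))"
    using num \<rho> \<theta> by (intro mult_left_mono mult_right_mono) auto
  finally have "1 * N \<le> (1 - x + y) * (2 * ((1 - \<rho>) + \<theta>))"
    by (simp only: mult_1_left mult.left_commute[of "1 - x + y"])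
  moreover have "0 < N \<Longrightarrow> 0 < D \<Longrightarrow> 1 * N \<le> X * D \<Longrightarrow> 1 / D \<le> X / N" for D X :: real
    by (simp add: field_simps)
  ultimately show ?thesis unfolding sum using N_pos \<rho> \<theta> by simp
qed

text \<open>A perturbation estimate: |B| \<ge> 7 A / 8 and |B + A| \<le> 17 A / 8 give |1 / B^2 - 1
  / A^2| \<le> (17 / 49) / A^2, and 17 / 49 < 1 / 2.\<close>

lemma Re_inverse_square_ge:
  fixes A :: real and B :: complex
  assumes A: "0 < A" and AB: "norm (B - of_real A) \<le> A / 8"
  shows "1 / (2 * A\<^sup>2) \<le> Re (1 / B\<^sup>2)"
proof -
  have B: "7 * A / 8 \<le> norm B"
    using norm_triangle_ineq2[of "of_real A :: complex" "of_real A - B"] AB A by (simp add: norm_minus_commute)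
  then have B0: "B \<noteq> 0" using A by auto
  have sumB: "norm (B + of_real A) \<le> 17 * A / 8"
    using norm_triangle_ineq[of "B - of_real A" "2 * of_real A"] AB A
    by (simp add: norm_mult add.commute[of B])
  have "norm (1 / B\<^sup>2 - 1 / of_real (A\<^sup>2)) = norm (B - of_real A) * norm (B + of_real A) / ((norm B)\<^sup>2 * A\<^sup>2)"
  proof -
    have "1 / B\<^sup>2 - 1 / of_real (A\<^sup>2) = - ((B - of_real A) * (B + of_real A)) / (B\<^sup>2 * of_real (A\<^sup>2))"
      using B0 A by (simp add: field_simps power2_eq_square)
    then show ?thesis by (simp add: norm_divide norm_mult norm_power)
  qed
  also have "\<dots> \<le> (A / 8) * (17 * A / 8) / ((7 * A / 8)\<^sup>2 * A\<^sup>2)"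
    using A B AB sumB by (intro frac_le mult_mono mult_pos_pos mult_nonneg_nonneg power_mono) auto
  also have "\<dots> = 17 / 49 * (1 / A\<^sup>2)" using A by (simp add: field_simps power2_eq_square)
  also have "\<dots> \<le> 1 / 2 * (1 / A\<^sup>2)" using A by (intro mult_right_mono) auto
  finally have "norm (1 / B\<^sup>2 - 1 / of_real (A\<^sup>2)) \<le> 1 / (2 * A\<^sup>2)" by simp
  then have "\<bar>Re (1 / B\<^sup>2 - 1 / of_real (A\<^sup>2))\<bar> \<le> 1 / (2 * A\<^sup>2)"
    using abs_Re_le_cmod order_trans by blast
  moreover have "Re (1 / B\<^sup>2 - 1 / of_real (A\<^sup>2)) = Re (1 / B\<^sup>2) - 1 / A\<^sup>2"
    by (simp add: Re_divide_of_real del: of_real_power)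
  moreover have "1 / A\<^sup>2 = 1 / (2 * A\<^sup>2) + 1 / (2 * A\<^sup>2)" using A by (simp add: field_simps)
  ultimately show ?thesis by linarith
qed

lemma holomorphic_inverse_one_minus: "(\<lambda>w. 1 / (1 - w)) holomorphic_on unit_disc"
  by (intro holomorphic_intros) auto

lemma deriv_inverse_one_minus: "norm w < 1 \<Longrightarrow> deriv (\<lambda>w. 1 / (1 - w)) w = 1 / (1 - w)\<^sup>2"
  by (intro DERIV_imp_deriv) (auto intro!: derivative_eq_intros simp: power2_eq_square)

context radial_mass
begin

lemma radial_density_self: "radial_density a (\<lambda>t. complex_of_real (a t))"
  by unfold_locales (auto simp: mass_nonneg)

definition stieltjes :: "complex \<Rightarrow> complex"
  where "stieltjes = radial_density.transform (\<lambda>t. complex_of_real (a t)) (\<lambda>w. 1 / (1 - w))"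

interpretation A: radial_density a "\<lambda>t. complex_of_real (a t)" by (rule radial_density_self)
interpretation At: radial_density a "\<lambda>t. complex_of_real (a t) * of_real t" by (rule A.radial_density_times_t)

lemma holomorphic_stieltjes: "stieltjes holomorphic_on unit_disc"
  unfolding stieltjes_def by (rule A.transform_holomorphic[OF holomorphic_inverse_one_minus])

lemma stieltjes_0: "stieltjes 0 = of_real (integral\<^sup>L lborel a)"
  by (simp add: stieltjes_def A.transform_def integral_complex_of_real)

text \<open>Both 1 - t r and \<theta> are at most 1 - t m. The free parameter serves two purposes: m
  = r on the arc \<theta> \<le> 1 - r for area integrals, and m = 1 - \<theta> on larger angles for
  the Hardy norm. The constant 8 is 4 from the kernel times 2 from Re + Im \<le> 2 |.|.\<close>

lemma norm_stieltjes_ge: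
  assumes r: "0 \<le> r" "r < 1" and \<theta>: "0 \<le> \<theta>" "\<theta> \<le> 1" and m: "0 \<le> m" "m \<le> r" "m \<le> 1 - \<theta>"
  shows "Phi a 1 m / 8 \<le> norm (stieltjes (of_real r * cis \<theta>))"
proof -
  define z where "z = of_real r * cis \<theta>"
  have z: "norm z < 1" using r by (simp add: z_def norm_mult)
  let ?k = "\<lambda>t. of_real (a t) * (1 / (1 - of_real t * z))"
  have int: "integrable lborel ?k"
    by (rule A.integrable_transform[OF holomorphic_on_imp_continuous_on[OF holomorphic_inverse_one_minus] z])
  have "Phi a 1 m / 4 = (LINT t|lborel. 1 / 4 * (a t * (1 - t * m) powr (- 1)))"
    unfolding Phi_def by (subst integral_mult_right_zero) simp
  also have "\<dots> \<le> (LINT t|lborel. Re (?k t) + Im (?k t))"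
  proof (rule integral_mono)
    show "integrable lborel (\<lambda>t. 1 / 4 * (a t * (1 - t * m) powr (- 1)))"
      using m r by (intro integrable_mult_right Phi_integrable) auto
    show "integrable lborel (\<lambda>t. Re (?k t) + Im (?k t))" using int by (intro Bochner_Integration.integrable_add) auto
    fix t
    show "1 / 4 * (a t * (1 - t * m) powr (- 1)) \<le> Re (?k t) + Im (?k t)"
    proof (cases "t \<in> {0..<1}")
      case True
      have \<rho>: "0 \<le> t * r" "t * r < 1" using kernel_bounds(3)[OF True] r True by auto
      have pos: "0 < 1 - t * m" using kernel_bounds(3)[OF True] m r by auto
      have "t * m \<le> t * r" "t * m \<le> m" using True m by (auto intro!: mult_left_mono mult_left_le_one_le)
      then have le: "2 * ((1 - t * r) + \<theta>) \<le> 4 * (1 - t * m)" using m by simp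
      have "1 / 4 * (1 - t * m) powr (- 1) = 1 / (4 * (1 - t * m))"
        using pos by (simp add: powr_minus_divide)
      also have "\<dots> \<le> 1 / (2 * ((1 - t * r) + \<theta>))" using le \<rho> \<theta> by (intro divide_left_mono mult_pos_pos) auto
      also have "\<dots> \<le> Re (1 / (1 - of_real (t * r) * cis \<theta>)) + Im (1 / (1 - of_real (t * r) * cis \<theta>))"
        by (rule inverse_one_minus_ge[OF \<rho> \<theta>])
      also have "of_real (t * r) * cis \<theta> = of_real t * z" by (simp add: z_def)
      finally have "a t * (1 / 4 * (1 - t * m) powr (- 1)) \<le> a t * (Re (1 / (1 - of_real t * z)) + Im (1 / (1 - of_real t * z)))"
        by (intro mult_left_mono mass_nonneg)
      moreover have "Re (?k t) + Im (?k t) = a t * (Re (1 / (1 - of_real t * z)) + Im (1 / (1 - of_real t * z)))"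
        by (simp only: Re_complex_of_real Im_complex_of_real times_complex.sel mult_zero_left add_0_right diff_0_right distrib_left)
      ultimately show ?thesis by (simp add: mult.left_commute)
    qed (simp add: mass_supp)
  qed
  also have "\<dots> = Re (stieltjes z) + Im (stieltjes z)"
    unfolding stieltjes_def A.transform_def using int by (subst Bochner_Integration.integral_add) auto
  also have "\<dots> \<le> 2 * norm (stieltjes z)"
    using abs_Re_le_cmod[of "stieltjes z"] abs_Im_le_cmod[of "stieltjes z"] by linarith
  finally show ?thesis by (simp add: z_def)
qed

lemma circ_int_stieltjes_ge_arc:
  assumes p: "0 < p" and r: "0 \<le> r" "r < 1"
  shows "ennreal ((1 - r) * (Phi a 1 r / 8) powr p) \<le> circ_int p r stieltjes"
proof -
  have "ennreal ((1 - r) * (Phi a 1 r / 8) powr p) = (\<integral>\<^sup>+\<theta>\<in>{0..1-r}. ennreal ((Phi a 1 r / 8) powr p) \<partial>lborel)"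
    using r by (subst nn_integral_cmult_indicator) (auto simp: ennreal_mult'[symmetric] mult.commute)
  also have "\<dots> \<le> circ_int p r stieltjes" unfolding circ_int_def
  proof (rule nn_integral_mono)
    fix \<theta>
    show "ennreal ((Phi a 1 r / 8) powr p) * indicator {0..1-r} \<theta> \<le> ennreal (norm (stieltjes (of_real r * cis \<theta>)) powr p) * indicator {0..2*pi} \<theta>"
    proof (cases "\<theta> \<in> {0..1-r}")
      case True
      then have "\<theta> \<in> {0..2*pi}" using r pi_gt3 by auto
      moreover have "(Phi a 1 r / 8) powr p \<le> norm (stieltjes (of_real r * cis \<theta>)) powr p"
        using True r p Phi_nonneg by (intro powr_mono2 norm_stieltjes_ge) auto
      ultimately show ?thesis using True by (simp add: ennreal_leI)
    qed simp
  qed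
  finally show ?thesis .
qed

lemma circ_int_stieltjes_ge_integral:
  assumes p: "0 < p" and r: "0 \<le> r" "r < 1"
  shows "(\<integral>\<^sup>+s\<in>{0..r}. ennreal ((Phi a 1 s / 8) powr p) \<partial>lborel) \<le> circ_int p r stieltjes"
proof -
  have "(\<integral>\<^sup>+s\<in>{0..r}. ennreal ((Phi a 1 s / 8) powr p) \<partial>lborel) =
      (\<integral>\<^sup>+\<theta>\<in>{1-r..1}. ennreal ((Phi a 1 (1 - \<theta>) / 8) powr p) \<partial>lborel)"
    by (subst nn_integral_real_affine[where c="-1" and t=1]) (auto intro!: nn_integral_cong simp: indicator_def)
  also have "\<dots> \<le> circ_int p r stieltjes" unfolding circ_int_def
  proof (rule nn_integral_mono)
    fix \<theta>
    show "ennreal ((Phi a 1 (1 - \<theta>) / 8) powr p) * indicator {1-r..1} \<theta> \<le> ennreal (norm (stieltjes (of_real r * cis \<theta>)) powr p) * indicator {0..2*pi} \<theta>"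
    proof (cases "\<theta> \<in> {1-r..1}")
      case True
      then have "\<theta> \<in> {0..2*pi}" using r pi_gt3 by auto
      moreover have "(Phi a 1 (1 - \<theta>) / 8) powr p \<le> norm (stieltjes (of_real r * cis \<theta>)) powr p"
        using True r p Phi_nonneg by (intro powr_mono2 norm_stieltjes_ge) auto
      ultimately show ?thesis using True by (simp add: ennreal_leI)
    qed simp
  qed
  finally show ?thesis .
qed

text \<open>The derivative carries the density t a(t), which loses the mass near t = 0. For t \<le>
  1 / 2 the kernel of \<open>Phi a 2\<close> is at most 4 and the total mass pays; for t > 1 / 2 the
  factor t costs 2 and the real part of the squared kernel costs another 2. The arc (1 - r) / 8 is
  what \<open>Re_inverse_square_ge\<close> tolerates.\<close>

lemma norm_deriv_stieltjes_ge:
  assumes r: "0 \<le> r" "r < 1" and \<theta>: "0 \<le> \<theta>" "\<theta> \<le> (1 - r) / 8"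
  shows "Phi a 2 r \<le> 4 * integral\<^sup>L lborel a + 4 * norm (deriv stieltjes (of_real r * cis \<theta>))"
proof -
  define z where "z = of_real r * cis \<theta>"
  have z: "norm z < 1" using r by (simp add: z_def norm_mult)
  let ?k = "\<lambda>t. of_real (a t) * of_real t * (deriv (\<lambda>w. 1 / (1 - w)) (of_real t * z))"
  have hd: "deriv (\<lambda>w. 1 / (1 - w)) holomorphic_on unit_disc"
    by (intro holomorphic_deriv holomorphic_inverse_one_minus) auto
  have int: "integrable lborel ?k"
    by (rule At.integrable_transform[OF holomorphic_on_imp_continuous_on[OF hd] z])
  have "Phi a 2 r \<le> (LINT t|lborel. 4 * a t + 4 * Re (?k t))"
    unfolding Phi_def
  proof (rule integral_mono)
    show "integrable lborel (\<lambda>t. a t * (1 - t * r) powr (- 2))"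
      using r by (intro Phi_integrable) auto
    show "integrable lborel (\<lambda>t. 4 * a t + 4 * Re (?k t))"
      using int integrable_mass by (intro Bochner_Integration.integrable_add integrable_mult_right integrable_Re) auto
    fix t
    show "a t * (1 - t * r) powr (- 2) \<le> 4 * a t + 4 * Re (?k t)"
    proof (cases "t \<in> {0..<1}")
      case True
      define A where "A = 1 - t * r"
      have A: "0 < A" "1 - r \<le> A" using kernel_bounds[OF True r] by (auto simp: A_def)
      have w: "norm (of_real t * z) < 1" using True z by (intro disc_scale) auto
      have "norm (1 - of_real t * z - of_real A) = t * r * norm (cis \<theta> - 1)"
      proof -
        have "1 - of_real t * z - of_real A = - (of_real (t * r) * (cis \<theta> - 1))"
          by (simp add: z_def A_def algebra_simps)
        then show ?thesis using True r by (simp add: norm_mult)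
      qed
      also have "\<dots> \<le> 1 * norm (cis \<theta> - 1)" using True r by (intro mult_right_mono mult_le_one) auto
      also have "\<dots> \<le> \<theta>"
        using dist_exp_i_1[of \<theta>] abs_sin_x_le_abs_x[of "\<theta> / 2"] \<theta> by (simp add: cis_conv_exp)
      also have "\<dots> \<le> A / 8" using \<theta> A by simp
      finally have re: "1 / (2 * A\<^sup>2) \<le> Re (1 / (1 - of_real t * z)\<^sup>2)"
        by (rule Re_inverse_square_ge[OF A(1)])
      have pw: "(1 - t * r) powr (- 2) = 1 / A\<^sup>2"
        using A by (simp add: powr_minus_divide A_def[symmetric] flip: powr_numeral)
      have "1 / A\<^sup>2 \<le> 4 + 4 * (t * Re (1 / (1 - of_real t * z)\<^sup>2))"
      proof (cases "t \<le> 1 / 2")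
        case True
        have "t * r \<le> 1 / 2 * 1" using True \<open>t \<in> {0..<1}\<close> r by (intro mult_mono) auto
        then have "1 / 2 \<le> A" by (simp add: A_def)
        then have "(1 / 2)\<^sup>2 \<le> A\<^sup>2" by (intro power_mono) auto
        then have "1 / A\<^sup>2 \<le> 1 / (1 / 2)\<^sup>2" by (intro divide_left_mono mult_pos_pos) (use A in auto)
        moreover have "0 \<le> Re (1 / (1 - of_real t * z)\<^sup>2)" using re A by (smt (verit) divide_nonneg_nonneg zero_le_power2)
        ultimately show ?thesis using \<open>t \<in> {0..<1}\<close> by (simp add: power2_eq_square add_increasing2)
      next
        case False
        have "1 / A\<^sup>2 = 4 * (1 / 2 * (1 / (2 * A\<^sup>2)))" by simp
        also have "\<dots> \<le> 4 * (t * Re (1 / (1 - of_real t * z)\<^sup>2))"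
          using False re by (intro mult_left_mono mult_mono) auto
        finally show ?thesis by simp
      qed
      then have "a t * (1 / A\<^sup>2) \<le> a t * (4 + 4 * (t * Re (1 / (1 - of_real t * z)\<^sup>2)))"
        by (intro mult_left_mono mass_nonneg)
      also have "\<dots> = 4 * a t + 4 * Re (?k t)"
      proof -
        have "Re (of_real (a t) * of_real t * X) = a t * (t * Re X)" for X :: complex by simp
        then show ?thesis unfolding deriv_inverse_one_minus[OF w] by (simp only:) (simp only: distrib_left mult_ac)
      qed
      finally show ?thesis by (simp only: pw)
    qed (simp add: mass_supp)
  qed
  also have "\<dots> = 4 * integral\<^sup>L lborel a + 4 * Re (At.transform (deriv (\<lambda>w. 1 / (1 - w))) z)"
  proof -
    have "(LINT t|lborel. 4 * a t + 4 * Re (?k t)) = (LINT t|lborel. 4 * a t) + (LINT t|lborel. 4 * Re (?k t))"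
      using int integrable_mass by (intro Bochner_Integration.integral_add integrable_mult_right integrable_Re) auto
    then show ?thesis by (simp only: integral_mult_right_zero integral_Re[OF int] At.transform_def)
  qed
  also have "At.transform (deriv (\<lambda>w. 1 / (1 - w))) z = deriv stieltjes z"
    unfolding stieltjes_def
    by (rule DERIV_imp_deriv[symmetric]) (rule A.transform_has_field_derivative[OF holomorphic_inverse_one_minus z])
  also have "4 * integral\<^sup>L lborel a + 4 * Re (deriv stieltjes z) \<le> 4 * integral\<^sup>L lborel a + 4 * norm (deriv stieltjes z)"
    using complex_Re_le_cmod[of "deriv stieltjes z"] by simp
  finally show ?thesis by (simp add: z_def)
qed

text \<open>The lower bound is integrated over an arc of length (1 - r) / 8, whence the extra factor
  8; 8^p is 4^p from that bound times 2^p from separating the mass.\<close>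

lemma circ_int_deriv_stieltjes_ge:
  assumes p: "0 < p" and r: "0 \<le> r" "r < 1"
  shows "ennreal ((1 - r) * Phi a 2 r powr p) \<le>
    ennreal (8 powr p) * ennreal ((integral\<^sup>L lborel a) powr p) + ennreal (8 * 8 powr p) * circ_int p r (deriv stieltjes)"
proof -
  define A where "A = integral\<^sup>L lborel a"
  have A: "0 \<le> A" unfolding A_def by (intro integral_nonneg_AE AE_I2 mass_nonneg)
  \<comment> \<open>The pointwise lower bound is empty when the mass term dominates; then 0 is
    used.\<close>
  define Y where "Y = max 0 (Phi a 2 r / 4 - A)"
  have "ennreal ((1 - r) / 8 * Y powr p) = (\<integral>\<^sup>+\<theta>\<in>{0..(1-r)/8}. ennreal (Y powr p) \<partial>lborel)"
    using r by (subst nn_integral_cmult_indicator) (auto simp: ennreal_mult'[symmetric] mult.commute)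
  also have "\<dots> \<le> circ_int p r (deriv stieltjes)" unfolding circ_int_def
  proof (rule nn_integral_mono)
    fix \<theta>
    show "ennreal (Y powr p) * indicator {0..(1-r)/8} \<theta> \<le> ennreal (norm (deriv stieltjes (of_real r * cis \<theta>)) powr p) * indicator {0..2*pi} \<theta>"
    proof (cases "\<theta> \<in> {0..(1-r)/8}")
      case True
      then have "\<theta> \<in> {0..2*pi}" using r pi_gt3 by auto
      moreover have "Y powr p \<le> norm (deriv stieltjes (of_real r * cis \<theta>)) powr p"
        using norm_deriv_stieltjes_ge[OF r, of \<theta>] True p by (intro powr_mono2) (auto simp: Y_def A_def)
      ultimately show ?thesis using True by (simp add: ennreal_leI)
    qed simp
  qed
  finally have Y: "ennreal ((1 - r) / 8 * Y powr p) \<le> circ_int p r (deriv stieltjes)" .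
  have "Phi a 2 r / 4 - A \<le> Y" by (simp add: Y_def)
  then have "Phi a 2 r \<le> 4 * (A + Y)" by simp
  then have "Phi a 2 r powr p \<le> (4 * (A + Y)) powr p" using p Phi_nonneg by (intro powr_mono2) auto
  also have "\<dots> = 4 powr p * (A + Y) powr p" by (rule powr_mult)
  also have "\<dots> \<le> 4 powr p * (2 powr p * (A powr p + Y powr p))"
    using A p by (intro mult_left_mono powr_add_le) (auto simp: Y_def)
  also have "\<dots> = 8 powr p * (A powr p + Y powr p)" by (simp add: mult.assoc[symmetric] powr_mult[symmetric])
  finally have "(1 - r) * Phi a 2 r powr p \<le> (1 - r) * (8 powr p * (A powr p + Y powr p))"
    using r by (intro mult_left_mono) auto
  also have "\<dots> = (1 - r) * (8 powr p * A powr p) + 8 * 8 powr p * ((1 - r) / 8 * Y powr p)"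
    by (simp add: algebra_simps diff_divide_distrib)
  also have "\<dots> \<le> 8 powr p * A powr p + 8 * 8 powr p * ((1 - r) / 8 * Y powr p)"
    using r by (intro add_right_mono mult_left_le_one_le) auto
  finally have "ennreal ((1 - r) * Phi a 2 r powr p) \<le> ennreal (8 powr p * A powr p + 8 * 8 powr p * ((1 - r) / 8 * Y powr p))"
    by (rule ennreal_leI)
  also have "\<dots> = ennreal (8 powr p) * ennreal (A powr p) + ennreal (8 * 8 powr p) * ennreal ((1 - r) / 8 * Y powr p)"
  proof -
    have "0 \<le> 8 powr p * A powr p" "0 \<le> 8 * 8 powr p" "0 \<le> (1 - r) / 8 * Y powr p" using r by auto
    then show ?thesis by (simp only: ennreal_plus ennreal_mult' mult_nonneg_nonneg powr_ge_zero)
  qed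
  also have "\<dots> \<le> ennreal (8 powr p) * ennreal (A powr p) + ennreal (8 * 8 powr p) * circ_int p r (deriv stieltjes)"
    by (intro add_left_mono mult_left_mono Y) simp
  finally show ?thesis by (simp add: A_def)
qed

end

section \<open>Integrals over the disc\<close>

definition disc_int :: "real \<Rightarrow> real \<Rightarrow> (complex \<Rightarrow> complex) \<Rightarrow> ennreal"
  where "disc_int p \<alpha> k = (\<integral>\<^sup>+z\<in>unit_disc. ennreal (norm (k z) powr p * (1 - (norm z)\<^sup>2) powr \<alpha>) \<partial>lborel)"

lemma bergman_norm_eq: "bergman_norm p \<alpha> k = ennpowr (ennreal ((\<alpha> + 1) / pi) * disc_int p \<alpha> k) (1 / p)"
  by (simp add: bergman_norm_def disc_int_def)

lemma disc_int_cong: "(\<And>z. norm z < 1 \<Longrightarrow> k z = l z) \<Longrightarrow> disc_int p \<alpha> k = disc_int p \<alpha> l"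
  unfolding disc_int_def by (intro nn_integral_cong) (auto simp: indicator_def)

text \<open>Functions on the disc are arbitrary outside it; extension by zero makes them Borel on
  the whole plane.\<close>

definition cutoff :: "(complex \<Rightarrow> complex) \<Rightarrow> complex \<Rightarrow> complex"
  where "cutoff k z = indicator unit_disc z *\<^sub>R k z"

lemma circ_int_cong: "0 \<le> r \<Longrightarrow> (\<And>z. norm z = r \<Longrightarrow> k z = l z) \<Longrightarrow> circ_int p r k = circ_int p r l"
  unfolding circ_int_def by (simp add: norm_mult)

lemma circ_int_cutoff: "0 \<le> r \<Longrightarrow> r < 1 \<Longrightarrow> circ_int p r (cutoff k) = circ_int p r k"
  by (intro circ_int_cong) (auto simp: cutoff_def)

lemma circ_int_cutoff_measurable:
  assumes "continuous_on unit_disc k"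
  shows "(\<lambda>r. circ_int p r (cutoff k)) \<in> borel_measurable borel"
proof -
  have [measurable]: "cutoff k \<in> borel_measurable borel"
    unfolding cutoff_def by (rule borel_measurable_disc_cutoff[OF assms])
  have [measurable]: "cis \<in> borel_measurable borel"
    by (intro borel_measurable_continuous_onI continuous_intros)
  show ?thesis unfolding circ_int_def by measurable
qed

lemma disc_int_polar:
  assumes k: "continuous_on unit_disc k"
  shows "disc_int p \<alpha> k =
    (\<integral>\<^sup>+r\<in>{0..<1}. ennreal ((1 - r\<^sup>2) powr \<alpha> * r) * circ_int p r (cutoff k) \<partial>lborel)"
proof -
  have m [measurable]: "cutoff k \<in> borel_measurable borel"
    unfolding cutoff_def by (rule borel_measurable_disc_cutoff[OF k])
  have [measurable]: "cis \<in> borel_measurable borel"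
    by (intro borel_measurable_continuous_onI continuous_intros)
  have "disc_int p \<alpha> k = disc_int p \<alpha> (cutoff k)"
    by (rule disc_int_cong) (simp add: cutoff_def)
  also have "\<dots> = (\<integral>\<^sup>+r\<in>{0..<1}. (\<integral>\<^sup>+t\<in>{0..2 * pi}. ennreal (norm (cutoff k (of_real r * cis t)) powr p * (1 - (norm (of_real r * cis t))\<^sup>2) powr \<alpha>) \<partial>lborel) * ennreal r \<partial>lborel)"
    unfolding disc_int_def by (rule nn_integral_disc_polar) measurable
  also have "\<dots> = (\<integral>\<^sup>+r\<in>{0..<1}. ennreal ((1 - r\<^sup>2) powr \<alpha> * r) * circ_int p r (cutoff k) \<partial>lborel)"
  proof (rule nn_integral_cong)
    fix r :: real
    have "(\<integral>\<^sup>+t\<in>{0..2 * pi}. ennreal (norm (cutoff k (of_real r * cis t)) powr p * (1 - (norm (of_real r * cis t))\<^sup>2) powr \<alpha>) \<partial>lborel)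
        = (\<integral>\<^sup>+t. ennreal ((1 - r\<^sup>2) powr \<alpha>) * (ennreal (norm (cutoff k (of_real r * cis t)) powr p) * indicator {0..2*pi} t) \<partial>lborel)"
      by (rule nn_integral_cong) (simp add: norm_mult ennreal_mult mult_ac)
    also have "\<dots> = ennreal ((1 - r\<^sup>2) powr \<alpha>) * circ_int p r (cutoff k)"
      unfolding circ_int_def by (rule nn_integral_cmult) measurable
    moreover have "ennreal ((1 - r\<^sup>2) powr \<alpha> * r) = ennreal ((1 - r\<^sup>2) powr \<alpha>) * ennreal r"
      by (rule ennreal_mult') simp
    ultimately show "(\<integral>\<^sup>+t\<in>{0..2 * pi}. ennreal (norm (cutoff k (of_real r * cis t)) powr p * (1 - (norm (of_real r * cis t))\<^sup>2) powr \<alpha>) \<partial>lborel) * ennreal r * indicator {0..<1} r =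
      ennreal ((1 - r\<^sup>2) powr \<alpha> * r) * circ_int p r (cutoff k) * indicator {0..<1} r"
      by (simp only: mult_ac)
  qed
  finally show ?thesis .
qed

text \<open>1 - r^2 = (1 - r) (1 + r) with 1 \<le> 1 + r \<le> 2; the absolute value of \<alpha>
  covers both signs.\<close>

lemma one_minus_square_powr_bounds:
  fixes r \<alpha> :: real
  assumes "0 \<le> r" "r < 1"
  shows "(1 - r\<^sup>2) powr \<alpha> \<le> 2 powr \<bar>\<alpha>\<bar> * (1 - r) powr \<alpha>"
    and "(1 - r) powr \<alpha> \<le> 2 powr \<bar>\<alpha>\<bar> * (1 - r\<^sup>2) powr \<alpha>"
proof -
  have eq: "(1 - r\<^sup>2) powr \<alpha> = (1 + r) powr \<alpha> * (1 - r) powr \<alpha>"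
    using assms by (simp add: powr_mult[symmetric] power2_eq_square algebra_simps)
  have b: "(1 + r) powr \<bar>\<alpha>\<bar> \<le> 2 powr \<bar>\<alpha>\<bar>" using assms by (intro powr_mono2) auto
  have "(1 + r) powr \<alpha> \<le> (1 + r) powr \<bar>\<alpha>\<bar>" using assms by (intro powr_mono) auto
  then show "(1 - r\<^sup>2) powr \<alpha> \<le> 2 powr \<bar>\<alpha>\<bar> * (1 - r) powr \<alpha>"
    unfolding eq using b by (intro mult_right_mono) auto
  have "1 = (1 + r) powr \<bar>\<alpha>\<bar> * (1 + r) powr (- \<bar>\<alpha>\<bar>)" using assms by (simp add: powr_add[symmetric])
  also have "\<dots> \<le> 2 powr \<bar>\<alpha>\<bar> * (1 + r) powr \<alpha>" using assms b by (intro mult_mono powr_mono) auto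
  finally have "1 * (1 - r) powr \<alpha> \<le> (2 powr \<bar>\<alpha>\<bar> * (1 + r) powr \<alpha>) * (1 - r) powr \<alpha>" by (intro mult_right_mono) auto
  then show "(1 - r) powr \<alpha> \<le> 2 powr \<bar>\<alpha>\<bar> * (1 - r\<^sup>2) powr \<alpha>" unfolding eq by (simp add: mult_ac)
qed

lemma disc_int_le:
  assumes k: "continuous_on unit_disc k" and v: "\<And>r. 0 \<le> r \<Longrightarrow> r < 1 \<Longrightarrow> circ_int p r k \<le> ennreal (v r)"
    and v0: "\<And>r. 0 \<le> v r" and [measurable]: "v \<in> borel_measurable borel"
  shows "disc_int p \<alpha> k \<le> ennreal (2 powr \<bar>\<alpha>\<bar>) * (\<integral>\<^sup>+r\<in>{0..<1}. ennreal ((1 - r) powr \<alpha> * v r) \<partial>lborel)"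
proof -
  have "disc_int p \<alpha> k \<le> (\<integral>\<^sup>+r. ennreal (2 powr \<bar>\<alpha>\<bar>) * (ennreal ((1 - r) powr \<alpha> * v r) * indicator {0..<1} r) \<partial>lborel)"
    unfolding disc_int_polar[OF k]
  proof (rule nn_integral_mono)
    fix r :: real
    show "ennreal ((1 - r\<^sup>2) powr \<alpha> * r) * circ_int p r (cutoff k) * indicator {0..<1} r \<le>
      ennreal (2 powr \<bar>\<alpha>\<bar>) * (ennreal ((1 - r) powr \<alpha> * v r) * indicator {0..<1} r)"
    proof (cases "r \<in> {0..<1}")
      case True
      then have "(1 - r\<^sup>2) powr \<alpha> * r \<le> (2 powr \<bar>\<alpha>\<bar> * (1 - r) powr \<alpha>) * 1"
        by (intro mult_mono one_minus_square_powr_bounds) auto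
      then have "ennreal ((1 - r\<^sup>2) powr \<alpha> * r) * circ_int p r (cutoff k) \<le> ennreal (2 powr \<bar>\<alpha>\<bar> * (1 - r) powr \<alpha>) * ennreal (v r)"
        using True v[of r] by (intro mult_mono) (auto simp: circ_int_cutoff intro!: ennreal_leI)
      also have "\<dots> = ennreal (2 powr \<bar>\<alpha>\<bar>) * ennreal ((1 - r) powr \<alpha> * v r)"
        using v0[of r] by (simp add: ennreal_mult mult_ac)
      finally show ?thesis using True by simp
    qed simp
  qed
  also have "\<dots> = ennreal (2 powr \<bar>\<alpha>\<bar>) * (\<integral>\<^sup>+r\<in>{0..<1}. ennreal ((1 - r) powr \<alpha> * v r) \<partial>lborel)"
    by (rule nn_integral_cmult) measurable
  finally show ?thesis .
qed

text \<open>The polar density r degenerates at the origin, hence the restriction to r \<ge> 1 / 2,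
  where 1 \<le> 2 r. \<open>nn_integral_increasing_tail\<close> later restores the inner
  half.\<close>

lemma disc_int_ge:
  assumes k: "continuous_on unit_disc k"
  shows "(\<integral>\<^sup>+r\<in>{1/2..<1}. ennreal ((1 - r) powr \<alpha>) * circ_int p r (cutoff k) \<partial>lborel) \<le>
    ennreal (2 * 2 powr \<bar>\<alpha>\<bar>) * disc_int p \<alpha> k"
proof -
  note [measurable] = circ_int_cutoff_measurable[OF k]
  have "(\<integral>\<^sup>+r\<in>{1/2..<1}. ennreal ((1 - r) powr \<alpha>) * circ_int p r (cutoff k) \<partial>lborel) \<le>
      (\<integral>\<^sup>+r. ennreal (2 * 2 powr \<bar>\<alpha>\<bar>) * (ennreal ((1 - r\<^sup>2) powr \<alpha> * r) * circ_int p r (cutoff k) * indicator {0..<1} r) \<partial>lborel)"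
  proof (rule nn_integral_mono)
    fix r :: real
    show "ennreal ((1 - r) powr \<alpha>) * circ_int p r (cutoff k) * indicator {1/2..<1} r \<le>
      ennreal (2 * 2 powr \<bar>\<alpha>\<bar>) * (ennreal ((1 - r\<^sup>2) powr \<alpha> * r) * circ_int p r (cutoff k) * indicator {0..<1} r)"
    proof (cases "r \<in> {1/2..<1}")
      case True
      then have "(1 - r) powr \<alpha> * 1 \<le> (2 powr \<bar>\<alpha>\<bar> * (1 - r\<^sup>2) powr \<alpha>) * (2 * r)"
        by (intro mult_mono one_minus_square_powr_bounds) auto
      then have "ennreal ((1 - r) powr \<alpha>) \<le> ennreal ((2 * 2 powr \<bar>\<alpha>\<bar>) * ((1 - r\<^sup>2) powr \<alpha> * r))"
        by (intro ennreal_leI) (simp add: mult_ac)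
      also have "\<dots> = ennreal (2 * 2 powr \<bar>\<alpha>\<bar>) * ennreal ((1 - r\<^sup>2) powr \<alpha> * r)"
        by (rule ennreal_mult') simp
      finally have "ennreal ((1 - r) powr \<alpha>) * circ_int p r (cutoff k) \<le> (ennreal (2 * 2 powr \<bar>\<alpha>\<bar>) * ennreal ((1 - r\<^sup>2) powr \<alpha> * r)) * circ_int p r (cutoff k)"
        by (rule mult_right_mono) simp
      then show ?thesis using True by (simp add: mult.assoc)
    qed simp
  qed
  also have "\<dots> = ennreal (2 * 2 powr \<bar>\<alpha>\<bar>) * disc_int p \<alpha> k"
    unfolding disc_int_polar[OF k] by (rule nn_integral_cmult) measurable
  finally show ?thesis .
qed

text \<open>Both halves are compared with the constant v(1/2): it dominates \<open>v\<close> on [0,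
  1/2) and is dominated on [1/2, 1). The factor 2^(\<gamma> + 1) is the ratio of the masses of (1 -
  r)^\<gamma> on [0, 1) and [1/2, 1).\<close>

lemma nn_integral_increasing_tail:
  fixes v :: "real \<Rightarrow> real"
  assumes \<gamma>: "-1 < \<gamma>" and [measurable]: "v \<in> borel_measurable borel" and v0: "\<And>r. 0 \<le> v r"
    and mono: "\<And>r s. 0 \<le> r \<Longrightarrow> r \<le> s \<Longrightarrow> s < 1 \<Longrightarrow> v r \<le> v s"
  shows "(\<integral>\<^sup>+r\<in>{0..<1}. ennreal ((1 - r) powr \<gamma> * v r) \<partial>lborel) \<le>
    ennreal (1 + 2 powr (\<gamma> + 1)) * (\<integral>\<^sup>+r\<in>{1/2..<1}. ennreal ((1 - r) powr \<gamma> * v r) \<partial>lborel)"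
proof -
  let ?I = "\<lambda>A. (\<integral>\<^sup>+r\<in>A. ennreal ((1 - r) powr \<gamma> * v r) \<partial>lborel)"
  define V where "V = v (1/2) / (\<gamma> + 1)"
  have V: "0 \<le> V" using v0 \<gamma> by (simp add: V_def)
  have const: "(\<integral>\<^sup>+r\<in>{s..<1}. ennreal ((1 - r) powr \<gamma> * v (1/2)) \<partial>lborel) = ennreal (V * (1 - s) powr (\<gamma> + 1))"
    if "s \<le> 1" for s
  proof -
    have "(\<integral>\<^sup>+r\<in>{s..<1}. ennreal ((1 - r) powr \<gamma> * v (1/2)) \<partial>lborel) = (\<integral>\<^sup>+r. ennreal (v (1/2)) * (ennreal ((1 - r) powr \<gamma>) * indicator {s..<1} r) \<partial>lborel)"
      by (rule nn_integral_cong) (simp add: ennreal_mult v0 mult_ac)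
    also have "\<dots> = ennreal (v (1/2)) * ennreal ((1 - s) powr (\<gamma> + 1) / (\<gamma> + 1))"
      by (subst nn_integral_cmult, measurable, subst nn_integral_one_minus_powr[OF \<gamma> that]) simp
    finally show ?thesis using v0 by (simp add: V_def ennreal_mult'[symmetric])
  qed
  have "?I {0..<1/2} \<le> (\<integral>\<^sup>+r\<in>{0..<1}. ennreal ((1 - r) powr \<gamma> * v (1/2)) \<partial>lborel)"
    by (intro nn_integral_mono) (auto simp: indicator_def intro!: ennreal_leI mult_left_mono mono)
  also have "\<dots> = ennreal V" by (subst const) auto
  also have "\<dots> = ennreal (2 powr (\<gamma> + 1)) * ennreal (V * (1 - 1/2) powr (\<gamma> + 1))"
  proof -
    have "2 powr (\<gamma> + 1) * (1 - 1/2 :: real) powr (\<gamma> + 1) = 1" by (simp add: powr_mult[symmetric] del: powr_divide)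
    then have "V = 2 powr (\<gamma> + 1) * (V * (1 - 1/2) powr (\<gamma> + 1))" by (simp only: mult.left_commute[of _ V] mult_1_right)
    then show ?thesis by (simp only: ennreal_mult'[symmetric] powr_ge_zero)
  qed
  also have "ennreal (V * (1 - 1/2) powr (\<gamma> + 1)) \<le> ?I {1/2..<1}"
    by (subst const[symmetric]) (auto intro!: nn_integral_mono ennreal_leI mult_left_mono mono simp: indicator_def)
  finally have low: "?I {0..<1/2} \<le> ennreal (2 powr (\<gamma> + 1)) * ?I {1/2..<1}" by (simp add: mult_left_mono)
  have "?I {0..<1} = ?I {0..<1/2} + ?I {1/2..<1}" by (rule nn_integral_Ico_split) auto
  also have "\<dots> \<le> ennreal (2 powr (\<gamma> + 1)) * ?I {1/2..<1} + 1 * ?I {1/2..<1}" using low by (simp add: add_right_mono)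
  also have "\<dots> = ennreal (1 + 2 powr (\<gamma> + 1)) * ?I {1/2..<1}"
  proof -
    have "ennreal (1 + 2 powr (\<gamma> + 1)) = ennreal (2 powr (\<gamma> + 1)) + 1" by (simp add: add.commute)
    then show ?thesis by (simp only: distrib_right)
  qed
  finally show ?thesis .
qed

context radial_mass
begin

lemma stieltjes_disc_int_ge:
  assumes p: "0 < p" and \<alpha>: "-1 < \<alpha>"
  shows "(\<integral>\<^sup>+r\<in>{0..<1}. ennreal ((1 - r) powr (\<alpha> + 1) * Phi a 1 r powr p) \<partial>lborel) \<le>
    ennreal ((1 + 2 powr (\<alpha> + 2)) * (8 powr p * (2 * 2 powr \<bar>\<alpha>\<bar>))) * disc_int p \<alpha> stieltjes"
proof -
  have c: "continuous_on unit_disc stieltjes" by (rule holomorphic_on_imp_continuous_on[OF holomorphic_stieltjes])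
  note [measurable] = circ_int_cutoff_measurable[OF c]
  have "(\<integral>\<^sup>+r\<in>{1/2..<1}. ennreal ((1 - r) powr (\<alpha> + 1) * Phi a 1 r powr p) \<partial>lborel) \<le>
      (\<integral>\<^sup>+r. ennreal (8 powr p) * (ennreal ((1 - r) powr \<alpha>) * circ_int p r (cutoff stieltjes) * indicator {1/2..<1} r) \<partial>lborel)"
  proof (rule nn_integral_mono)
    fix r :: real
    show "ennreal ((1 - r) powr (\<alpha> + 1) * Phi a 1 r powr p) * indicator {1/2..<1} r \<le>
      ennreal (8 powr p) * (ennreal ((1 - r) powr \<alpha>) * circ_int p r (cutoff stieltjes) * indicator {1/2..<1} r)"
    proof (cases "r \<in> {1/2..<1}")
      case True
      have "(1 - r) powr (\<alpha> + 1) = (1 - r) powr \<alpha> * (1 - r)" using True powr_add[of "1 - r" \<alpha> 1] by simp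
      moreover have "Phi a 1 r powr p = 8 powr p * (Phi a 1 r / 8) powr p"
        by (simp add: powr_divide)
      ultimately have "ennreal ((1 - r) powr (\<alpha> + 1) * Phi a 1 r powr p) = ennreal (8 powr p * ((1 - r) powr \<alpha> * ((1 - r) * (Phi a 1 r / 8) powr p)))"
        by (simp only: mult_ac)
      also have "\<dots> = ennreal (8 powr p) * (ennreal ((1 - r) powr \<alpha>) * ennreal ((1 - r) * (Phi a 1 r / 8) powr p))"
        by (simp only: ennreal_mult' powr_ge_zero)
      also have "\<dots> \<le> ennreal (8 powr p) * (ennreal ((1 - r) powr \<alpha>) * circ_int p r (cutoff stieltjes))"
        using True circ_int_stieltjes_ge_arc[OF p, of r] by (intro mult_left_mono) (auto simp: circ_int_cutoff)
      finally show ?thesis using True by simp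
    qed simp
  qed
  also have "\<dots> = ennreal (8 powr p) * (\<integral>\<^sup>+r\<in>{1/2..<1}. ennreal ((1 - r) powr \<alpha>) * circ_int p r (cutoff stieltjes) \<partial>lborel)"
    by (rule nn_integral_cmult) measurable
  also have "\<dots> \<le> ennreal (8 powr p) * (ennreal (2 * 2 powr \<bar>\<alpha>\<bar>) * disc_int p \<alpha> stieltjes)"
    by (intro mult_left_mono disc_int_ge[OF c]) simp
  finally have tail: "(\<integral>\<^sup>+r\<in>{1/2..<1}. ennreal ((1 - r) powr (\<alpha> + 1) * Phi a 1 r powr p) \<partial>lborel) \<le> ennreal (8 powr p) * (ennreal (2 * 2 powr \<bar>\<alpha>\<bar>) * disc_int p \<alpha> stieltjes)" .
  have "(\<integral>\<^sup>+r\<in>{0..<1}. ennreal ((1 - r) powr (\<alpha> + 1) * Phi a 1 r powr p) \<partial>lborel) \<le>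
      ennreal (1 + 2 powr (\<alpha> + 1 + 1)) * (\<integral>\<^sup>+r\<in>{1/2..<1}. ennreal ((1 - r) powr (\<alpha> + 1) * Phi a 1 r powr p) \<partial>lborel)"
    using \<alpha> p by (intro nn_integral_increasing_tail) (auto intro!: powr_mono2 Phi_mono Phi_nonneg)
  also have "\<dots> \<le> ennreal (1 + 2 powr (\<alpha> + 1 + 1)) * (ennreal (8 powr p) * (ennreal (2 * 2 powr \<bar>\<alpha>\<bar>) * disc_int p \<alpha> stieltjes))"
    by (intro mult_left_mono tail) simp
  also have "\<dots> = ennreal ((1 + 2 powr (\<alpha> + 2)) * (8 powr p * (2 * 2 powr \<bar>\<alpha>\<bar>))) * disc_int p \<alpha> stieltjes"
  proof -
    have "\<alpha> + 1 + 1 = \<alpha> + 2" by simp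
    moreover have "0 \<le> 1 + 2 powr (\<alpha> + 2)" by (simp add: add_nonneg_nonneg)
    ultimately show ?thesis by (simp only: ennreal_mult' powr_ge_zero mult.assoc)
  qed
  finally show ?thesis .
qed

text \<open>The value at 0 is the total mass, so the corresponding term of the Dirichlet norm pays
  for the mass that the derivative does not see.\<close>

lemma deriv_stieltjes_disc_int_ge:
  assumes p: "0 < p" and \<alpha>: "-1 < \<alpha>"
  shows "(\<integral>\<^sup>+r\<in>{0..<1}. ennreal ((1 - r) powr (\<alpha> + 1) * Phi a 2 r powr p) \<partial>lborel) \<le>
    ennreal ((1 + 2 powr (\<alpha> + 2)) * (8 powr p * (1 / (\<alpha> + 1) + 8 * (2 * 2 powr \<bar>\<alpha>\<bar>)))) *
      (ennreal (norm (stieltjes 0) powr p) + disc_int p \<alpha> (deriv stieltjes))"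
proof -
  have c: "continuous_on unit_disc (deriv stieltjes)"
    by (intro holomorphic_on_imp_continuous_on holomorphic_deriv holomorphic_stieltjes) auto
  note [measurable] = circ_int_cutoff_measurable[OF c]
  define A where "A = integral\<^sup>L lborel a"
  have A: "norm (stieltjes 0) = A" unfolding stieltjes_0 A_def
    by (simp add: integral_nonneg_AE mass_nonneg)
  let ?D = "disc_int p \<alpha> (deriv stieltjes)"
  define c1 c2 where "c1 = 8 powr p * (1 / (\<alpha> + 1))" and "c2 = 8 powr p * (8 * (2 * 2 powr \<bar>\<alpha>\<bar>))"
  have cc: "0 \<le> c1" "0 \<le> c2" using \<alpha> by (auto simp: c1_def c2_def)
  have "(\<integral>\<^sup>+r\<in>{1/2..<1}. ennreal ((1 - r) powr (\<alpha> + 1) * Phi a 2 r powr p) \<partial>lborel) \<le>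
      (\<integral>\<^sup>+r. ennreal (8 powr p) * ennreal (A powr p) * (ennreal ((1 - r) powr \<alpha>) * indicator {0..<1} r) +
        ennreal (8 * 8 powr p) * (ennreal ((1 - r) powr \<alpha>) * circ_int p r (cutoff (deriv stieltjes)) * indicator {1/2..<1} r) \<partial>lborel)"
  proof (rule nn_integral_mono)
    fix r :: real
    show "ennreal ((1 - r) powr (\<alpha> + 1) * Phi a 2 r powr p) * indicator {1/2..<1} r \<le>
      ennreal (8 powr p) * ennreal (A powr p) * (ennreal ((1 - r) powr \<alpha>) * indicator {0..<1} r) +
        ennreal (8 * 8 powr p) * (ennreal ((1 - r) powr \<alpha>) * circ_int p r (cutoff (deriv stieltjes)) * indicator {1/2..<1} r)"
    proof (cases "r \<in> {1/2..<1}")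
      case True
      have "(1 - r) powr (\<alpha> + 1) = (1 - r) powr \<alpha> * (1 - r)" using True powr_add[of "1 - r" \<alpha> 1] by simp
      then have "ennreal ((1 - r) powr (\<alpha> + 1) * Phi a 2 r powr p) = ennreal ((1 - r) powr \<alpha>) * ennreal ((1 - r) * Phi a 2 r powr p)"
        by (simp only: ennreal_mult' powr_ge_zero mult.assoc)
      also have "\<dots> \<le> ennreal ((1 - r) powr \<alpha>) * (ennreal (8 powr p) * ennreal (A powr p) + ennreal (8 * 8 powr p) * circ_int p r (cutoff (deriv stieltjes)))"
        using True circ_int_deriv_stieltjes_ge[OF p, of r] by (intro mult_left_mono) (auto simp: circ_int_cutoff A_def)
      finally show ?thesis using True by (simp add: distrib_left mult_ac)
    qed simp
  qed
  also have "\<dots> = ennreal (8 powr p) * ennreal (A powr p) * (\<integral>\<^sup>+r\<in>{0..<1}. ennreal ((1 - r) powr \<alpha>) \<partial>lborel) +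
      ennreal (8 * 8 powr p) * (\<integral>\<^sup>+r\<in>{1/2..<1}. ennreal ((1 - r) powr \<alpha>) * circ_int p r (cutoff (deriv stieltjes)) \<partial>lborel)"
    by (subst nn_integral_add, measurable, subst nn_integral_cmult, measurable, subst nn_integral_cmult, measurable)
  also have "\<dots> \<le> ennreal (8 powr p) * ennreal (A powr p) * ennreal (1 / (\<alpha> + 1)) + ennreal (8 * 8 powr p) * (ennreal (2 * 2 powr \<bar>\<alpha>\<bar>) * ?D)"
    using nn_integral_one_minus_powr[OF \<alpha>, of 0] by (intro add_mono mult_left_mono disc_int_ge[OF c]) auto
  also have "\<dots> = ennreal c1 * ennreal (A powr p) + ennreal c2 * ?D"
  proof -
    have "ennreal c1 = ennreal (8 powr p) * ennreal (1 / (\<alpha> + 1))" unfolding c1_def by (rule ennreal_mult') simp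
    moreover have "ennreal c2 = ennreal (8 * 8 powr p) * ennreal (2 * 2 powr \<bar>\<alpha>\<bar>)"
      unfolding c2_def by (subst ennreal_mult'[symmetric]) (auto simp: mult_ac)
    ultimately show ?thesis by (simp only: mult_ac)
  qed
  also have "\<dots> \<le> (ennreal c1 + ennreal c2) * ennreal (A powr p) + (ennreal c1 + ennreal c2) * ?D"
    by (intro add_mono mult_right_mono) auto
  also have "\<dots> = ennreal (c1 + c2) * (ennreal (A powr p) + ?D)"
    using cc by (simp add: distrib_left)
  finally have tail: "(\<integral>\<^sup>+r\<in>{1/2..<1}. ennreal ((1 - r) powr (\<alpha> + 1) * Phi a 2 r powr p) \<partial>lborel) \<le> ennreal (c1 + c2) * (ennreal (A powr p) + ?D)" .
  have "(\<integral>\<^sup>+r\<in>{0..<1}. ennreal ((1 - r) powr (\<alpha> + 1) * Phi a 2 r powr p) \<partial>lborel) \<le>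
      ennreal (1 + 2 powr (\<alpha> + 1 + 1)) * (\<integral>\<^sup>+r\<in>{1/2..<1}. ennreal ((1 - r) powr (\<alpha> + 1) * Phi a 2 r powr p) \<partial>lborel)"
    using \<alpha> p by (intro nn_integral_increasing_tail) (auto intro!: powr_mono2 Phi_mono Phi_nonneg)
  also have "\<dots> \<le> ennreal (1 + 2 powr (\<alpha> + 1 + 1)) * (ennreal (c1 + c2) * (ennreal (A powr p) + ?D))"
    by (intro mult_left_mono tail) simp
  also have "\<dots> = ennreal ((1 + 2 powr (\<alpha> + 2)) * (8 powr p * (1 / (\<alpha> + 1) + 8 * (2 * 2 powr \<bar>\<alpha>\<bar>)))) * (ennreal (A powr p) + ?D)"
  proof -
    have "\<alpha> + 1 + 1 = \<alpha> + 2" by simp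
    moreover have "c1 + c2 = 8 powr p * (1 / (\<alpha> + 1) + 8 * (2 * 2 powr \<bar>\<alpha>\<bar>))" by (simp only: c1_def c2_def distrib_left)
    moreover have "0 \<le> 1 + 2 powr (\<alpha> + 2)" by (simp add: add_nonneg_nonneg)
    ultimately show ?thesis by (simp only: ennreal_mult' mult.assoc)
  qed
  finally show ?thesis by (simp only: A)
qed

end

section \<open>The generalised Hilbert operator\<close>

definition path_mass :: "(complex \<Rightarrow> complex) \<Rightarrow> real \<Rightarrow> real"
  where "path_mass f t = indicator {0..<1} t * norm (f (of_real t))"

definition path_density :: "(complex \<Rightarrow> complex) \<Rightarrow> real \<Rightarrow> complex"
  where "path_density f t = indicator {0..<1} t *\<^sub>R f (of_real t)"

lemma path_density_measurable:
  assumes "f holomorphic_on unit_disc"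
  shows "path_density f \<in> borel_measurable borel"
proof -
  have "continuous_on {0..<1::real} (\<lambda>t. f (of_real t))"
    by (rule continuous_on_compose2[OF holomorphic_on_imp_continuous_on[OF assms]])
      (auto intro!: continuous_intros)
  then show ?thesis unfolding path_density_def
    by (intro borel_measurable_continuous_on_indicator) auto
qed

lemma norm_path_density: "norm (path_density f t) = path_mass f t"
  by (simp add: path_density_def path_mass_def indicator_def)

lemma radial_mass_path:
  assumes "integrable lborel (path_density f)"
  shows "radial_mass (path_mass f)"
proof
  show "integrable lborel (path_mass f)"
    using integrable_norm[OF assms] by (simp add: norm_path_density)
qed (auto simp: path_mass_def)

lemma radial_density_path:
  assumes "f holomorphic_on unit_disc" "integrable lborel (path_density f)"
  shows "radial_density (path_mass f) (path_density f)"
proof -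
  interpret radial_mass "path_mass f" by (rule radial_mass_path[OF assms(2)])
  show ?thesis by unfold_locales (simp_all add: path_density_measurable[OF assms(1)] norm_path_density)
qed

lemma gen_hilbert_eq_transform:
  assumes "f holomorphic_on unit_disc" "integrable lborel (path_density f)"
  shows "gen_hilbert g f = radial_density.transform (path_density f) (deriv g)"
proof -
  interpret radial_density "path_mass f" "path_density f" by (rule radial_density_path[OF assms])
  show ?thesis
    by (rule ext) (simp add: gen_hilbert_def transform_def set_lebesgue_integral_def path_density_def)
qed

lemma sub_hilbert_eq_stieltjes:
  assumes "integrable lborel (path_density f)"
  shows "sub_hilbert f = radial_mass.stieltjes (path_mass f)"
proof -
  interpret radial_mass "path_mass f" by (rule radial_mass_path[OF assms])
  interpret A: radial_density "path_mass f" "\<lambda>t. complex_of_real (path_mass f t)" by (rule radial_density_self)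
  show ?thesis
    unfolding stieltjes_def A.transform_def
    by (rule ext) (auto simp: sub_hilbert_def set_lebesgue_integral_def path_mass_def
      indicator_def intro!: Bochner_Integration.integral_cong)
qed

text \<open>If \<open>f\<close> is not integrable on the radius, then \<open>sub_hilbert f\<close> is \<open>0\<close> by the convention for
  Bochner integrals, and the estimates hold because \<open>gen_hilbert g f\<close> then vanishes off a null set.\<close>

lemma gen_hilbert_eq_0:
  assumes f: "f holomorphic_on unit_disc" and g: "g holomorphic_on unit_disc"
    and ni: "\<not> integrable lborel (path_density f)" and z: "norm z < 1" and nz: "deriv g z \<noteq> 0"
  shows "gen_hilbert g f z = 0"
proof -
  have hg: "deriv g holomorphic_on unit_disc" by (intro holomorphic_deriv g) auto
  have eq: "gen_hilbert g f z = (LINT t|lborel. path_density f t * deriv g (of_real t * z))"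
    by (simp add: gen_hilbert_def set_lebesgue_integral_def path_density_def)
  have "\<not> integrable lborel (\<lambda>t. path_density f t * deriv g (of_real t * z))"
  proof
    assume int: "integrable lborel (\<lambda>t. path_density f t * deriv g (of_real t * z))"
    \<comment> \<open>Near t = 1 the factor g'(t z) stays above \<open>c\<close> in modulus, so
      integrability of the product would pass to f; away from t = 1 the function f is bounded
      anyway.\<close>
    define c where "c = norm (deriv g z) / 2"
    have c: "0 < c" using nz by (simp add: c_def)
    have "continuous_on {0..1::real} (\<lambda>t. deriv g (of_real t * z))"
      by (rule continuous_on_compose2[OF holomorphic_on_imp_continuous_on[OF hg]])
        (use disc_scale z in \<open>auto intro!: continuous_intros\<close>)
    then have "((\<lambda>t. deriv g (of_real t * z)) \<longlongrightarrow> deriv g (of_real 1 * z)) (at 1 within {0..1})"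
      unfolding continuous_on_def by (rule bspec) simp
    then have "((\<lambda>t. norm (deriv g (of_real t * z))) \<longlongrightarrow> norm (deriv g z)) (at 1 within {0..1})"
      using tendsto_norm by fastforce
    then have "\<forall>\<^sub>F t in at 1 within {0..1}. c < norm (deriv g (of_real t * z))"
      using c by (intro order_tendstoD(1)) (auto simp: c_def)
    then obtain d where d: "0 < d" and dd: "\<And>t. t \<in> {0..1} \<Longrightarrow> t \<noteq> 1 \<Longrightarrow> dist t 1 < d \<Longrightarrow> c < norm (deriv g (of_real t * z))"
      unfolding eventually_at by blast
    define s where "s = max 0 (1 - d / 2)"
    have s: "0 \<le> s" "s < 1" "1 - s < d" using d by (auto simp: s_def)
    have "continuous_on {0..s} (\<lambda>t. f (of_real t))"
      by (rule continuous_on_compose2[OF holomorphic_on_imp_continuous_on[OF f]])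
        (use s in \<open>auto intro!: continuous_intros\<close>)
    from compact_imp_bounded[OF compact_continuous_image[OF this compact_Icc]]
    obtain B where B: "\<And>t. t \<in> {0..s} \<Longrightarrow> norm (f (of_real t)) \<le> B"
      unfolding bounded_iff by blast
    have "integrable lborel (path_density f)"
    proof (rule Bochner_Integration.integrable_bound)
      show "integrable lborel (\<lambda>t. \<bar>B\<bar> * indicator {0..1} t + norm (path_density f t * deriv g (of_real t * z)) / c)"
        using int by (intro Bochner_Integration.integrable_add integrable_mult_right integrable_divide integrable_norm) auto
      show "path_density f \<in> borel_measurable lborel" using path_density_measurable[OF f] by simp
      have "norm (path_density f t) \<le> \<bar>B\<bar> * indicator {0..1} t + norm (path_density f t * deriv g (of_real t * z)) / c" for t
      proof -
        consider "t \<notin> {0..<1}" | "t \<in> {0..s}" | "t \<in> {s<..<1}" using s by force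
        then show ?thesis
        proof cases
          case 1
          then show ?thesis using c by (simp add: path_density_def)
        next
          case 2
          then have "norm (path_density f t) \<le> \<bar>B\<bar>" using B[of t] s by (simp add: path_density_def)
          moreover have "0 \<le> norm (path_density f t * deriv g (of_real t * z)) / c" using c by simp
          moreover have "\<bar>B\<bar> * indicator {0..1} t = \<bar>B\<bar>" using 2 s by simp
          ultimately show ?thesis by linarith
        next
          case 3
          then have "c < norm (deriv g (of_real t * z))" using s by (intro dd) (auto simp: dist_real_def)
          then have "norm (path_density f t) * c \<le> norm (path_density f t) * norm (deriv g (of_real t * z))"
            by (intro mult_left_mono) auto
          then have "norm (path_density f t) \<le> norm (path_density f t * deriv g (of_real t * z)) / c"
            using c by (simp add: norm_mult field_simps)
          moreover have "0 \<le> \<bar>B\<bar> * indicator {0..1} t" by simp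
          ultimately show ?thesis by linarith
        qed
      qed
      then show "AE t in lborel. norm (path_density f t) \<le> norm (\<bar>B\<bar> * indicator {0..1} t + norm (path_density f t * deriv g (of_real t * z)) / c)"
        by (intro AE_I2) (smt (verit) real_norm_def)
    qed
    then show False using ni by simp
  qed
  then show ?thesis unfolding eq by (rule not_integrable_integral_eq)
qed

text \<open>The exceptional set is the zero set of g', countable by the identity theorem, or empty
  when g' vanishes identically, since then so does the integrand. Openness of the complement lets
  the derivative vanish there too, as the Dirichlet norm requires.\<close>

lemma gen_hilbert_eq_0_off_countable:
  assumes f: "f holomorphic_on unit_disc" and g: "g holomorphic_on unit_disc"
    and ni: "\<not> integrable lborel (path_density f)"
  obtains Z where "countable Z" "open (unit_disc - Z)" "\<And>z. norm z < 1 \<Longrightarrow> z \<notin> Z \<Longrightarrow> gen_hilbert g f z = 0"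
proof (cases "\<forall>z\<in>unit_disc. deriv g z = 0")
  case True
  have "gen_hilbert g f z = 0" if "norm z < 1" for z
  proof -
    have "indicator {0..<1} t *\<^sub>R (f (of_real t) * deriv g (of_real t * z)) = 0" for t :: real
      using True disc_scale[of t z] that by (auto simp: indicator_def)
    then show ?thesis unfolding gen_hilbert_def set_lebesgue_integral_def by (simp only: integral_zero)
  qed
  then show ?thesis using that[of "{}"] by simp
next
  case False
  have hg: "deriv g holomorphic_on unit_disc" by (intro holomorphic_deriv g) auto
  define Z where "Z = {z \<in> unit_disc. deriv g z = 0}"
  have "countable Z"
  proof (cases "deriv g constant_on unit_disc")
    case True
    then have "Z = {}" using False unfolding Z_def constant_on_def by force
    then show ?thesis by simp
  next
    case nc: False
    obtain C :: "nat \<Rightarrow> complex set" where "\<And>n. compact (C n)" "\<Union>(range C) = unit_disc"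
      using open_Union_compact_subsets[OF open_ball] by metis
    then have "fsigma unit_disc" unfolding fsigma_Union_compact by blast
    then show ?thesis unfolding Z_def
      by (intro holomorphic_countable_zeros[OF hg _ _ _ nc]) auto
  qed
  moreover have "unit_disc - Z = {z \<in> unit_disc. deriv g z \<in> - {0}}" by (auto simp: Z_def)
  then have "open (unit_disc - Z)"
    using continuous_open_preimage[OF holomorphic_on_imp_continuous_on[OF hg], of "- {0}"]
    by (simp add: vimage_def Int_def Collect_conj_eq[symmetric] open_Compl)
  ultimately show ?thesis
    using that gen_hilbert_eq_0[OF f g ni] unfolding Z_def by auto
qed

lemma disc_int_eq_0_off_countable:
  assumes "countable Z" "\<And>z. norm z < 1 \<Longrightarrow> z \<notin> Z \<Longrightarrow> k z = 0"
  shows "disc_int p \<alpha> k = 0"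
proof -
  have "disc_int p \<alpha> k = (\<integral>\<^sup>+z. 0 \<partial>(lborel :: complex measure))"
    unfolding disc_int_def
  proof (rule nn_integral_cong_AE)
    have "AE z in lborel. z \<notin> Z" by (rule AE_not_in[OF countable_imp_null_set_lborel[OF assms(1)]])
    then show "AE z in lborel. ennreal (norm (k z) powr p * (1 - (norm z)\<^sup>2) powr \<alpha>) * indicator unit_disc z = 0"
      by eventually_elim (use assms(2) in \<open>auto simp: indicator_def\<close>)
  qed
  then show ?thesis by simp
qed

lemma circ_int_eq_0_off_countable:
  assumes Z: "countable Z" and k: "\<And>z. norm z < 1 \<Longrightarrow> z \<notin> Z \<Longrightarrow> k z = 0" and r: "0 < r" "r < 1"
  shows "circ_int p r k = 0"
proof -
  have "circ_int p r k = (\<integral>\<^sup>+t. 0 \<partial>(lborel :: real measure))"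
    unfolding circ_int_def
  proof (rule nn_integral_cong_AE)
    \<comment> \<open>\<open>Arg2pi\<close> takes values in [0, 2 pi), so the end point 2 pi is
      discarded separately.\<close>
    have "countable (insert (2 * pi) (Arg2pi ` Z))" using Z by simp
    then have "AE t in lborel. t \<notin> insert (2 * pi) (Arg2pi ` Z)"
      by (rule AE_not_in[OF countable_imp_null_set_lborel])
    then show "AE t in lborel. ennreal (norm (k (of_real r * cis t)) powr p) * indicator {0..2*pi} t = 0"
    proof eventually_elim
      case (elim t)
      show ?case
      proof (cases "t \<in> {0..2*pi}")
        case True
        then have "Arg2pi (of_real r * cis t) = t"
          using elim r by (intro Arg2pi_unique[of r]) (auto simp: cis_conv_exp)
        then have "of_real r * cis t \<notin> Z" using elim by (metis image_eqI insertCI)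
        then show ?thesis using k[of "of_real r * cis t"] r by (simp add: norm_mult)
      qed simp
    qed
  qed
  then show ?thesis by simp
qed

text \<open>Joins the bound on circles to the Hardy inequality, with a constant uniform in the mass
  and the density. It is applied with n = 1 to the operator itself and with n = 2 to its
  derivative.\<close>

lemma disc_int_transform_le:
  assumes p: "1 < p" and \<alpha>: "-1 < \<alpha>" and n: "1 \<le> n" and G: "continuous_on unit_disc G" and C: "0 < C"
    and gr: "\<And>r. 0 \<le> r \<Longrightarrow> r < 1 \<Longrightarrow> circ_int p r G \<le> ennreal (C * (1 - r) powr (1 - real n * p))"
  shows "\<exists>K>0. \<forall>a b. radial_density a b \<longrightarrow> continuous_on unit_disc (radial_density.transform b G) \<longrightarrow>
    disc_int p \<alpha> (radial_density.transform b G) \<le>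
      ennreal K * (\<integral>\<^sup>+r\<in>{0..<1}. ennreal ((1 - r) powr (\<alpha> + 1) * Phi a (real n) r powr p) \<partial>lborel)"
proof -
  have "1 / p < 1" using p by simp
  then have "1 / p < real n" using n by linarith
  from Phi_hardy[OF p \<alpha> this] obtain K where K: "0 < K" and hardy: "\<And>a. radial_mass a \<Longrightarrow>
    (\<integral>\<^sup>+r\<in>{0..<1}. ennreal ((1 - r) powr \<alpha> * Phi a (real n - 1 / p) r powr p) \<partial>lborel) \<le>
      ennreal K * (\<integral>\<^sup>+r\<in>{0..<1}. ennreal ((1 - r) powr (\<alpha> + 1) * Phi a (real n) r powr p) \<partial>lborel)"
    by blast
  show ?thesis
  proof (intro exI[of _ "2 powr \<bar>\<alpha>\<bar> * (C * K)"] conjI allI impI)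
    show "0 < 2 powr \<bar>\<alpha>\<bar> * (C * K)" using C K by simp
    fix a b assume ab: "radial_density a b" and cont: "continuous_on unit_disc (radial_density.transform b G)"
    interpret radial_density a b by (rule ab)
    have rm: "radial_mass a" by unfold_locales
    have "disc_int p \<alpha> (transform G) \<le> ennreal (2 powr \<bar>\<alpha>\<bar>) * (\<integral>\<^sup>+r\<in>{0..<1}. ennreal ((1 - r) powr \<alpha> * (C * Phi a (real n - 1 / p) r powr p)) \<partial>lborel)"
      using C by (intro disc_int_le[OF cont] circ_int_transform_le[OF p G n _ gr]) auto
    also have "(\<integral>\<^sup>+r\<in>{0..<1}. ennreal ((1 - r) powr \<alpha> * (C * Phi a (real n - 1 / p) r powr p)) \<partial>lborel) =
        (\<integral>\<^sup>+r. ennreal C * (ennreal ((1 - r) powr \<alpha> * Phi a (real n - 1 / p) r powr p) * indicator {0..<1} r) \<partial>lborel)"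
    proof (rule nn_integral_cong)
      fix r
      have "(1 - r) powr \<alpha> * (C * Phi a (real n - 1 / p) r powr p) = C * ((1 - r) powr \<alpha> * Phi a (real n - 1 / p) r powr p)" by simp
      then show "ennreal ((1 - r) powr \<alpha> * (C * Phi a (real n - 1 / p) r powr p)) * indicator {0..<1} r =
          ennreal C * (ennreal ((1 - r) powr \<alpha> * Phi a (real n - 1 / p) r powr p) * indicator {0..<1} r)"
        using C by (simp only: ennreal_mult' less_imp_le mult.assoc)
    qed
    also have "\<dots> = ennreal C * (\<integral>\<^sup>+r\<in>{0..<1}. ennreal ((1 - r) powr \<alpha> * Phi a (real n - 1 / p) r powr p) \<partial>lborel)"
      by (rule nn_integral_cmult) measurable
    also have "ennreal (2 powr \<bar>\<alpha>\<bar>) * \<dots> \<le> ennreal (2 powr \<bar>\<alpha>\<bar>) * (ennreal C * (ennreal K * (\<integral>\<^sup>+r\<in>{0..<1}. ennreal ((1 - r) powr (\<alpha> + 1) * Phi a (real n) r powr p) \<partial>lborel)))"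
      by (intro mult_left_mono hardy[OF rm]) auto
    also have "\<dots> = ennreal (2 powr \<bar>\<alpha>\<bar> * (C * K)) * (\<integral>\<^sup>+r\<in>{0..<1}. ennreal ((1 - r) powr (\<alpha> + 1) * Phi a (real n) r powr p) \<partial>lborel)"
      using C K by (simp only: ennreal_mult' powr_ge_zero less_imp_le mult.assoc)
    finally show "disc_int p \<alpha> (transform G) \<le>
      ennreal (2 powr \<bar>\<alpha>\<bar> * (C * K)) * (\<integral>\<^sup>+r\<in>{0..<1}. ennreal ((1 - r) powr (\<alpha> + 1) * Phi a (real n) r powr p) \<partial>lborel)" .
  qed
qed

section \<open>The Bergman and Dirichlet estimates\<close>

lemma ennpowr_0: "0 < a \<Longrightarrow> ennpowr 0 a = 0"
  by (simp add: ennpowr_def)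

theorem bergman_norm_gen_hilbert_le:
  assumes p: "1 < p" and g: "g \<in> mean_lipschitz p (1 / p)" and \<alpha>: "-1 < \<alpha>"
  shows "\<exists>C>0. \<forall>f. f holomorphic_on unit_disc \<longrightarrow>
    bergman_norm p \<alpha> (gen_hilbert g f) \<le> ennreal C * bergman_norm p \<alpha> (sub_hilbert f)"
proof -
  have hol: "g holomorphic_on unit_disc" using g by (auto simp: mean_lipschitz_def hardy_space_def)
  have hg: "deriv g holomorphic_on unit_disc" by (intro holomorphic_deriv hol) auto
  have cg: "continuous_on unit_disc (deriv g)" by (rule holomorphic_on_imp_continuous_on[OF hg])
  obtain C where C: "0 < C" and gr: "\<And>r. 0 \<le> r \<Longrightarrow> r < 1 \<Longrightarrow> circ_int p r (deriv g) \<le> ennreal (C * (1 - r) powr (1 - real 1 * p))"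
    using mean_lipschitz_growth[OF p g, of 1] by auto
  from disc_int_transform_le[OF p \<alpha> order_refl cg C gr] obtain K where K: "0 < K"
    and up: "\<And>a b. radial_density a b \<Longrightarrow> continuous_on unit_disc (radial_density.transform b (deriv g)) \<Longrightarrow>
      disc_int p \<alpha> (radial_density.transform b (deriv g)) \<le>
        ennreal K * (\<integral>\<^sup>+r\<in>{0..<1}. ennreal ((1 - r) powr (\<alpha> + 1) * Phi a (real 1) r powr p) \<partial>lborel)"
    by blast
  define L where "L = (1 + 2 powr (\<alpha> + 2)) * (8 powr p * (2 * 2 powr \<bar>\<alpha>\<bar>))"
  have L: "0 < L" unfolding L_def by (intro mult_pos_pos add_pos_pos) auto
  show ?thesis
  proof (intro exI[of _ "(K * L) powr (1 / p)"] conjI allI impI)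
    show "0 < (K * L) powr (1 / p)" using K L by simp
    fix f assume f: "f holomorphic_on unit_disc"
    have "disc_int p \<alpha> (gen_hilbert g f) \<le> ennreal (K * L) * disc_int p \<alpha> (sub_hilbert f)"
    proof (cases "integrable lborel (path_density f)")
      case True
      interpret radial_density "path_mass f" "path_density f" by (rule radial_density_path[OF f True])
      have rd: "radial_density (path_mass f) (path_density f)" by unfold_locales
      have "disc_int p \<alpha> (transform (deriv g)) \<le> ennreal K * (\<integral>\<^sup>+r\<in>{0..<1}. ennreal ((1 - r) powr (\<alpha> + 1) * Phi (path_mass f) (real 1) r powr p) \<partial>lborel)"
        by (rule up[OF rd holomorphic_on_imp_continuous_on[OF transform_holomorphic[OF hg]]])
      also have "\<dots> \<le> ennreal K * (ennreal L * disc_int p \<alpha> stieltjes)"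
        using stieltjes_disc_int_ge[of p \<alpha>] p \<alpha> by (intro mult_left_mono) (auto simp: L_def)
      finally show ?thesis using K
        by (simp add: gen_hilbert_eq_transform[OF f True] sub_hilbert_eq_stieltjes[OF True] ennreal_mult' mult.assoc)
    next
      case False
      from gen_hilbert_eq_0_off_countable[OF f hol this] obtain Z where
        "countable Z" "\<And>z. norm z < 1 \<Longrightarrow> z \<notin> Z \<Longrightarrow> gen_hilbert g f z = 0" by metis
      then have "disc_int p \<alpha> (gen_hilbert g f) = 0" by (rule disc_int_eq_0_off_countable)
      then show ?thesis by simp
    qed
    then have "ennreal ((\<alpha> + 1) / pi) * disc_int p \<alpha> (gen_hilbert g f) \<le> ennreal ((\<alpha> + 1) / pi) * (ennreal (K * L) * disc_int p \<alpha> (sub_hilbert f))"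
      by (rule mult_left_mono) simp
    then show "bergman_norm p \<alpha> (gen_hilbert g f) \<le> ennreal ((K * L) powr (1 / p)) * bergman_norm p \<alpha> (sub_hilbert f)"
      unfolding bergman_norm_eq using p K L
      by (intro ennpowr_mono_mult) (auto simp: mult.left_commute)
  qed
qed

lemma dirichlet_norm_eq:
  assumes "0 < p"
  shows "dirichlet_norm p \<alpha> k =
    ennpowr (ennreal (norm (k 0) powr p) + ennreal ((\<alpha> + 1) / pi) * disc_int p \<alpha> (deriv k)) (1 / p)"
  unfolding dirichlet_norm_def bergman_norm_eq using assms by (simp only: ennpowr_ennpowr_inverse)

text \<open>At 0 the generalised operator is the integral of f over the radius times g'(0), and the
  sublinear one is the integral of |f|; the derivative is the transform of g'' with density t f(t).
  The two terms of the Dirichlet norm are kept apart because the second is bounded by both terms on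
  the other side.\<close>

lemma disc_int_deriv_gen_hilbert_le:
  assumes p: "1 < p" and g: "g \<in> mean_lipschitz p (1 / p)" and \<alpha>: "-1 < \<alpha>"
  shows "\<exists>K>0. \<forall>f. f holomorphic_on unit_disc \<longrightarrow>
    ennreal (norm (gen_hilbert g f 0) powr p) \<le> ennreal K * ennreal (norm (sub_hilbert f 0) powr p) \<and>
    disc_int p \<alpha> (deriv (gen_hilbert g f)) \<le>
      ennreal K * (ennreal (norm (sub_hilbert f 0) powr p) + disc_int p \<alpha> (deriv (sub_hilbert f)))"
proof -
  have hol: "g holomorphic_on unit_disc" using g by (auto simp: mean_lipschitz_def hardy_space_def)
  have hg: "deriv g holomorphic_on unit_disc" by (intro holomorphic_deriv hol) auto
  have hg2: "deriv (deriv g) holomorphic_on unit_disc" by (intro holomorphic_deriv hg) auto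
  have cg: "continuous_on unit_disc (deriv (deriv g))" by (rule holomorphic_on_imp_continuous_on[OF hg2])
  obtain C where C: "0 < C" and gr: "\<And>r. 0 \<le> r \<Longrightarrow> r < 1 \<Longrightarrow> circ_int p r (deriv (deriv g)) \<le> ennreal (C * (1 - r) powr (1 - real 2 * p))"
    using mean_lipschitz_growth[OF p g, of 2] by (auto simp: numeral_2_eq_2)
  from disc_int_transform_le[OF p \<alpha> one_le_numeral cg C gr] obtain K where K: "0 < K"
    and up: "\<And>a b. radial_density a b \<Longrightarrow> continuous_on unit_disc (radial_density.transform b (deriv (deriv g))) \<Longrightarrow>
      disc_int p \<alpha> (radial_density.transform b (deriv (deriv g))) \<le>
        ennreal K * (\<integral>\<^sup>+r\<in>{0..<1}. ennreal ((1 - r) powr (\<alpha> + 1) * Phi a (real 2) r powr p) \<partial>lborel)"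
    by blast
  define L where "L = (1 + 2 powr (\<alpha> + 2)) * (8 powr p * (1 / (\<alpha> + 1) + 8 * (2 * 2 powr \<bar>\<alpha>\<bar>)))"
  have L: "0 < L" unfolding L_def using \<alpha> by (intro mult_pos_pos add_pos_pos) auto
  define N where "N = norm (deriv g 0) powr p"
  have N: "0 \<le> N" by (simp add: N_def)
  show ?thesis
  proof (intro exI[of _ "K * L + N"] conjI allI impI)
    show "0 < K * L + N" using K L N by (intro add_pos_nonneg mult_pos_pos)
    fix f assume f: "f holomorphic_on unit_disc"
    show "ennreal (norm (gen_hilbert g f 0) powr p) \<le> ennreal (K * L + N) * ennreal (norm (sub_hilbert f 0) powr p)"
    proof (cases "integrable lborel (path_density f)")
      case True
      interpret radial_density "path_mass f" "path_density f" by (rule radial_density_path[OF f True])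
      have "gen_hilbert g f 0 = (LINT t|lborel. path_density f t) * deriv g 0"
        by (simp add: gen_hilbert_eq_transform[OF f True] transform_def)
      then have "norm (gen_hilbert g f 0) = norm (LINT t|lborel. path_density f t) * norm (deriv g 0)"
        by (simp add: norm_mult)
      also have "\<dots> \<le> integral\<^sup>L lborel (path_mass f) * norm (deriv g 0)"
        using integral_norm_bound[of lborel "path_density f"] by (intro mult_right_mono) (auto simp: norm_path_density)
      also have "integral\<^sup>L lborel (path_mass f) = norm (sub_hilbert f 0)"
        by (simp add: sub_hilbert_eq_stieltjes[OF True] stieltjes_0 integral_nonneg_AE mass_nonneg)
      finally have "norm (gen_hilbert g f 0) powr p \<le> (norm (sub_hilbert f 0) * norm (deriv g 0)) powr p"
        using p by (intro powr_mono2) auto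
      also have "\<dots> = N * norm (sub_hilbert f 0) powr p" by (simp add: powr_mult N_def)
      also have "\<dots> \<le> (K * L + N) * norm (sub_hilbert f 0) powr p" using K L by (intro mult_right_mono) auto
      finally show ?thesis using K L N by (simp only: ennreal_mult''[symmetric] powr_ge_zero ennreal_leI)
    next
      case False
      have "gen_hilbert g f 0 = 0"
      proof (cases "deriv g 0 = 0")
        case True
        then show ?thesis by (simp add: gen_hilbert_def set_lebesgue_integral_def)
      qed (use gen_hilbert_eq_0[OF f hol False] in simp)
      then show ?thesis using p by simp
    qed
    have "disc_int p \<alpha> (deriv (gen_hilbert g f)) \<le>
        ennreal (K * L) * (ennreal (norm (sub_hilbert f 0) powr p) + disc_int p \<alpha> (deriv (sub_hilbert f)))"
    proof (cases "integrable lborel (path_density f)")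
      case True
      interpret radial_density "path_mass f" "path_density f" by (rule radial_density_path[OF f True])
      interpret bt: radial_density "path_mass f" "\<lambda>t. path_density f t * of_real t" by (rule radial_density_times_t)
      have rd: "radial_density (path_mass f) (\<lambda>t. path_density f t * of_real t)" by unfold_locales
      have "disc_int p \<alpha> (deriv (gen_hilbert g f)) = disc_int p \<alpha> (bt.transform (deriv (deriv g)))"
        unfolding gen_hilbert_eq_transform[OF f True]
        by (intro disc_int_cong DERIV_imp_deriv transform_has_field_derivative hg)
      also have "\<dots> \<le> ennreal K * (\<integral>\<^sup>+r\<in>{0..<1}. ennreal ((1 - r) powr (\<alpha> + 1) * Phi (path_mass f) (real 2) r powr p) \<partial>lborel)"
        by (rule up[OF rd holomorphic_on_imp_continuous_on[OF bt.transform_holomorphic[OF hg2]]])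
      also have "\<dots> \<le> ennreal K * (ennreal L * (ennreal (norm (stieltjes 0) powr p) + disc_int p \<alpha> (deriv stieltjes)))"
        using deriv_stieltjes_disc_int_ge[of p \<alpha>] p \<alpha> by (intro mult_left_mono) (auto simp: L_def)
      finally show ?thesis using K
        by (simp add: sub_hilbert_eq_stieltjes[OF True] ennreal_mult' mult.assoc)
    next
      case False
      from gen_hilbert_eq_0_off_countable[OF f hol this] obtain Z where
        Z: "countable Z" "open (unit_disc - Z)" "\<And>z. norm z < 1 \<Longrightarrow> z \<notin> Z \<Longrightarrow> gen_hilbert g f z = 0" by metis
      \<comment> \<open>The function vanishes on an open set around z, so no holomorphy at the
        exceptional points is involved.\<close>
      have "deriv (gen_hilbert g f) z = 0" if z: "norm z < 1" "z \<notin> Z" for z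
      proof -
        have "((\<lambda>_. 0) has_field_derivative 0) (at z)" by simp
        then have "(gen_hilbert g f has_field_derivative 0) (at z)"
          by (rule has_field_derivative_transform_within_open[OF _ Z(2)]) (use z Z(3) in auto)
        then show ?thesis by (rule DERIV_imp_deriv)
      qed
      then have "disc_int p \<alpha> (deriv (gen_hilbert g f)) = 0" using Z(1) by (intro disc_int_eq_0_off_countable)
      then show ?thesis by simp
    qed
    also have "\<dots> \<le> ennreal (K * L + N) * (ennreal (norm (sub_hilbert f 0) powr p) + disc_int p \<alpha> (deriv (sub_hilbert f)))"
      using N by (intro mult_right_mono ennreal_leI) auto
    finally show "disc_int p \<alpha> (deriv (gen_hilbert g f)) \<le>
      ennreal (K * L + N) * (ennreal (norm (sub_hilbert f 0) powr p) + disc_int p \<alpha> (deriv (sub_hilbert f)))" .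
  qed
qed

theorem dirichlet_norm_gen_hilbert_le:
  assumes p: "1 < p" and g: "g \<in> mean_lipschitz p (1 / p)" and \<alpha>: "-1 < \<alpha>"
  shows "\<exists>C>0. \<forall>f. f holomorphic_on unit_disc \<longrightarrow>
    dirichlet_norm p \<alpha> (gen_hilbert g f) \<le> ennreal C * dirichlet_norm p \<alpha> (sub_hilbert f)"
proof -
  from disc_int_deriv_gen_hilbert_le[OF p g \<alpha>] obtain K where K: "0 < K"
    and zero: "\<And>f. f holomorphic_on unit_disc \<Longrightarrow> ennreal (norm (gen_hilbert g f 0) powr p) \<le> ennreal K * ennreal (norm (sub_hilbert f 0) powr p)"
    and der: "\<And>f. f holomorphic_on unit_disc \<Longrightarrow> disc_int p \<alpha> (deriv (gen_hilbert g f)) \<le>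
      ennreal K * (ennreal (norm (sub_hilbert f 0) powr p) + disc_int p \<alpha> (deriv (sub_hilbert f)))"
    by blast
  define c where "c = (\<alpha> + 1) / pi"
  have c: "0 \<le> c" using \<alpha> by (simp add: c_def)
  show ?thesis
  proof (intro exI[of _ "(K * (1 + c)) powr (1 / p)"] conjI allI impI)
    show "0 < (K * (1 + c)) powr (1 / p)" using K c by simp
    fix f assume f: "f holomorphic_on unit_disc"
    let ?s = "ennreal (norm (sub_hilbert f 0) powr p)" and ?D = "disc_int p \<alpha> (deriv (sub_hilbert f))"
    have "ennreal (norm (gen_hilbert g f 0) powr p) + ennreal c * disc_int p \<alpha> (deriv (gen_hilbert g f)) \<le>
        ennreal K * ?s + ennreal c * (ennreal K * (?s + ?D))"
      by (intro add_mono mult_left_mono zero der f) simp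
    also have "\<dots> = ennreal K * ((1 + ennreal c) * ?s + ennreal c * ?D)"
      by (simp only: distrib_left distrib_right mult_1_left mult_ac add_ac)
    \<comment> \<open>The derivative term is enlarged by 1 + c so that this factor can be taken out
      of the whole sum.\<close>
    also have "\<dots> \<le> ennreal K * ((1 + ennreal c) * ?s + (1 + ennreal c) * (ennreal c * ?D))"
      by (intro mult_left_mono add_left_mono) (simp_all add: distrib_right)
    also have "\<dots> = ennreal (K * (1 + c)) * (?s + ennreal c * ?D)"
    proof -
      have "ennreal (K * (1 + c)) = ennreal K * (1 + ennreal c)" using K c by (simp add: ennreal_mult')
      then show ?thesis by (simp only: distrib_left[of "1 + ennreal c", symmetric] mult.assoc)
    qed
    finally show "dirichlet_norm p \<alpha> (gen_hilbert g f) \<le> ennreal ((K * (1 + c)) powr (1 / p)) * dirichlet_norm p \<alpha> (sub_hilbert f)"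
      unfolding dirichlet_norm_eq[OF less_trans[OF zero_less_one p]] c_def[symmetric] using p K c
      by (intro ennpowr_mono_mult) auto
  qed
qed

section \<open>A Littlewood--Paley inequality for exponents up to two\<close>

lemma bernoulli_powr_le:
  fixes q y :: real
  assumes "0 < q" "q \<le> 1" "-1 \<le> y"
  shows "(1 + y) powr q \<le> 1 + q * y"
proof (cases "q = 1")
  case False
  \<comment> \<open>Young's inequality with the exponent 1 / q > 1, u = (1 + y)^q and c = 1.\<close>
  then have "(1 + y) powr q * 1 powr (1 / q - 1) \<le> ((1 + y) powr q) powr (1 / q) / (1 / q) + (1 - 1 / (1 / q)) * 1 powr (1 / q)"
    using assms by (intro young_powr) auto
  also have "((1 + y) powr q) powr (1 / q) = 1 + y" using assms by (simp add: powr_powr)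
  finally show ?thesis by (simp add: algebra_simps)
qed (use assms in simp)

text \<open>For |c| \<le> 1, Bernoulli's inequality with exponent p / 2 \<le> 1 is applied to |1 +
  c|^2, and the quadratic remainder is at most |c|^p because p \<le> 2. For |c| > 1, |1 + c|^p \<le>
  4 |c|^p and the linear term is at most 2 |c|^p in size; 4 + 2 gives the constant 6.\<close>

lemma norm_one_plus_powr_le:
  fixes c :: complex
  assumes p: "1 < p" "p \<le> 2"
  shows "norm (1 + c) powr p \<le> 1 + p * Re c + 6 * norm c powr p"
proof (cases "norm c \<le> 1")
  case True
  define y where "y = 2 * Re c + (norm c)\<^sup>2"
  have sq: "(norm (1 + c))\<^sup>2 = 1 + y"
    unfolding y_def cmod_power2 by (simp add: power2_eq_square algebra_simps)
  then have "-1 \<le> y" using zero_le_power2[of "norm (1 + c)"] by linarith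
  have "norm (1 + c) powr p = ((norm (1 + c))\<^sup>2) powr (p / 2)"
    by (simp add: powr_powr flip: powr_numeral)
  also have "\<dots> \<le> 1 + p / 2 * y"
    unfolding sq using p \<open>-1 \<le> y\<close> by (intro bernoulli_powr_le) auto
  also have "\<dots> = 1 + p * Re c + p / 2 * (norm c)\<^sup>2" by (simp add: y_def algebra_simps)
  also have "(norm c)\<^sup>2 = norm c powr 2" by simp
  also have "\<dots> \<le> norm c powr p" using True p by (cases "c = 0") (auto intro: powr_mono' simp del: powr_numeral)
  then have "p / 2 * (norm c powr 2) \<le> 6 * norm c powr p" using p by (intro mult_mono) auto
  then have "1 + p * Re c + p / 2 * (norm c powr 2) \<le> 1 + p * Re c + 6 * norm c powr p" by simp
  finally show ?thesis .
next
  case False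
  have one: "norm c powr 1 \<le> norm c powr p" using False p by (intro powr_mono) auto
  have "norm (1 + c) powr p \<le> (2 * norm c) powr p"
    using False p norm_triangle_ineq[of 1 c] by (intro powr_mono2) auto
  also have "\<dots> = 2 powr p * norm c powr p" by (simp add: powr_mult)
  also have "\<dots> \<le> 2 powr 2 * norm c powr p" using p by (intro mult_right_mono powr_mono) auto
  finally have "norm (1 + c) powr p \<le> 4 * norm c powr p" by simp
  moreover have "- (p * Re c) \<le> 2 * norm c powr p"
  proof -
    have "- (p * Re c) = p * (- Re c)" by simp
    also have "\<dots> \<le> p * norm c" using p abs_Re_le_cmod[of c] by (intro mult_left_mono) auto
    also have "\<dots> \<le> 2 * norm c powr p" using p one False by (intro mult_mono) auto
    finally show ?thesis .
  qed
  ultimately show ?thesis by linarith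
qed

lemma norm_add_powr_le:
  fixes a b :: complex
  assumes p: "1 < p" "p \<le> 2"
  shows "norm (a + b) powr p \<le> norm a powr p + p * norm a powr (p - 2) * Re (cnj a * b) + 6 * norm b powr p"
proof (cases "a = 0")
  case True
  then show ?thesis using p by simp
next
  case False
  have "norm (a + b) powr p = norm a powr p * norm (1 + b / a) powr p"
  proof -
    have "a + b = a * (1 + b / a)" using False by (simp add: field_simps)
    then have "norm (a + b) = norm a * norm (1 + b / a)" by (simp only: norm_mult)
    then show ?thesis by (simp add: powr_mult)
  qed
  also have "\<dots> \<le> norm a powr p * (1 + p * Re (b / a) + 6 * norm (b / a) powr p)"
    by (intro mult_left_mono norm_one_plus_powr_le p) auto
  also have "\<dots> = norm a powr p + p * (norm a powr p * Re (b / a)) + 6 * (norm a powr p * norm (b / a) powr p)"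
    by (simp add: algebra_simps)
  also have "norm a powr p * norm (b / a) powr p = norm b powr p"
    using False by (simp add: norm_divide powr_mult[symmetric])
  also have "norm a powr p * Re (b / a) = norm a powr (p - 2) * Re (cnj a * b)"
  proof -
    have "b / a = (cnj a * b) / of_real ((norm a)\<^sup>2)"
      unfolding complex_norm_square using False by (simp add: field_simps)
    then have "Re (b / a) = Re (cnj a * b) / (norm a)\<^sup>2" by (simp only: Re_divide_of_real)
    moreover have "norm a powr p = norm a powr (p - 2) * (norm a)\<^sup>2"
      using False powr_add[of "norm a" "p - 2" 2] by simp
    ultimately show ?thesis using False by simp
  qed
  finally show ?thesis by (simp add: mult.assoc)
qed

subsection \<open>Convex functions of one variable\<close>

lemma has_integral_cos_period: "(cos has_integral (0::real)) {0..2 * pi}"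
proof -
  have "(cos has_integral (sin (2 * pi) - sin 0)) {0..2 * pi}"
    by (rule fundamental_theorem_of_calculus)
      (auto intro!: derivative_eq_intros simp: has_real_derivative_iff_has_vector_derivative[symmetric])
  then show ?thesis by simp
qed

text \<open>A sub-mean value property for arbitrarily small radii excludes interior maxima of the
  difference to a chord.\<close>

lemma convex_on_if_cos_mean:
  fixes m :: "real \<Rightarrow> real"
  assumes cont: "continuous_on {..<0} m"
    and mean: "\<And>x \<rho>. 0 < \<rho> \<Longrightarrow> \<rho> < - x \<Longrightarrow> 2 * pi * m x \<le> integral {0..2 * pi} (\<lambda>\<psi>. m (x + \<rho> * cos \<psi>))"
    and ab: "a < b" "b < 0" and c0: "a \<le> c0" "c0 \<le> b"
  shows "m c0 \<le> m a + (m b - m a) / (b - a) * (c0 - a)"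
proof (rule ccontr)
  assume neg: "\<not> ?thesis"
  define s where "s = (m b - m a) / (b - a)"
  define n where "n x = m x - (m a + s * (x - a))" for x
  have sub: "{a..b} \<subseteq> {..<0}" using ab by auto
  have ncont: "continuous_on {a..b} n"
    unfolding n_def by (intro continuous_intros continuous_on_subset[OF cont sub])
  obtain x1 where x1: "x1 \<in> {a..b}" and max: "\<And>y. y \<in> {a..b} \<Longrightarrow> n y \<le> n x1"
    using continuous_attains_sup[OF compact_Icc _ ncont] ab by auto
  define M where "M = n x1"
  have n0: "n a = 0" "n b = 0" using ab by (auto simp: n_def s_def)
  have "0 < n c0" using neg by (simp add: n_def s_def)
  then have M: "0 < M" using max[of c0] c0 by (simp add: M_def)
  define S where "S = {x \<in> {a..b}. n x = M}"
  have "S = {a..b} \<inter> n -` {M}" by (auto simp: S_def)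
  then have "closed S" using continuous_closed_preimage[OF ncont, of "{M}"] by simp
  moreover have "bounded S" by (rule bounded_subset[OF bounded_closed_interval[of a b]]) (auto simp: S_def)
  ultimately have "compact S" by (simp add: compact_eq_bounded_closed)
  moreover have "S \<noteq> {}" using x1 by (auto simp: S_def M_def)
  \<comment> \<open>The leftmost maximum point; the mean value inequality will produce another one
    further left.\<close>
  ultimately obtain c where c: "c \<in> S" and least: "\<And>y. y \<in> S \<Longrightarrow> c \<le> y"
    using compact_attains_inf[of S] by metis
  have ncM: "n c = M" "c \<in> {a..b}" using c by (auto simp: S_def)
  then have cab: "a < c" "c < b" using M n0 by (auto simp: less_le)
  define \<rho> where "\<rho> = min (c - a) (b - c)"
  have \<rho>: "0 < \<rho>" "\<rho> < - c" "\<rho> \<le> c - a" "\<rho> \<le> b - c" using cab ab by (auto simp: \<rho>_def)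
  have inab: "c + \<rho> * cos \<psi> \<in> {a..b}" for \<psi>
  proof -
    have "\<bar>\<rho> * cos \<psi>\<bar> \<le> \<rho>" using \<rho> by (simp add: abs_mult mult_left_le)
    then show ?thesis using \<rho> by auto
  qed
  have neg_arg: "c + \<rho> * cos \<psi> < 0" for \<psi> using inab[of \<psi>] ab by auto
  have cm: "continuous_on {0..2*pi} (\<lambda>\<psi>. m (c + \<rho> * cos \<psi>))"
    by (rule continuous_on_compose2[OF cont]) (use neg_arg in \<open>auto intro!: continuous_intros\<close>)
  let ?F = "\<lambda>\<psi>. M - n (c + \<rho> * cos \<psi>)"
  have cF: "continuous_on {0..2*pi} ?F"
    by (intro continuous_intros continuous_on_compose2[OF ncont]) (use inab in auto)
  have F0: "0 \<le> ?F \<psi>" for \<psi> using max[OF inab] by (simp add: M_def)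
  have eqF: "?F \<psi> = (M + m a + s * (c - a)) + s * \<rho> * cos \<psi> - m (c + \<rho> * cos \<psi>)" for \<psi>
    by (simp add: n_def algebra_simps)
  define Q where "Q = M + m a + s * (c - a)"
  have "((\<lambda>\<psi>. Q + s * \<rho> * cos \<psi> - m (c + \<rho> * cos \<psi>)) has_integral
      (measure lborel {0..2*pi} *\<^sub>R Q + s * \<rho> * 0 - integral {0..2*pi} (\<lambda>\<psi>. m (c + \<rho> * cos \<psi>)))) {0..2*pi}"
    by (intro has_integral_diff has_integral_add has_integral_const_real has_integral_mult_right
        has_integral_cos_period integrable_integral integrable_continuous_real cm)
  then have "integral {0..2*pi} ?F = 2 * pi * Q - integral {0..2*pi} (\<lambda>\<psi>. m (c + \<rho> * cos \<psi>))"
    unfolding eqF Q_def[symmetric] by (simp add: integral_unique)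
  also have "\<dots> \<le> 2 * pi * Q - 2 * pi * m c"
    using mean[OF \<rho>(1,2)] by simp
  also have "\<dots> = 2 * pi * (M - n c)" by (simp add: n_def Q_def algebra_simps)
  finally have "integral {0..2*pi} ?F \<le> 0" using ncM by simp
  moreover have "0 \<le> integral {0..2*pi} ?F"
    using F0 by (intro integral_nonneg integrable_continuous_real cF) auto
  ultimately have "integral {0..2*pi} ?F = 0" by simp
  \<comment> \<open>A continuous nonnegative function with zero integral vanishes everywhere, in
    particular at the angle pi, where the argument is c - \<rho>.\<close>
  then have "?F pi = 0"
    using integral_eq_0_iff[OF cF] F0 pi_gt_zero by (simp del: cos_pi)
  then have "n (c - \<rho>) = M" by simp
  then have "c - \<rho> \<in> S" using inab[of pi] by (simp add: S_def)
  then show False using least[of "c - \<rho>"] \<rho> by simp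
qed

lemma chord_slope_le:
  fixes m :: "real \<Rightarrow> real"
  assumes chord: "\<And>a b c. a < b \<Longrightarrow> b < 0 \<Longrightarrow> a \<le> c \<Longrightarrow> c \<le> b \<Longrightarrow> m c \<le> m a + (m b - m a) / (b - a) * (c - a)"
    and xyz: "x < y" "y < z" "z < 0"
  shows "(m y - m x) / (y - x) \<le> (m z - m y) / (z - y)"
    and "(m y - m x) / (y - x) \<le> (m z - m x) / (z - x)"
    and "(m z - m x) / (z - x) \<le> (m z - m y) / (z - y)"
proof -
  define s where "s = (m z - m x) / (z - x)"
  have "m y \<le> m x + s * (y - x)" unfolding s_def using xyz by (intro chord) auto
  then show 2: "(m y - m x) / (y - x) \<le> (m z - m x) / (z - x)"
    unfolding s_def[symmetric] using xyz by (simp add: divide_le_eq)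
  have "s * (z - x) = m z - m x" using xyz by (simp add: s_def)
  then have "m z - m y \<ge> s * (z - y)" using \<open>m y \<le> m x + s * (y - x)\<close> by (simp add: algebra_simps)
  then show 3: "(m z - m x) / (z - x) \<le> (m z - m y) / (z - y)"
    unfolding s_def[symmetric] using xyz by (simp add: le_divide_eq)
  show "(m y - m x) / (y - x) \<le> (m z - m y) / (z - y)" using 2 3 by (rule order_trans)
qed

text \<open>Divided by t, the second difference is a right chord slope, increasing in t, minus a
  left one, decreasing in t.\<close>

lemma second_difference_mono:
  fixes m :: "real \<Rightarrow> real"
  assumes chord: "\<And>a b c. a < b \<Longrightarrow> b < 0 \<Longrightarrow> a \<le> c \<Longrightarrow> c \<le> b \<Longrightarrow> m c \<le> m a + (m b - m a) / (b - a) * (c - a)"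
    and t: "0 < t" "t \<le> u" "u < - x"
  shows "0 \<le> m (x + t) + m (x - t) - 2 * m x" "m (x + t) + m (x - t) - 2 * m x \<le> m (x + u) + m (x - u) - 2 * m x"
proof -
  note slope = chord_slope_le[OF chord]
  have "(m x - m (x - t)) / (x - (x - t)) \<le> (m (x + t) - m x) / (x + t - x)"
    using t by (intro slope) auto
  then have "(m x - m (x - t)) / t \<le> (m (x + t) - m x) / t" by simp
  then show nn: "0 \<le> m (x + t) + m (x - t) - 2 * m x" using t by (simp add: divide_le_cancel)
  show "m (x + t) + m (x - t) - 2 * m x \<le> m (x + u) + m (x - u) - 2 * m x"
  proof (cases "t = u")
    case False
    then have tu: "t < u" using t by simp
    have "(m (x + t) - m x) / (x + t - x) \<le> (m (x + u) - m x) / (x + u - x)" using t tu by (intro slope(2)) auto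
    then have 1: "(m (x + t) - m x) / t \<le> (m (x + u) - m x) / u" by simp
    have "(m x - m (x - u)) / (x - (x - u)) \<le> (m x - m (x - t)) / (x - (x - t))" using t tu by (intro slope(3)) auto
    then have 2: "(m x - m (x - u)) / u \<le> (m x - m (x - t)) / t" by simp
    define g where "g t = m (x + t) + m (x - t) - 2 * m x" for t
    have "g t / t = (m (x + t) - m x) / t - (m x - m (x - t)) / t" for t
      by (simp add: g_def add_divide_distrib diff_divide_distrib)
    then have "g t / t \<le> g u / u" using 1 2 by simp
    then have "g t \<le> g u / u * t" using t by (simp add: divide_le_eq)
    also have "\<dots> = g u * (t / u)" by simp
    also have "\<dots> \<le> g u"
    proof (rule mult_left_le)
      have "0 \<le> g t / t" using nn t by (simp add: g_def)
      then have "0 \<le> g u / u" using \<open>g t / t \<le> g u / u\<close> by linarith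
      then show "0 \<le> g u" using t by (simp add: zero_le_divide_iff)
      show "t / u \<le> 1" using t by simp
    qed
    finally show ?thesis by (simp add: g_def)
  qed simp
qed

text \<open>With chord slopes \<open>D k\<close> between the nodes \<open>x k\<close> of a geometric grid, the extrapolation of the chord to
  the end point \<open>0\<close> changes from one chord to the next by \<open>(D (k + 1) - D k) * \<bar>x (k + 1)\<bar>\<close>.\<close>

lemma convex_geometric_grid_bound:
  fixes m :: "real \<Rightarrow> real" and e :: "nat \<Rightarrow> real"
  assumes chord: "\<And>a b c. a < b \<Longrightarrow> b < 0 \<Longrightarrow> a \<le> c \<Longrightarrow> c \<le> b \<Longrightarrow> m c \<le> m a + (m b - m a) / (b - a) * (c - a)"
    and m0: "\<And>x. x < 0 \<Longrightarrow> 0 \<le> m x" and X: "0 < X"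
    and x: "\<And>k. x k = - X * (4 / 5) ^ k"
    and e: "\<And>k. 1 \<le> k \<Longrightarrow> m (x k + (- x k) / 4) + m (x k - (- x k) / 4) - 2 * m (x k) \<le> e k"
    and B: "m (x 0) \<le> B" "m (x 1) \<le> B"
  shows "m (x (Suc n)) \<le> 11 * B + 4 * (\<Sum>k=1..n. e k)"
proof -
  note slope = chord_slope_le[OF chord]
  have xneg: "x k < 0" for k using X by (simp add: x)
  have xs: "x (Suc k) = 4 / 5 * x k" for k by (simp add: x)
  define D where "D k = (m (x (Suc k)) - m (x k)) / (x (Suc k) - x k)" for k
  have incr: "x k < x (Suc k)" for k using xneg[of k] by (simp add: xs)
  have Dmono: "D k \<le> D (Suc k)" for k
    unfolding D_def using incr xneg by (intro slope(1)) auto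
  have Dstep: "(D (Suc k) - D k) * (- x (Suc k)) \<le> 4 * e (Suc k)" for k
  proof -
    \<comment> \<open>With ratio 4 / 5 the node to the left of \<open>y\<close> is exactly |y| / 4
      away, and the node to the right only 4 / 5 of that; lengthening the right chord to the same
      width can only raise its slope, which leaves a symmetric second difference.\<close>
    define y where "y = x (Suc k)"
    define \<delta> where "\<delta> = - y / 4"
    have \<delta>: "0 < \<delta>" "y + \<delta> < 0" using xneg[of "Suc k"] by (auto simp: \<delta>_def y_def)
    have xk: "x k = y - \<delta>" by (simp add: y_def \<delta>_def xs)
    have D_k: "D k = (m y - m (y - \<delta>)) / \<delta>" using \<delta> by (simp add: D_def xk y_def[symmetric])
    have xk2: "x (Suc (Suc k)) = y + 4 / 5 * \<delta>" by (simp add: xs[of "Suc k"] y_def[symmetric] \<delta>_def)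
    have "D (Suc k) = (m (y + 4/5 * \<delta>) - m y) / (y + 4/5 * \<delta> - y)"
      by (simp only: D_def xk2 y_def[symmetric])
    also have "\<dots> \<le> (m (y + \<delta>) - m y) / (y + \<delta> - y)"
      using \<delta> by (intro slope(2)) auto
    finally have "D (Suc k) \<le> (m (y + \<delta>) - m y) / \<delta>" by simp
    then have "D (Suc k) - D k \<le> (m (y + \<delta>) + m (y - \<delta>) - 2 * m y) / \<delta>"
      unfolding D_k by (simp add: add_divide_distrib diff_divide_distrib)
    also have "\<dots> \<le> e (Suc k) / \<delta>"
      using e[of "Suc k"] \<delta> by (intro divide_right_mono) (auto simp: \<delta>_def y_def)
    finally have "(D (Suc k) - D k) * (4 * \<delta>) \<le> e (Suc k) / \<delta> * (4 * \<delta>)" using \<delta> by (intro mult_right_mono) auto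
    then show ?thesis using \<delta> by (simp add: y_def[symmetric] \<delta>_def)
  qed
  define T where "T k = m (x k) + D k * (- x k)" for k
  have T_alt: "T k = m (x (Suc k)) + D k * (- x (Suc k))" for k
  proof -
    have "D k * (x (Suc k) - x k) = m (x (Suc k)) - m (x k)" using incr[of k] by (simp add: D_def)
    then show ?thesis by (simp add: T_def algebra_simps)
  qed
  have T_step: "T (Suc k) \<le> T k + 4 * e (Suc k)" for k
    using Dstep[of k] T_alt[of k] by (simp add: T_def algebra_simps)
  have T_sum: "T k \<le> T 0 + 4 * (\<Sum>j=1..k. e j)" for k
  proof (induction k)
    case (Suc k)
    then show ?case using T_step[of k] by simp
  qed simp
  have x0: "x 0 = - X" "x (Suc 0) - x 0 = X / 5" by (auto simp: x)
  \<comment> \<open>The first step has width X / 5, so extrapolation to 0 multiplies the difference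
    by 5, and \<open>T 0\<close> is at most 6 B.\<close>
  have "D 0 = (m (x 1) - m (x 0)) / (X / 5)" unfolding D_def x0(2) by simp
  then have D0: "D 0 * X = 5 * (m (x 1) - m (x 0))" using X by simp
  have T0: "T 0 \<le> 6 * B" using D0 B m0[OF xneg[of 0]] by (simp add: T_def x0)
  \<comment> \<open>Slopes increase, so a negative slope is at worst D 0, whose contribution is at
    most 5 B; together with the 6 B for \<open>T 0\<close> this gives the constant 11.\<close>
  have "D 0 \<le> D n" by (induction n) (use Dmono order_trans in auto)
  then have "- D n * (- x (Suc n)) \<le> - D 0 * (- x (Suc n))" using xneg[of "Suc n"] by (intro mult_right_mono) auto
  also have "- D 0 * (- x (Suc n)) \<le> 5 * B"
  proof (cases "0 \<le> D 0")
    case True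
    then have "- D 0 * (- x (Suc n)) \<le> 0" using xneg[of "Suc n"] by (intro mult_nonpos_nonneg) auto
    also have "0 \<le> 5 * B" using B m0[OF xneg[of 0]] by linarith
    finally show ?thesis .
  next
    case False
    have "(4 / 5 :: real) ^ Suc n \<le> 1" by (intro power_le_one) auto
    then have "- x (Suc n) \<le> X" using X unfolding x by (simp add: mult_left_le del: power_Suc)
    then have "- D 0 * (- x (Suc n)) \<le> - D 0 * X" using False by (intro mult_left_mono) auto
    also have "\<dots> \<le> 5 * B" using D0 B m0[OF xneg[of 1]] by simp
    finally show ?thesis .
  qed
  finally have "- D n * (- x (Suc n)) \<le> 5 * B" .
  then show ?thesis using T_alt[of n] T_sum[of n] T0 by (simp add: algebra_simps)
qed

subsection \<open>Circular means in logarithmic coordinates\<close>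

lemma nn_integral_Icc_continuous:
  fixes v :: "real \<Rightarrow> real"
  assumes c: "continuous_on {a..b} v" and v: "\<And>x. x \<in> {a..b} \<Longrightarrow> 0 \<le> v x"
  shows "(\<integral>\<^sup>+x\<in>{a..b}. ennreal (v x) \<partial>lborel) = ennreal (integral {a..b} v)"
proof -
  have "((\<lambda>x. if x \<in> {a..b} then v x else 0) has_integral integral {a..b} v) UNIV"
    using integrable_integral[OF integrable_continuous_real[OF c]] by (subst has_integral_restrict_UNIV)
  then have "((\<lambda>x. indicator {a..b} x *\<^sub>R v x) has_integral integral {a..b} v) UNIV"
    by (rule has_integral_eq[rotated]) (auto simp: indicator_def)
  then have "(\<integral>\<^sup>+x. ennreal (indicator {a..b} x *\<^sub>R v x) \<partial>lborel) = ennreal (integral {a..b} v)"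
    using v by (intro nn_integral_has_integral_lborel borel_measurable_continuous_on_indicator c) (auto simp: indicator_def)
  moreover have "(\<integral>\<^sup>+x. ennreal (indicator {a..b} x *\<^sub>R v x) \<partial>lborel) = (\<integral>\<^sup>+x\<in>{a..b}. ennreal (v x) \<partial>lborel)"
    by (rule nn_integral_cong) (auto simp: indicator_def)
  ultimately show ?thesis by simp
qed

lemma exp_Complex: "exp (Complex x t) = of_real (exp x) * cis t"
  by (simp add: exp_eq_polar exp_of_real)

text \<open>When the centre runs along the vertical line Re = x, the point of the circle at angle
  \<psi> runs along the line Re = x + \<rho> cos \<psi>, displaced by \<rho> sin \<psi>; periodicity
  absorbs the displacement.\<close>

lemma nn_integral_circle_swap:
  fixes v :: "complex \<Rightarrow> ennreal"
  assumes v [measurable]: "v \<in> borel_measurable borel" and per: "\<And>w. v (w + \<i> * of_real (2 * pi)) = v w"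
  shows "(\<integral>\<^sup>+\<theta>\<in>{0..2*pi}. (\<integral>\<^sup>+\<psi>\<in>{0..2*pi}. v (Complex x \<theta> + of_real \<rho> * cis \<psi>) \<partial>lborel) \<partial>lborel) =
    (\<integral>\<^sup>+\<psi>\<in>{0..2*pi}. (\<integral>\<^sup>+\<theta>\<in>{0..2*pi}. v (Complex (x + \<rho> * cos \<psi>) \<theta>) \<partial>lborel) \<partial>lborel)"
proof -
  have [measurable]: "cis \<in> borel_measurable borel" "(\<lambda>\<theta>. Complex y \<theta>) \<in> borel_measurable borel" for y
    by (auto simp: Complex_eq intro!: borel_measurable_continuous_onI continuous_intros)
  have "(\<integral>\<^sup>+\<theta>\<in>{0..2*pi}. (\<integral>\<^sup>+\<psi>\<in>{0..2*pi}. v (Complex x \<theta> + of_real \<rho> * cis \<psi>) \<partial>lborel) \<partial>lborel) =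
      (\<integral>\<^sup>+\<theta>. (\<integral>\<^sup>+\<psi>. v (Complex x \<theta> + of_real \<rho> * cis \<psi>) * indicator {0..2*pi} \<psi> * indicator {0..2*pi} \<theta> \<partial>lborel) \<partial>lborel)"
    by (subst nn_integral_multc) auto
  also have "\<dots> = (\<integral>\<^sup>+\<psi>. (\<integral>\<^sup>+\<theta>. v (Complex x \<theta> + of_real \<rho> * cis \<psi>) * indicator {0..2*pi} \<psi> * indicator {0..2*pi} \<theta> \<partial>lborel) \<partial>lborel)"
    by (rule lborel_pair.Fubini'[symmetric]) measurable
  also have "\<dots> = (\<integral>\<^sup>+\<psi>\<in>{0..2*pi}. (\<integral>\<^sup>+\<theta>\<in>{0..2*pi}. v (Complex (x + \<rho> * cos \<psi>) \<theta>) \<partial>lborel) \<partial>lborel)"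
  proof (rule nn_integral_cong)
    fix \<psi>
    let ?f = "\<lambda>\<theta>. v (Complex (x + \<rho> * cos \<psi>) \<theta>)"
    have f: "?f \<in> borel_measurable borel" by measurable
    have eq: "v (Complex x \<theta> + of_real \<rho> * cis \<psi>) = ?f (\<theta> + \<rho> * sin \<psi>)" for \<theta>
      by (rule arg_cong[where f=v]) (simp add: complex_eq_iff)
    have "?f (\<theta> + 2 * pi) = ?f \<theta>" for \<theta>
    proof -
      have "Complex (x + \<rho> * cos \<psi>) (\<theta> + 2 * pi) = Complex (x + \<rho> * cos \<psi>) \<theta> + \<i> * of_real (2 * pi)"
        by (simp add: complex_eq_iff)
      then show ?thesis by (simp only: per)
    qed
    then have shift: "(\<integral>\<^sup>+\<theta>\<in>{0..2*pi}. ?f (\<theta> + \<rho> * sin \<psi>) \<partial>lborel) = (\<integral>\<^sup>+\<theta>\<in>{0..2*pi}. ?f \<theta> \<partial>lborel)"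
      by (intro nn_integral_periodic_shift f) auto
    have "(\<integral>\<^sup>+\<theta>. v (Complex x \<theta> + of_real \<rho> * cis \<psi>) * indicator {0..2*pi} \<psi> * indicator {0..2*pi} \<theta> \<partial>lborel)
      = (\<integral>\<^sup>+\<theta>. (?f (\<theta> + \<rho> * sin \<psi>) * indicator {0..2*pi} \<theta>) * indicator {0..2*pi} \<psi> \<partial>lborel)"
      by (rule nn_integral_cong) (subst eq, simp only: mult_ac)
    also have "\<dots> = (\<integral>\<^sup>+\<theta>\<in>{0..2*pi}. ?f (\<theta> + \<rho> * sin \<psi>) \<partial>lborel) * indicator {0..2*pi} \<psi>"
      by (rule nn_integral_multc) measurable
    finally show "(\<integral>\<^sup>+\<theta>. v (Complex x \<theta> + of_real \<rho> * cis \<psi>) * indicator {0..2*pi} \<psi> * indicator {0..2*pi} \<theta> \<partial>lborel) =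
      (\<integral>\<^sup>+\<theta>\<in>{0..2*pi}. ?f \<theta> \<partial>lborel) * indicator {0..2*pi} \<psi>"
      by (simp only: shift)
  qed
  finally show ?thesis .
qed

lemma nn_integral_Icc_mono: "(\<And>x. x \<in> A \<Longrightarrow> u x \<le> v x) \<Longrightarrow> (\<integral>\<^sup>+x\<in>A. u x \<partial>M) \<le> (\<integral>\<^sup>+x\<in>A. (v x :: ennreal) \<partial>M)"
  by (rule nn_integral_mono) (auto simp: indicator_def)

locale disc_function =
  fixes h :: "complex \<Rightarrow> complex" and p :: real
  assumes hol: "h holomorphic_on unit_disc" and p: "1 < p" "p \<le> 2"
begin

definition m :: "real \<Rightarrow> real"
  where "m x = integral {0..2 * pi} (\<lambda>\<theta>. norm (h (of_real (exp x) * cis \<theta>)) powr p)"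

lemma h_cont: "continuous_on unit_disc h"
  by (rule holomorphic_on_imp_continuous_on[OF hol])

lemma dh_hol: "deriv h holomorphic_on unit_disc"
  by (intro holomorphic_deriv hol) auto

lemma circle_cont: "x < 0 \<Longrightarrow> continuous_on A (\<lambda>\<theta>. norm (h (of_real (exp x) * cis \<theta>)) powr p)"
  using p by (intro continuous_on_powr' continuous_intros continuous_on_compose2[OF h_cont]) (auto simp: norm_mult)

lemma circ_int_eq_m: "x < 0 \<Longrightarrow> circ_int p (exp x) h = ennreal (m x)"
  unfolding circ_int_def m_def using nn_integral_Icc_continuous[OF circle_cont] by simp

lemma m_nonneg: "x < 0 \<Longrightarrow> 0 \<le> m x"
  unfolding m_def by (intro integral_nonneg integrable_continuous_real circle_cont) auto

lemma m_cont: "continuous_on {..<0} m"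
proof -
  have "continuous_on ({..<0} \<times> cbox 0 (2 * pi)) (\<lambda>(x, \<theta>). norm (h (of_real (exp x) * cis \<theta>)) powr p)"
    unfolding case_prod_unfold using p
    by (intro continuous_on_powr' continuous_intros continuous_on_compose2[OF h_cont]) (auto simp: norm_mult)
  then have "continuous_on {..<0} (\<lambda>x. integral (cbox 0 (2 * pi)) (\<lambda>\<theta>. norm (h (of_real (exp x) * cis \<theta>)) powr p))"
    by (rule integral_continuous_on_param)
  then show ?thesis by (simp add: m_def[abs_def])
qed

text \<open>The lift of h to the left half plane: circles of radius exp x become periods of the
  vertical line Re = x. The cutoff only serves measurability off the half plane.\<close>

definition H :: "complex \<Rightarrow> complex" where "H w = cutoff h (exp w)"

lemma exp_in_disc: "Re w < 0 \<Longrightarrow> exp w \<in> unit_disc"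
  by simp

lemma H_eq: "Re w < 0 \<Longrightarrow> H w = h (exp w)"
  by (simp add: H_def cutoff_def)

lemma H_measurable [measurable]: "H \<in> borel_measurable borel"
proof -
  have [measurable]: "cutoff h \<in> borel_measurable borel"
    unfolding cutoff_def by (rule borel_measurable_disc_cutoff[OF h_cont])
  have [measurable]: "(exp :: complex \<Rightarrow> complex) \<in> borel_measurable borel"
    by (intro borel_measurable_continuous_onI continuous_intros)
  show ?thesis unfolding H_def by measurable
qed

lemma H_periodic: "H (w + \<i> * of_real (2 * pi)) = H w"
proof -
  have "exp (\<i> * of_real (2 * pi)) = (1 :: complex)" using cis_2pi by (simp only: cis_conv_exp)
  then show ?thesis by (simp only: H_def exp_add mult_1_right)
qed

lemma nn_integral_H_eq_m:
  assumes "x < 0"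
  shows "(\<integral>\<^sup>+\<theta>\<in>{0..2*pi}. ennreal (norm (H (Complex x \<theta>)) powr p) \<partial>lborel) = ennreal (m x)"
  using assms circ_int_eq_m[OF assms] by (simp add: H_eq exp_Complex circ_int_def)

lemma cos_arg_neg:
  fixes x \<rho> \<psi> :: real
  assumes "0 < \<rho>" "\<rho> < - x"
  shows "x + \<rho> * cos \<psi> < 0"
proof -
  have "\<rho> * cos \<psi> \<le> \<rho>" using assms by (intro mult_left_le) auto
  then show ?thesis using assms by linarith
qed

lemma nn_integral_H_circles_eq:
  assumes "0 < \<rho>" "\<rho> < - x"
  shows "(\<integral>\<^sup>+\<theta>\<in>{0..2*pi}. (\<integral>\<^sup>+\<psi>\<in>{0..2*pi}. ennreal (norm (H (Complex x \<theta> + of_real \<rho> * cis \<psi>)) powr p) \<partial>lborel) \<partial>lborel) =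
    (\<integral>\<^sup>+\<psi>\<in>{0..2*pi}. ennreal (m (x + \<rho> * cos \<psi>)) \<partial>lborel)"
proof -
  have "(\<lambda>w. ennreal (norm (H w) powr p)) \<in> borel_measurable borel" by measurable
  from nn_integral_circle_swap[OF this, of x \<rho>] show ?thesis
    by (simp only: H_periodic nn_integral_H_eq_m cos_arg_neg[OF assms])
qed

lemma circle_mean_H:
  assumes w: "Re w = x" and \<rho>: "0 < \<rho>" "\<rho> < - x"
  shows "continuous_on UNIV (\<lambda>t. H (w + of_real \<rho> * cis t))"
    and "of_real (2 * pi) * H w = (LINT t|arc. H (w + of_real \<rho> * cis t))"
proof -
  define R where "R = - x / \<rho>"
  have R: "1 < R" unfolding R_def using \<rho> by (subst pos_less_divide_eq) auto
  have neg: "Re (w + of_real \<rho> * \<zeta>) < 0" if "norm \<zeta> < R" for \<zeta>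
  proof -
    have "\<rho> * Re \<zeta> \<le> \<rho> * norm \<zeta>" using \<rho> complex_Re_le_cmod by (intro mult_left_mono) auto
    also have "\<dots> < \<rho> * R" using that \<rho> by simp
    finally show ?thesis using \<rho> by (simp add: w R_def)
  qed
  have k: "(\<lambda>\<zeta>. h (exp (w + of_real \<rho> * \<zeta>))) holomorphic_on ball 0 R"
    by (rule holomorphic_on_compose_gen[OF _ hol, unfolded o_def])
      (intro holomorphic_intros, use neg exp_in_disc in \<open>auto simp del: norm_exp_eq_Re\<close>)
  have eq: "H (w + of_real \<rho> * \<zeta>) = h (exp (w + of_real \<rho> * \<zeta>))" if "norm \<zeta> < R" for \<zeta>
    using H_eq[OF neg[OF that]] .
  have "continuous_on UNIV (\<lambda>t. h (exp (w + of_real \<rho> * cis t)))"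
    by (rule continuous_on_compose2[OF holomorphic_on_imp_continuous_on[OF k]])
      (use R in \<open>auto intro!: continuous_intros\<close>)
  then show "continuous_on UNIV (\<lambda>t. H (w + of_real \<rho> * cis t))"
    using eq R by simp
  have "(\<lambda>t. h (exp (w + of_real \<rho> * cis t)) * (cis t / (cis t - 0) ^ Suc 0)) = (\<lambda>t. H (w + of_real \<rho> * cis t))"
    using eq R by auto
  then show "of_real (2 * pi) * H w = (LINT t|arc. H (w + of_real \<rho> * cis t))"
    using higher_deriv_unit_circle[OF k R, of 0 0] eq[of 0] R by simp
qed

text \<open>The lift has the mean value property, so Jensen's inequality makes |H|^p sub-mean over
  circles; averaging over the centres on a vertical line turns this into a statement about
  \<open>m\<close> alone.\<close>

lemma m_submean:
  assumes \<rho>: "0 < \<rho>" "\<rho> < - x"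
  shows "ennreal (2 * pi * m x) \<le> (\<integral>\<^sup>+\<psi>\<in>{0..2*pi}. ennreal (m (x + \<rho> * cos \<psi>)) \<partial>lborel)"
proof -
  have x: "x < 0" using \<rho> by simp
  have pt: "ennreal (2 * pi) * ennreal (norm (H (Complex x \<theta>)) powr p) \<le> (\<integral>\<^sup>+\<psi>\<in>{0..2*pi}. ennreal (norm (H (Complex x \<theta> + of_real \<rho> * cis \<psi>)) powr p) \<partial>lborel)" for \<theta>
  proof -
    let ?f = "\<lambda>t. H (Complex x \<theta> + of_real \<rho> * cis t)"
    have c: "continuous_on UNIV ?f" by (rule circle_mean_H(1)[OF _ \<rho>]) simp
    have fm [measurable]: "?f \<in> borel_measurable borel" by (rule borel_measurable_continuous_onI[OF c])
    have "of_real (2 * pi) * H (Complex x \<theta>) = integral\<^sup>L arc ?f" by (rule circle_mean_H(2)[OF _ \<rho>]) simp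
    then have "ennreal (norm (of_real (2 * pi) * H (Complex x \<theta>))) \<le> (\<integral>\<^sup>+t. ennreal (norm (?f t) * 1) \<partial>arc)"
      using integral_norm_bound_ennreal[OF arc_integral_continuous(1)[OF c]] by simp
    then have "ennreal (norm (of_real (2 * pi) * H (Complex x \<theta>)) powr p) \<le> ennreal ((2 * pi) powr (p - 1)) * (\<integral>\<^sup>+t. ennreal (norm (?f t) powr p * 1) \<partial>arc)"
      using p emeasure_arc by (intro jensen_powr_nn_integral) auto
    also have "(\<integral>\<^sup>+t. ennreal (norm (?f t) powr p * 1) \<partial>arc) = (\<integral>\<^sup>+\<psi>\<in>{0..2*pi}. ennreal (norm (?f \<psi>) powr p) \<partial>lborel)"
      by (subst nn_integral_arc) (auto, measurable)
    also have "norm (of_real (2 * pi) * H (Complex x \<theta>)) powr p = (2 * pi) powr (p - 1) * (2 * pi * norm (H (Complex x \<theta>)) powr p)"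
    proof -
      have "(2 * pi) powr p = (2 * pi) powr (p - 1) * (2 * pi)" using powr_add[of "2 * pi" "p - 1" 1] by simp
      then show ?thesis by (simp add: norm_mult powr_mult del: powr_mult_base)
    qed
    finally have "ennreal ((2 * pi) powr (p - 1)) * ennreal (2 * pi * norm (H (Complex x \<theta>)) powr p) \<le> ennreal ((2 * pi) powr (p - 1)) * (\<integral>\<^sup>+\<psi>\<in>{0..2*pi}. ennreal (norm (?f \<psi>) powr p) \<partial>lborel)"
      by (simp only: ennreal_mult' powr_ge_zero)
    then have "ennreal (2 * pi * norm (H (Complex x \<theta>)) powr p) \<le> (\<integral>\<^sup>+\<psi>\<in>{0..2*pi}. ennreal (norm (?f \<psi>) powr p) \<partial>lborel)"
      by (subst (asm) ennreal_mult_le_mult_iff) auto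
    then show ?thesis by (simp add: ennreal_mult')
  qed
  have [measurable]: "(\<lambda>\<theta>. Complex x \<theta>) \<in> borel_measurable borel"
    by (auto simp: Complex_eq intro!: borel_measurable_continuous_onI continuous_intros)
  have "ennreal (2 * pi * m x) = ennreal (2 * pi) * (\<integral>\<^sup>+\<theta>\<in>{0..2*pi}. ennreal (norm (H (Complex x \<theta>)) powr p) \<partial>lborel)"
    using x m_nonneg[OF x] by (simp add: nn_integral_H_eq_m ennreal_mult'[symmetric])
  also have "\<dots> = (\<integral>\<^sup>+\<theta>. ennreal (2 * pi) * (ennreal (norm (H (Complex x \<theta>)) powr p) * indicator {0..2*pi} \<theta>) \<partial>lborel)"
    by (rule nn_integral_cmult[symmetric]) measurable
  also have "\<dots> \<le> (\<integral>\<^sup>+\<theta>\<in>{0..2*pi}. (\<integral>\<^sup>+\<psi>\<in>{0..2*pi}. ennreal (norm (H (Complex x \<theta> + of_real \<rho> * cis \<psi>)) powr p) \<partial>lborel) \<partial>lborel)"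
    unfolding mult.assoc[symmetric] by (intro nn_integral_Icc_mono pt)
  also have "\<dots> = (\<integral>\<^sup>+\<psi>\<in>{0..2*pi}. ennreal (m (x + \<rho> * cos \<psi>)) \<partial>lborel)" by (rule nn_integral_H_circles_eq[OF \<rho>])
  finally show ?thesis .
qed

lemma m_chord:
  assumes "a < b" "b < 0" "a \<le> c" "c \<le> b"
  shows "m c \<le> m a + (m b - m a) / (b - a) * (c - a)"
proof (rule convex_on_if_cos_mean[OF m_cont _ assms])
  fix x \<rho> :: real assume \<rho>: "0 < \<rho>" "\<rho> < - x"
  have c: "continuous_on {0..2*pi} (\<lambda>\<psi>. m (x + \<rho> * cos \<psi>))"
    by (rule continuous_on_compose2[OF m_cont]) (use cos_arg_neg[OF \<rho>] in \<open>auto intro!: continuous_intros\<close>)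
  have "ennreal (2 * pi * m x) \<le> ennreal (integral {0..2*pi} (\<lambda>\<psi>. m (x + \<rho> * cos \<psi>)))"
    using m_submean[OF \<rho>] nn_integral_Icc_continuous[OF c] m_nonneg[OF cos_arg_neg[OF \<rho>]] by simp
  moreover have "0 \<le> integral {0..2*pi} (\<lambda>\<psi>. m (x + \<rho> * cos \<psi>))"
    by (intro integral_nonneg integrable_continuous_real c m_nonneg cos_arg_neg[OF \<rho>])
  ultimately show "2 * pi * m x \<le> integral {0..2*pi} (\<lambda>\<psi>. m (x + \<rho> * cos \<psi>))"
    by (simp only: ennreal_le_iff)
qed


text \<open>The increment is the integral of the derivative along a segment. Jensen's inequality in
  the parameter s and Tonelli reduce it to means of h' over vertical lines, that is over circles of
  radius at most exp (x + \<rho>).\<close>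

lemma H_increment:
  assumes \<rho>: "0 < \<rho>" "\<rho> < - x" and \<zeta>: "norm \<zeta> = 1"
    and \<Psi>: "\<And>r. 0 < r \<Longrightarrow> r \<le> exp (x + \<rho>) \<Longrightarrow> circ_int p r (deriv h) \<le> ennreal P"
  shows "(\<integral>\<^sup>+\<theta>\<in>{0..2*pi}. ennreal (norm (H (Complex x \<theta> + of_real \<rho> * \<zeta>) - H (Complex x \<theta>)) powr p) \<partial>lborel) \<le> ennreal (\<rho> powr p * P)"
proof -
  define G where "G w = cutoff (deriv h) (exp w)" for w
  have [measurable]: "cutoff (deriv h) \<in> borel_measurable borel"
    unfolding cutoff_def by (rule borel_measurable_disc_cutoff[OF holomorphic_on_imp_continuous_on[OF dh_hol]])
  have [measurable]: "(exp :: complex \<Rightarrow> complex) \<in> borel_measurable borel" "(\<lambda>\<theta>. Complex y \<theta>) \<in> borel_measurable borel" for y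
    by (auto simp: Complex_eq intro!: borel_measurable_continuous_onI continuous_intros)
  have Gm [measurable]: "G \<in> borel_measurable borel" unfolding G_def by measurable
  have G_per: "G (w + \<i> * of_real (2 * pi)) = G w" for w
  proof -
    have "exp (\<i> * of_real (2 * pi)) = (1 :: complex)" using cis_2pi by (simp only: cis_conv_exp)
    then show ?thesis by (simp only: G_def exp_add mult_1_right)
  qed
  have re: "\<bar>Re \<zeta>\<bar> \<le> 1" using abs_Re_le_cmod[of \<zeta>] \<zeta> by simp
  have s_le: "x + s * (\<rho> * Re \<zeta>) \<le> x + \<rho>" if "s \<in> {0..1}" for s
  proof -
    have "s * (\<rho> * Re \<zeta>) \<le> s * (\<rho> * 1)" using that \<rho> re by (intro mult_left_mono) auto
    also have "\<dots> \<le> \<rho>" using that \<rho> by (simp add: mult_left_le_one_le)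
    finally show ?thesis by simp
  qed
  have pt: "ennreal (norm (H (Complex x \<theta> + of_real \<rho> * \<zeta>) - H (Complex x \<theta>)) powr p) \<le>
      ennreal (\<rho> powr p) * (\<integral>\<^sup>+s\<in>{0..1}. ennreal (norm (G (Complex x \<theta> + of_real s * (of_real \<rho> * \<zeta>))) powr p) \<partial>lborel)" for \<theta>
  proof -
    define w where "w = Complex x \<theta>"
    define \<eta> where "\<eta> = of_real \<rho> * \<zeta>"
    have neg: "Re (w + of_real s * \<eta>) < 0" if "s \<in> {0..1}" for s
    proof -
      have "x + s * (\<rho> * Re \<zeta>) < 0" using s_le[OF that] \<rho> by linarith
      then show ?thesis by (simp add: w_def \<eta>_def)
    qed
    let ?q = "\<lambda>s. h (exp (w + of_real s * \<eta>))"
    let ?q' = "\<lambda>s. deriv h (exp (w + of_real s * \<eta>)) * (exp (w + of_real s * \<eta>) * \<eta>)"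
    have der: "(?q has_vector_derivative ?q' s) (at s within {0..1})" if s: "s \<in> {0..1}" for s
    proof -
      have "(h has_field_derivative deriv h (exp (w + of_real s * \<eta>))) (at (exp (w + of_real s * \<eta>)))"
        using exp_in_disc[OF neg[OF s]] by (intro holomorphic_derivI[OF hol]) auto
      moreover have "((\<lambda>s. exp (w + s * \<eta>)) has_field_derivative exp (w + of_real s * \<eta>) * \<eta>) (at (of_real s))"
        by (auto intro!: derivative_eq_intros)
      ultimately have "((\<lambda>s. h (exp (w + s * \<eta>))) has_field_derivative ?q' s) (at (of_real s))"
        by (rule DERIV_chain2)
      from has_vector_derivative_real_field[OF this] show ?thesis .
    qed
    have cq: "continuous_on {0..1} ?q'"
      by (intro continuous_intros continuous_on_compose2[OF holomorphic_on_imp_continuous_on[OF dh_hol]])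
        (use exp_in_disc[OF neg] in auto)
    have "(?q' has_integral (?q 1 - ?q 0)) {0..1}"
      by (rule fundamental_theorem_of_calculus) (use der in auto)
    then have "norm (?q 1 - ?q 0) = norm (integral {0..1} ?q')" by (simp add: integral_unique)
    also have "\<dots> \<le> integral {0..1} (\<lambda>s. norm (?q' s))"
      by (intro integral_norm_bound_integral integrable_continuous_real cq continuous_on_norm[OF cq]) auto
    finally have "ennreal (norm (?q 1 - ?q 0)) \<le> ennreal (integral {0..1} (\<lambda>s. norm (?q' s)))" by (rule ennreal_leI)
    also have "\<dots> = (\<integral>\<^sup>+s\<in>{0..1}. ennreal (norm (?q' s)) \<partial>lborel)"
      by (intro nn_integral_Icc_continuous[symmetric] continuous_on_norm[OF cq]) auto
    also have "\<dots> \<le> (\<integral>\<^sup>+s. ennreal (\<rho> * norm (G (w + of_real s * \<eta>)) * indicator {0..1} s) \<partial>lborel)"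
    proof (rule nn_integral_mono)
      fix s :: real
      show "ennreal (norm (?q' s)) * indicator {0..1} s \<le> ennreal (\<rho> * norm (G (w + of_real s * \<eta>)) * indicator {0..1} s)"
      proof (cases "s \<in> {0..1}")
        case True
        \<comment> \<open>The inner derivative of the lift is bounded by 1 in the left half
          plane.\<close>
        have "norm (exp (w + of_real s * \<eta>)) \<le> 1" using exp_in_disc[OF neg[OF True]] by simp
        then have "norm (exp (w + of_real s * \<eta>) * \<eta>) \<le> \<rho>" using \<rho> \<zeta>
          by (simp add: norm_mult \<eta>_def mult_left_le_one_le)
        then have le: "norm (?q' s) \<le> norm (deriv h (exp (w + of_real s * \<eta>))) * \<rho>"
          by (subst norm_mult, intro mult_left_mono) auto
        have "deriv h (exp (w + of_real s * \<eta>)) = G (w + of_real s * \<eta>)"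
          using exp_in_disc[OF neg[OF True]] by (simp add: G_def cutoff_def)
        then have "norm (deriv h (exp (w + of_real s * \<eta>))) * \<rho> = \<rho> * norm (G (w + of_real s * \<eta>))" by simp
        then show ?thesis using True ennreal_leI[OF le] by (simp only: indicator_simps mult_1_right)
      qed simp
    qed
    finally have "ennreal (norm (?q 1 - ?q 0)) \<le> (\<integral>\<^sup>+s. ennreal (\<rho> * norm (G (w + of_real s * \<eta>)) * indicator {0..1} s) \<partial>lborel)" .
    then have "ennreal (norm (?q 1 - ?q 0) powr p) \<le> ennreal (1 powr (p - 1)) * (\<integral>\<^sup>+s. ennreal ((\<rho> * norm (G (w + of_real s * \<eta>))) powr p * indicator {0..1} s) \<partial>lborel)"
      using p \<rho> by (intro jensen_powr_nn_integral) (auto simp: ennreal_indicator)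
    also have "(\<integral>\<^sup>+s. ennreal ((\<rho> * norm (G (w + of_real s * \<eta>))) powr p * indicator {0..1} s) \<partial>lborel) =
        (\<integral>\<^sup>+s. ennreal (\<rho> powr p) * (ennreal (norm (G (w + of_real s * \<eta>)) powr p) * indicator {0..1} s) \<partial>lborel)"
      by (rule nn_integral_cong) (auto simp: powr_mult ennreal_mult' indicator_def)
    also have "\<dots> = ennreal (\<rho> powr p) * (\<integral>\<^sup>+s\<in>{0..1}. ennreal (norm (G (w + of_real s * \<eta>)) powr p) \<partial>lborel)"
      by (rule nn_integral_cmult) measurable
    finally have "ennreal (norm (?q 1 - ?q 0) powr p) \<le> ennreal (\<rho> powr p) * (\<integral>\<^sup>+s\<in>{0..1}. ennreal (norm (G (w + of_real s * \<eta>)) powr p) \<partial>lborel)" by simp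
    moreover have "H (w + \<eta>) = ?q 1" "H w = ?q 0"
      using H_eq[OF neg[of 1]] H_eq[OF neg[of 0]] by simp_all
    ultimately show ?thesis by (simp only: w_def[symmetric] \<eta>_def[symmetric])
  qed
  have inner: "(\<integral>\<^sup>+\<theta>\<in>{0..2*pi}. ennreal (norm (G (Complex x \<theta> + of_real s * (of_real \<rho> * \<zeta>))) powr p) \<partial>lborel) \<le> ennreal P" if s: "s \<in> {0..1}" for s
  proof -
    define y where "y = x + s * (\<rho> * Re \<zeta>)"
    have y: "y \<le> x + \<rho>" "y < 0" using s_le[OF s] \<rho> unfolding y_def by linarith+
    let ?f = "\<lambda>\<theta>. ennreal (norm (G (Complex y \<theta>)) powr p)"
    have f: "?f \<in> borel_measurable borel" by measurable
    have eq: "Complex x \<theta> + of_real s * (of_real \<rho> * \<zeta>) = Complex y (\<theta> + s * (\<rho> * Im \<zeta>))" for \<theta>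
      by (simp add: complex_eq_iff y_def)
    have per: "?f (\<theta> + 2 * pi) = ?f \<theta>" for \<theta>
    proof -
      have "Complex y (\<theta> + 2 * pi) = Complex y \<theta> + \<i> * of_real (2 * pi)" by (simp add: complex_eq_iff)
      then show ?thesis by (simp only: G_per)
    qed
    have "(\<integral>\<^sup>+\<theta>\<in>{0..2*pi}. ennreal (norm (G (Complex x \<theta> + of_real s * (of_real \<rho> * \<zeta>))) powr p) \<partial>lborel) =
        (\<integral>\<^sup>+\<theta>\<in>{0..2*pi}. ?f (\<theta> + s * (\<rho> * Im \<zeta>)) \<partial>lborel)" by (simp only: eq)
    also have "\<dots> = (\<integral>\<^sup>+\<theta>\<in>{0..2*pi}. ?f \<theta> \<partial>lborel)"
      by (rule nn_integral_periodic_shift[OF f _ per]) simp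
    also have "\<dots> = circ_int p (exp y) (deriv h)"
      using y unfolding circ_int_def G_def by (simp add: exp_Complex cutoff_def norm_mult)
    also have "\<dots> \<le> ennreal P" using y by (intro \<Psi>) auto
    finally show ?thesis .
  qed
  have "(\<integral>\<^sup>+\<theta>\<in>{0..2*pi}. ennreal (norm (H (Complex x \<theta> + of_real \<rho> * \<zeta>) - H (Complex x \<theta>)) powr p) \<partial>lborel) \<le>
      (\<integral>\<^sup>+\<theta>. ennreal (\<rho> powr p) * (\<integral>\<^sup>+s. ennreal (norm (G (Complex x \<theta> + of_real s * (of_real \<rho> * \<zeta>))) powr p) * indicator {0..1} s * indicator {0..2*pi} \<theta> \<partial>lborel) \<partial>lborel)"
  proof (rule nn_integral_mono)
    fix \<theta>
    show "ennreal (norm (H (Complex x \<theta> + of_real \<rho> * \<zeta>) - H (Complex x \<theta>)) powr p) * indicator {0..2*pi} \<theta> \<le>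
      ennreal (\<rho> powr p) * (\<integral>\<^sup>+s. ennreal (norm (G (Complex x \<theta> + of_real s * (of_real \<rho> * \<zeta>))) powr p) * indicator {0..1} s * indicator {0..2*pi} \<theta> \<partial>lborel)"
      using pt[of \<theta>] by (cases "\<theta> \<in> {0..2*pi}") simp_all
  qed
  also have "\<dots> = ennreal (\<rho> powr p) * (\<integral>\<^sup>+\<theta>. (\<integral>\<^sup>+s. ennreal (norm (G (Complex x \<theta> + of_real s * (of_real \<rho> * \<zeta>))) powr p) * indicator {0..1} s * indicator {0..2*pi} \<theta> \<partial>lborel) \<partial>lborel)"
    by (rule nn_integral_cmult) measurable
  also have "(\<integral>\<^sup>+\<theta>. (\<integral>\<^sup>+s. ennreal (norm (G (Complex x \<theta> + of_real s * (of_real \<rho> * \<zeta>))) powr p) * indicator {0..1} s * indicator {0..2*pi} \<theta> \<partial>lborel) \<partial>lborel) =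
      (\<integral>\<^sup>+s. (\<integral>\<^sup>+\<theta>. ennreal (norm (G (Complex x \<theta> + of_real s * (of_real \<rho> * \<zeta>))) powr p) * indicator {0..1} s * indicator {0..2*pi} \<theta> \<partial>lborel) \<partial>lborel)"
    by (rule lborel_pair.Fubini'[symmetric]) measurable
  finally have le: "(\<integral>\<^sup>+\<theta>\<in>{0..2*pi}. ennreal (norm (H (Complex x \<theta> + of_real \<rho> * \<zeta>) - H (Complex x \<theta>)) powr p) \<partial>lborel) \<le>
     ennreal (\<rho> powr p) * (\<integral>\<^sup>+s. (\<integral>\<^sup>+\<theta>. ennreal (norm (G (Complex x \<theta> + of_real s * (of_real \<rho> * \<zeta>))) powr p) * indicator {0..1} s * indicator {0..2*pi} \<theta> \<partial>lborel) \<partial>lborel)" .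
  have "(\<integral>\<^sup>+s. (\<integral>\<^sup>+\<theta>. ennreal (norm (G (Complex x \<theta> + of_real s * (of_real \<rho> * \<zeta>))) powr p) * indicator {0..1} s * indicator {0..2*pi} \<theta> \<partial>lborel) \<partial>lborel)
      \<le> (\<integral>\<^sup>+s. ennreal P * indicator {0..1} (s :: real) \<partial>lborel)"
  proof (rule nn_integral_mono)
    fix s :: real
    show "(\<integral>\<^sup>+\<theta>. ennreal (norm (G (Complex x \<theta> + of_real s * (of_real \<rho> * \<zeta>))) powr p) * indicator {0..1} s * indicator {0..2*pi} \<theta> \<partial>lborel) \<le> ennreal P * indicator {0..1} s"
      using inner[of s] by (cases "s \<in> {0..1}") simp_all
  qed
  also have "\<dots> = ennreal P" by (subst nn_integral_cmult_indicator) auto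
  finally have "ennreal (\<rho> powr p) * (\<integral>\<^sup>+s. (\<integral>\<^sup>+\<theta>. ennreal (norm (G (Complex x \<theta> + of_real s * (of_real \<rho> * \<zeta>))) powr p) * indicator {0..1} s * indicator {0..2*pi} \<theta> \<partial>lborel) \<partial>lborel)
      \<le> ennreal (\<rho> powr p) * ennreal P" by (rule mult_left_mono) simp
  then show ?thesis using le by (simp add: ennreal_mult')
qed

text \<open>\<open>norm_add_powr_le\<close> with a = H w and b the increment from w to the circle.
  The mean value property makes b have mean zero, which kills the linear term;
  \<open>H_increment\<close> bounds the remainder for each angle, and 12 pi is 6 times the length 2
  pi.\<close>

lemma m_circle_mean_le:
  assumes \<rho>: "0 < \<rho>" "\<rho> < - x" and P: "0 \<le> P"
    and \<Psi>: "\<And>r. 0 < r \<Longrightarrow> r \<le> exp (x + \<rho>) \<Longrightarrow> circ_int p r (deriv h) \<le> ennreal P"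
  shows "(\<integral>\<^sup>+\<psi>\<in>{0..2*pi}. ennreal (m (x + \<rho> * cos \<psi>)) \<partial>lborel) \<le> ennreal (2 * pi * m x + 12 * pi * (\<rho> powr p * P))"
proof -
  have x: "x < 0" using \<rho> by simp
  have [measurable]: "cis \<in> borel_measurable borel" "(\<lambda>\<theta>. Complex y \<theta>) \<in> borel_measurable borel" for y
    by (auto simp: Complex_eq intro!: borel_measurable_continuous_onI continuous_intros)
  let ?d = "\<lambda>\<theta> \<psi>. norm (H (Complex x \<theta> + of_real \<rho> * cis \<psi>) - H (Complex x \<theta>)) powr p"
  have pt: "(\<integral>\<^sup>+\<psi>\<in>{0..2*pi}. ennreal (norm (H (Complex x \<theta> + of_real \<rho> * cis \<psi>)) powr p) \<partial>lborel) \<le>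
      ennreal (2 * pi) * ennreal (norm (H (Complex x \<theta>)) powr p) + 6 * (\<integral>\<^sup>+\<psi>\<in>{0..2*pi}. ennreal (?d \<theta> \<psi>) \<partial>lborel)" for \<theta>
  proof -
    define a where "a = H (Complex x \<theta>)"
    let ?f = "\<lambda>t. H (Complex x \<theta> + of_real \<rho> * cis t)"
    have c: "continuous_on UNIV ?f" by (rule circle_mean_H(1)[OF _ \<rho>]) simp
    have mean: "of_real (2 * pi) * a = integral\<^sup>L arc ?f" unfolding a_def by (rule circle_mean_H(2)[OF _ \<rho>]) simp
    have icc: "continuous_on {0..2*pi} ?f" using c continuous_on_subset by blast
    have "(?f has_integral of_real (2 * pi) * a) {0..2*pi}"
      using integrable_integral[OF integrable_continuous_real[OF icc]] arc_integral_continuous(2)[OF c] mean by simp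
    then have "((\<lambda>t. ?f t - a) has_integral (of_real (2 * pi) * a - measure lborel {0..2*pi} *\<^sub>R a)) {0..2*pi}"
      by (intro has_integral_diff has_integral_const_real)
    then have "((\<lambda>t. ?f t - a) has_integral 0) {0..2*pi}" by (simp add: scaleR_conv_of_real)
    then have "((\<lambda>t. Re (cnj a * (?f t - a))) has_integral Re (cnj a * 0)) {0..2*pi}"
      by (intro has_integral_Re has_integral_mult_right)
    then have r0: "((\<lambda>t. p * norm a powr (p - 2) * Re (cnj a * (?f t - a))) has_integral p * norm a powr (p - 2) * 0) {0..2*pi}"
      by (intro has_integral_mult_right) simp
    have cd: "continuous_on {0..2*pi} (\<lambda>t. norm (?f t - a) powr p)" "continuous_on {0..2*pi} (\<lambda>t. norm (?f t) powr p)"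
      using p by (intro continuous_on_powr' continuous_intros icc; auto)+
    let ?J = "integral {0..2*pi} (\<lambda>t. norm (?f t - a) powr p)"
    have "((\<lambda>t. norm a powr p + p * norm a powr (p - 2) * Re (cnj a * (?f t - a)) + 6 * norm (?f t - a) powr p) has_integral
        (measure lborel {0..2*pi} *\<^sub>R (norm a powr p) + p * norm a powr (p - 2) * 0 + 6 * ?J)) {0..2*pi}"
      by (intro has_integral_add r0 has_integral_const_real has_integral_mult_right integrable_integral integrable_continuous_real cd)
    then have up: "((\<lambda>t. norm a powr p + p * norm a powr (p - 2) * Re (cnj a * (?f t - a)) + 6 * norm (?f t - a) powr p) has_integral
        (2 * pi * norm a powr p + 6 * ?J)) {0..2*pi}" by simp
    have "integral {0..2*pi} (\<lambda>t. norm (?f t) powr p) \<le> 2 * pi * norm a powr p + 6 * ?J"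
    proof (rule has_integral_le[OF integrable_integral[OF integrable_continuous_real[OF cd(2)]] up])
      fix t
      show "norm (?f t) powr p \<le> norm a powr p + p * norm a powr (p - 2) * Re (cnj a * (?f t - a)) + 6 * norm (?f t - a) powr p"
        using norm_add_powr_le[OF p, of a "?f t - a"] by simp
    qed
    then have "ennreal (integral {0..2*pi} (\<lambda>t. norm (?f t) powr p)) \<le> ennreal (2 * pi * norm a powr p + 6 * ?J)" by (rule ennreal_leI)
    also have "\<dots> = ennreal (2 * pi) * ennreal (norm a powr p) + 6 * ennreal ?J"
    proof -
      have "0 \<le> ?J" by (intro integral_nonneg integrable_continuous_real cd) auto
      then show ?thesis by (simp add: ennreal_mult')
    qed
    finally show ?thesis
      using nn_integral_Icc_continuous[OF cd(1)] nn_integral_Icc_continuous[OF cd(2)] by (simp add: a_def)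
  qed
  have "(\<integral>\<^sup>+\<psi>\<in>{0..2*pi}. ennreal (m (x + \<rho> * cos \<psi>)) \<partial>lborel) =
      (\<integral>\<^sup>+\<theta>\<in>{0..2*pi}. (\<integral>\<^sup>+\<psi>\<in>{0..2*pi}. ennreal (norm (H (Complex x \<theta> + of_real \<rho> * cis \<psi>)) powr p) \<partial>lborel) \<partial>lborel)"
    by (rule nn_integral_H_circles_eq[OF \<rho>, symmetric])
  also have "\<dots> \<le> (\<integral>\<^sup>+\<theta>\<in>{0..2*pi}. (ennreal (2 * pi) * ennreal (norm (H (Complex x \<theta>)) powr p) + 6 * (\<integral>\<^sup>+\<psi>\<in>{0..2*pi}. ennreal (?d \<theta> \<psi>) \<partial>lborel)) \<partial>lborel)"
    by (intro nn_integral_Icc_mono pt)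
  also have "\<dots> = (\<integral>\<^sup>+\<theta>. ennreal (2 * pi) * (ennreal (norm (H (Complex x \<theta>)) powr p) * indicator {0..2*pi} \<theta>) +
      6 * (\<integral>\<^sup>+\<psi>. ennreal (?d \<theta> \<psi>) * indicator {0..2*pi} \<psi> * indicator {0..2*pi} \<theta> \<partial>lborel) \<partial>lborel)"
  proof (rule nn_integral_cong)
    fix \<theta>
    show "(ennreal (2 * pi) * ennreal (norm (H (Complex x \<theta>)) powr p) + 6 * (\<integral>\<^sup>+\<psi>\<in>{0..2*pi}. ennreal (?d \<theta> \<psi>) \<partial>lborel)) * indicator {0..2*pi} \<theta> =
      ennreal (2 * pi) * (ennreal (norm (H (Complex x \<theta>)) powr p) * indicator {0..2*pi} \<theta>) +
      6 * (\<integral>\<^sup>+\<psi>. ennreal (?d \<theta> \<psi>) * indicator {0..2*pi} \<psi> * indicator {0..2*pi} \<theta> \<partial>lborel)"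
      by (cases "\<theta> \<in> {0..2*pi}") simp_all
  qed
  also have "\<dots> = ennreal (2 * pi) * (\<integral>\<^sup>+\<theta>\<in>{0..2*pi}. ennreal (norm (H (Complex x \<theta>)) powr p) \<partial>lborel) +
      6 * (\<integral>\<^sup>+\<theta>. (\<integral>\<^sup>+\<psi>. ennreal (?d \<theta> \<psi>) * indicator {0..2*pi} \<psi> * indicator {0..2*pi} \<theta> \<partial>lborel) \<partial>lborel)"
    by (subst nn_integral_add, measurable, subst nn_integral_cmult, measurable, subst nn_integral_cmult, measurable)
  also have "(\<integral>\<^sup>+\<theta>. (\<integral>\<^sup>+\<psi>. ennreal (?d \<theta> \<psi>) * indicator {0..2*pi} \<psi> * indicator {0..2*pi} \<theta> \<partial>lborel) \<partial>lborel) =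
      (\<integral>\<^sup>+\<psi>. (\<integral>\<^sup>+\<theta>. ennreal (?d \<theta> \<psi>) * indicator {0..2*pi} \<psi> * indicator {0..2*pi} \<theta> \<partial>lborel) \<partial>lborel)"
    by (rule lborel_pair.Fubini'[symmetric]) measurable
  finally have le: "(\<integral>\<^sup>+\<psi>\<in>{0..2*pi}. ennreal (m (x + \<rho> * cos \<psi>)) \<partial>lborel) \<le>
      ennreal (2 * pi) * ennreal (m x) + 6 * (\<integral>\<^sup>+\<psi>. (\<integral>\<^sup>+\<theta>. ennreal (?d \<theta> \<psi>) * indicator {0..2*pi} \<psi> * indicator {0..2*pi} \<theta> \<partial>lborel) \<partial>lborel)"
    by (simp only: nn_integral_H_eq_m[OF x])
  have "(\<integral>\<^sup>+\<psi>. (\<integral>\<^sup>+\<theta>. ennreal (?d \<theta> \<psi>) * indicator {0..2*pi} \<psi> * indicator {0..2*pi} \<theta> \<partial>lborel) \<partial>lborel) \<le>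
      (\<integral>\<^sup>+\<psi>. ennreal (\<rho> powr p * P) * indicator {0..2*pi} \<psi> \<partial>lborel)"
  proof (rule nn_integral_mono)
    fix \<psi>
    show "(\<integral>\<^sup>+\<theta>. ennreal (?d \<theta> \<psi>) * indicator {0..2*pi} \<psi> * indicator {0..2*pi} \<theta> \<partial>lborel) \<le> ennreal (\<rho> powr p * P) * indicator {0..2*pi} \<psi>"
      using H_increment[OF \<rho> norm_cis \<Psi>] by (cases "\<psi> \<in> {0..2*pi}") simp_all
  qed
  also have "\<dots> = ennreal (2 * pi * (\<rho> powr p * P))"
    using P by (subst nn_integral_cmult_indicator) (auto simp: ennreal_mult'[symmetric] mult_ac)
  finally have "ennreal (2 * pi) * ennreal (m x) + 6 * (\<integral>\<^sup>+\<psi>. (\<integral>\<^sup>+\<theta>. ennreal (?d \<theta> \<psi>) * indicator {0..2*pi} \<psi> * indicator {0..2*pi} \<theta> \<partial>lborel) \<partial>lborel)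
      \<le> ennreal (2 * pi) * ennreal (m x) + ennreal 6 * ennreal (2 * pi * (\<rho> powr p * P))"
    by (intro add_left_mono mult_mono) auto
  also have "\<dots> = ennreal (2 * pi * m x + 12 * pi * (\<rho> powr p * P))"
  proof -
    have "0 \<le> 2 * pi * m x" "0 \<le> 6 * (2 * pi * (\<rho> powr p * P))" using P m_nonneg[OF x] by auto
    moreover have "ennreal (2 * pi) * ennreal (m x) = ennreal (2 * pi * m x)"
      by (rule ennreal_mult'[symmetric]) simp
    moreover have "ennreal 6 * ennreal (2 * pi * (\<rho> powr p * P)) = ennreal (6 * (2 * pi * (\<rho> powr p * P)))"
      by (rule ennreal_mult'[symmetric]) simp
    moreover have "6 * (2 * pi * (\<rho> powr p * P)) = 12 * pi * (\<rho> powr p * P)" by simp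
    ultimately show ?thesis by (simp only: ennreal_plus)
  qed
  finally show ?thesis using le order_trans by blast
qed

text \<open>Pairing the angles \<psi> and \<psi> + pi turns the cosine mean of \<open>m\<close> into
  second differences of width \<rho> |cos \<psi>|, all nonnegative by convexity. For \<psi> in
  [0, 1] this width is at least \<rho> / 2, and monotonicity leaves the second difference at \<rho>
  / 2; the pairing doubles 12 pi to 24 pi.\<close>

lemma m_second_difference_le:
  assumes \<rho>: "0 < \<rho>" "\<rho> < - x" and P: "0 \<le> P"
    and \<Psi>: "\<And>r. 0 < r \<Longrightarrow> r \<le> exp (x + \<rho>) \<Longrightarrow> circ_int p r (deriv h) \<le> ennreal P"
  shows "m (x + \<rho> / 2) + m (x - \<rho> / 2) - 2 * m x \<le> 24 * pi * (\<rho> powr p * P)"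
proof -
  have x: "x < 0" using \<rho> by simp
  define g where "g t = m (x + t) + m (x - t) - 2 * m x" for t
  have g0: "0 \<le> g t" if "0 \<le> t" "t \<le> \<rho>" for t
  proof (cases "t = 0")
    case False
    then show ?thesis unfolding g_def using that \<rho> by (intro second_difference_mono(1)[OF m_chord, where u=t]) auto
  qed (simp add: g_def)
  have gm: "g (\<rho> / 2) \<le> g t" if "\<rho> / 2 \<le> t" "t \<le> \<rho>" for t
    unfolding g_def using that \<rho> by (intro second_difference_mono(2)[OF m_chord]) auto
  define f where "f \<psi> = m (x + \<rho> * cos \<psi>)" for \<psi>
  have f_nonneg: "0 \<le> f \<psi>" for \<psi> unfolding f_def by (intro m_nonneg cos_arg_neg[OF \<rho>])
  have f_cont: "continuous_on UNIV f" unfolding f_def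
    by (rule continuous_on_compose2[OF m_cont]) (use cos_arg_neg[OF \<rho>] in \<open>auto intro!: continuous_intros\<close>)
  have fm: "(\<lambda>\<psi>. ennreal (f \<psi>)) \<in> borel_measurable borel"
    using borel_measurable_continuous_onI[OF f_cont] by measurable
  have fm' [measurable]: "(\<lambda>\<psi>. ennreal (f (\<psi> + pi))) \<in> borel_measurable borel"
    by (rule measurable_compose[OF _ fm]) measurable
  note [measurable] = fm
  define A where "A = (\<integral>\<^sup>+\<psi>\<in>{0..2*pi}. ennreal (f \<psi>) \<partial>lborel)"
  have shift: "(\<integral>\<^sup>+\<psi>\<in>{0..2*pi}. ennreal (f (\<psi> + pi)) \<partial>lborel) = A"
    unfolding A_def by (rule nn_integral_periodic_shift[OF fm]) (auto simp: f_def)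
  have cos_half: "1 / 2 \<le> cos \<psi>" if "\<psi> \<in> {0..1}" for \<psi> :: real
  proof -
    have "\<psi> \<le> pi / 3" using that pi_gt3 by auto
    then have "cos (pi / 3) \<le> cos \<psi>" using that by (intro cos_monotone_0_pi_le) auto
    then show ?thesis by (simp add: cos_60)
  qed
  have sum_ge: "2 * m x + g (\<rho> / 2) * indicator {0..1} \<psi> \<le> f \<psi> + f (\<psi> + pi)" for \<psi>
  proof -
    have eq: "f \<psi> + f (\<psi> + pi) = 2 * m x + g (\<rho> * \<bar>cos \<psi>\<bar>)"
      by (cases "0 \<le> cos \<psi>") (auto simp: f_def g_def)
    have le: "\<rho> * \<bar>cos \<psi>\<bar> \<le> \<rho>" using \<rho> by (intro mult_left_le) auto
    show ?thesis
    proof (cases "\<psi> \<in> {0..1}")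
      case True
      have "\<rho> * (1 / 2) \<le> \<rho> * \<bar>cos \<psi>\<bar>" using cos_half[OF True] \<rho> by (intro mult_left_mono) auto
      then show ?thesis unfolding eq using True gm[OF _ le] by simp
    next
      case False
      then show ?thesis unfolding eq using g0[OF _ le] \<rho> by simp
    qed
  qed
  have gh: "0 \<le> g (\<rho> / 2)" using g0[of "\<rho> / 2"] \<rho> by simp
  have "ennreal (4 * pi * m x + g (\<rho> / 2)) = (\<integral>\<^sup>+\<psi>. ennreal (2 * m x) * indicator {0..2*pi} \<psi> + ennreal (g (\<rho> / 2)) * indicator {0..1} \<psi> \<partial>lborel)"
  proof -
    have "(\<integral>\<^sup>+\<psi>. ennreal (2 * m x) * indicator {0..2*pi} \<psi> + ennreal (g (\<rho> / 2)) * indicator {0..1} (\<psi>::real) \<partial>lborel) =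
        ennreal (2 * m x) * ennreal (2 * pi) + ennreal (g (\<rho> / 2)) * ennreal 1"
      by (subst nn_integral_add, simp, simp, subst nn_integral_cmult_indicator, simp, subst nn_integral_cmult_indicator) auto
    also have "\<dots> = ennreal (2 * m x * (2 * pi) + g (\<rho> / 2))"
    proof -
      have "0 \<le> 2 * m x" "0 \<le> 2 * m x * (2 * pi)" using m_nonneg[OF x] by auto
      then show ?thesis using gh by (simp only: ennreal_mult'[symmetric] ennreal_plus mult_1_right)
    qed
    finally show ?thesis by (simp add: mult_ac)
  qed
  also have "\<dots> \<le> (\<integral>\<^sup>+\<psi>. ennreal (f \<psi>) * indicator {0..2*pi} \<psi> + ennreal (f (\<psi> + pi)) * indicator {0..2*pi} \<psi> \<partial>lborel)"
  proof (rule nn_integral_mono)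
    fix \<psi>
    show "ennreal (2 * m x) * indicator {0..2*pi} \<psi> + ennreal (g (\<rho> / 2)) * indicator {0..1} \<psi> \<le>
      ennreal (f \<psi>) * indicator {0..2*pi} \<psi> + ennreal (f (\<psi> + pi)) * indicator {0..2*pi} \<psi>"
    proof (cases "\<psi> \<in> {0..2*pi}")
      case True
      have "ennreal (2 * m x) + ennreal (g (\<rho> / 2) * indicator {0..1} \<psi>) = ennreal (2 * m x + g (\<rho> / 2) * indicator {0..1} \<psi>)"
        using gh m_nonneg[OF x] by (intro ennreal_plus[symmetric]) auto
      also have "\<dots> \<le> ennreal (f \<psi> + f (\<psi> + pi))" by (intro ennreal_leI sum_ge)
      also have "\<dots> = ennreal (f \<psi>) + ennreal (f (\<psi> + pi))" using f_nonneg by simp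
      finally show ?thesis using True gh by (simp add: ennreal_mult' ennreal_indicator)
    next
      case False
      then have "\<psi> \<notin> {0..1}" using pi_gt3 by auto
      then show ?thesis using False by simp
    qed
  qed
  also have "\<dots> = A + A"
    unfolding shift[symmetric] by (subst nn_integral_add) (auto simp: shift A_def)
  also have "\<dots> \<le> ennreal (2 * pi * m x + 12 * pi * (\<rho> powr p * P)) + ennreal (2 * pi * m x + 12 * pi * (\<rho> powr p * P))"
    unfolding A_def f_def by (intro add_mono m_circle_mean_le[OF \<rho> P \<Psi>]) auto
  also have "\<dots> = ennreal (4 * pi * m x + 24 * pi * (\<rho> powr p * P))"
    using P m_nonneg[OF x] by (subst ennreal_plus[symmetric]) (auto simp: algebra_simps)
  finally have "4 * pi * m x + g (\<rho> / 2) \<le> 4 * pi * m x + 24 * pi * (\<rho> powr p * P)"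
    using P m_nonneg[OF x] by (subst (asm) ennreal_le_iff) auto
  then show ?thesis by (simp add: g_def)
qed

end

section \<open>Summation over the geometric grid\<close>

lemma exp_neg_le_one_minus_half:
  fixes v :: real
  assumes "0 \<le> v" "v \<le> 1"
  shows "exp (- v) \<le> 1 - v / 2"
proof -
  have "exp (- v) = 1 / exp v" by (simp add: exp_minus inverse_eq_divide)
  also have "\<dots> \<le> 1 / (1 + v)" using exp_ge_add_one_self[of v] assms by (intro divide_left_mono mult_pos_pos) auto
  also have "\<dots> \<le> 1 - v / 2"
  proof -
    have "v * v \<le> v * 1" using assms by (intro mult_left_mono) auto
    then have "1 \<le> (1 - v / 2) * (1 + v)" by (simp add: algebra_simps)
    then show ?thesis using assms by (subst pos_divide_le_eq) auto
  qed
  finally show ?thesis .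
qed

lemma nn_integral_Ico_sum:
  fixes v :: "real \<Rightarrow> ennreal" and l :: "nat \<Rightarrow> real"
  assumes [measurable]: "v \<in> borel_measurable borel" and l: "\<And>k. l k \<le> l (Suc k)"
  shows "(\<Sum>k=1..n. (\<integral>\<^sup>+s\<in>{l k..<l (Suc k)}. v s \<partial>lborel)) = (\<integral>\<^sup>+s\<in>{l 1..<l (Suc n)}. v s \<partial>lborel)"
proof (induction n)
  case (Suc n)
  have "l 1 \<le> l (Suc n)" by (rule lift_Suc_mono_le[of l, OF l]) simp
  then have "(\<integral>\<^sup>+s\<in>{l 1..<l (Suc (Suc n))}. v s \<partial>lborel) =
      (\<integral>\<^sup>+s\<in>{l 1..<l (Suc n)}. v s \<partial>lborel) + (\<integral>\<^sup>+s\<in>{l (Suc n)..<l (Suc (Suc n))}. v s \<partial>lborel)"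
    by (intro nn_integral_Ico_split assms)
  then show ?case using Suc.IH by (simp only: sum.cl_ivl_Suc) simp
qed simp

lemma nn_integral_Ico_le_if_Icc_le:
  fixes v :: "real \<Rightarrow> ennreal"
  assumes [measurable]: "v \<in> borel_measurable borel"
    and le: "\<And>r. 0 \<le> r \<Longrightarrow> r < 1 \<Longrightarrow> (\<integral>\<^sup>+s\<in>{0..r}. v s \<partial>lborel) \<le> c"
  shows "(\<integral>\<^sup>+s\<in>{0..<1}. v s \<partial>lborel) \<le> c"
proof -
  define M where "M = density lborel v"
  have em: "emeasure M A = (\<integral>\<^sup>+s\<in>A. v s \<partial>lborel)" if "A \<in> sets borel" for A
    unfolding M_def using that by (simp add: emeasure_density)
  define A where "A n = {0..1 - 1 / real (Suc n)}" for n
  have un: "(\<Union>n. A n) = {0..<1}"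
  proof (intro set_eqI iffI)
    fix s assume s: "s \<in> {0..<1::real}"
    then obtain n where "1 / real (Suc n) < 1 - s" using nat_approx_posE[of "1 - s"] by auto
    then have "s \<in> A n" using s by (auto simp: A_def)
    then show "s \<in> (\<Union>n. A n)" by blast
  next
    fix s assume "s \<in> (\<Union>n. A n)"
    then obtain n where "0 \<le> s" "s \<le> 1 - 1 / real (Suc n)" by (auto simp: A_def)
    moreover have "0 < 1 / real (Suc n)" by simp
    ultimately have "0 \<le> s" "s < 1" by linarith+
    then show "s \<in> {0..<1}" by simp
  qed
  have inc: "incseq A"
  proof (rule incseq_SucI)
    fix n
    have "1 / real (Suc (Suc n)) \<le> 1 / real (Suc n)" by (intro divide_left_mono) auto
    then show "A n \<le> A (Suc n)" by (auto simp: A_def)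
  qed
  have "(\<integral>\<^sup>+s\<in>{0..<1}. v s \<partial>lborel) = emeasure M (\<Union>n. A n)" by (simp add: em un)
  also have "\<dots> = (SUP n. emeasure M (A n))"
    by (rule SUP_emeasure_incseq[OF _ inc, symmetric]) (auto simp: A_def M_def)
  also have "\<dots> \<le> c"
  proof (rule SUP_least)
    fix n
    have "emeasure M (A n) = (\<integral>\<^sup>+s\<in>A n. v s \<partial>lborel)" by (rule em) (simp add: A_def)
    also have "\<dots> \<le> c" unfolding A_def by (intro le) (auto simp: field_simps)
    finally show "emeasure M (A n) \<le> c" .
  qed
  finally show ?thesis .
qed

context disc_function
begin

text \<open>Monotonicity of the majorant \<open>\<Psi>\<close> makes one value control all smaller
  circles, as \<open>H_increment\<close> demands, and also lets that value be spread over an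
  interval of larger radii. The grid in ln r starts in the region where \<open>B\<close> applies and
  ends exactly at ln r.\<close>

lemma littlewood_paley:
  assumes [measurable]: "\<Psi> \<in> borel_measurable borel" and \<Psi>0: "\<And>s. 0 \<le> \<Psi> s"
    and mono: "\<And>r s. 0 < r \<Longrightarrow> r \<le> s \<Longrightarrow> s < 1 \<Longrightarrow> \<Psi> r \<le> \<Psi> s"
    and bound: "\<And>r. 0 < r \<Longrightarrow> r < 1 \<Longrightarrow> circ_int p r (deriv h) \<le> ennreal (\<Psi> r)"
    and B: "0 \<le> B" "\<And>r. 0 < r \<Longrightarrow> r \<le> exp (- 1) \<Longrightarrow> circ_int p r h \<le> ennreal B"
    and r: "0 < r" "r < 1"
  shows "circ_int p r h \<le> ennreal (11 * B) +
    ennreal (4 * (24 * pi * 2 powr (- p) * 5 powr (p - 1) * 40)) * (\<integral>\<^sup>+s\<in>{0..<1}. ennreal ((1 - s) powr (p - 1) * \<Psi> s) \<partial>lborel)"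
proof (cases "r \<le> exp (- 1)")
  case True
  have "circ_int p r h \<le> ennreal B" using B(2)[OF r(1) True] .
  also have "\<dots> \<le> ennreal (11 * B)" using B(1) by (intro ennreal_leI) simp
  finally show ?thesis by (rule add_increasing2[rotated]) simp
next
  case False
  define y where "y = - ln r"
  have y: "0 < y" using r by (simp add: y_def)
  have "ln (exp (- 1)) < ln r" using False r by (subst ln_less_cancel_iff) auto
  then have y1: "y < 1" by (simp add: y_def)
  have r_eq: "r = exp (- y)" using r by (simp add: y_def)
  obtain N0 where "1 / y < (5 / 4 :: real) ^ N0" using real_arch_pow[of "5/4" "1 / y"] by auto
  then have ex: "1 \<le> y * (5 / 4) ^ N0" using y by (simp add: divide_less_eq mult.commute)
  \<comment> \<open>The least exponent puts y (5/4)^N into [1, 5/4).\<close>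
  define N where "N = (LEAST N. 1 \<le> y * (5 / 4 :: real) ^ N)"
  have N: "1 \<le> y * (5 / 4) ^ N" unfolding N_def by (rule LeastI[of _ N0]) (rule ex)
  have "N \<noteq> 0" using N y1 by (cases N) auto
  then obtain N' where N': "N = Suc N'" by (cases N) auto
  have "\<not> 1 \<le> y * (5 / 4 :: real) ^ N'" using not_less_Least[of N' "\<lambda>N. 1 \<le> y * (5 / 4 :: real) ^ N"] N' by (simp add: N_def)
  then have Y_lt: "y * (5 / 4) ^ N < 5 / 4" by (simp add: N')
  \<comment> \<open>One further factor 5 / 4 makes both initial nodes, -X and -(4/5) X, at most -1,
    so that \<open>B\<close> bounds the means there.\<close>
  define X where "X = 5 / 4 * (y * (5 / 4) ^ N)"
  have X: "0 < X" "5 / 4 \<le> X" "X < 25 / 16" using N Y_lt y by (auto simp: X_def)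
  define x where "x k = - X * (4 / 5) ^ k" for k :: nat
  have xneg: "x k < 0" for k using X by (simp add: x_def)
  have xs: "x (Suc k) = 4 / 5 * x k" for k by (simp add: x_def)
  have xN: "x (Suc N) = - y"
  proof -
    have "(5 / 4 :: real) ^ N * (4 / 5) ^ N = 1" by (simp add: power_mult_distrib[symmetric])
    then show ?thesis by (simp add: x_def X_def)
  qed
  have x_small: "- x k < 5 / 4" if "1 \<le> k" for k
  proof -
    obtain j where j: "k = Suc j" using \<open>1 \<le> k\<close> by (cases k) auto
    have "(4 / 5 :: real) ^ j \<le> 1" by (intro power_le_one) auto
    then have "X * (4 / 5) ^ j \<le> X" using X by (intro mult_left_le) auto
    moreover have "- x k = 4 / 5 * (X * (4 / 5) ^ j)" by (simp add: x_def j)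
    ultimately show ?thesis using X by linarith
  qed
  \<comment> \<open>The second-difference bound with \<rho> = |x k| / 2: it concerns width |x k| /
    4, as the grid lemma requires, and involves radii up to exp (x k / 2).\<close>
  define e where "e k = 24 * pi * (((- x k) / 2) powr p * \<Psi> (exp (x k / 2)))" for k
  have m_eq: "circ_int p (exp (x k)) h = ennreal (m (x k))" for k by (rule circ_int_eq_m[OF xneg])
  have mB: "m (x k) \<le> B" if "x k \<le> - 1" for k
    using B(2)[of "exp (x k)"] that B(1) by (simp add: m_eq)
  have e_bound: "m (x k + (- x k) / 4) + m (x k - (- x k) / 4) - 2 * m (x k) \<le> e k" for k
  proof -
    define \<rho> where "\<rho> = (- x k) / 2"
    have \<rho>: "0 < \<rho>" "\<rho> < - x k" using xneg[of k] by (auto simp: \<rho>_def)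
    have eq: "x k + \<rho> = x k / 2" by (simp add: \<rho>_def)
    have "exp (x k / 2) < 1" using xneg[of k] by simp
    then have "circ_int p s (deriv h) \<le> ennreal (\<Psi> (exp (x k / 2)))" if "0 < s" "s \<le> exp (x k + \<rho>)" for s
      using that bound[of s] mono[of s "exp (x k / 2)"] order_trans ennreal_leI unfolding eq by (metis le_less_trans)
    from m_second_difference_le[OF \<rho> \<Psi>0 this] show ?thesis by (simp add: \<rho>_def e_def)
  qed
  have "m (x (Suc N)) \<le> 11 * B + 4 * (\<Sum>k=1..N. e k)"
  proof (rule convex_geometric_grid_bound[OF m_chord m_nonneg X(1) x_def e_bound])
    have "x 0 \<le> - 1" "x 1 \<le> - 1" using X by (simp_all add: x_def)
    then show "m (x 0) \<le> B" "m (x 1) \<le> B" by (auto intro: mB)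
  qed
  then have m_le: "circ_int p r h \<le> ennreal (11 * B + 4 * (\<Sum>k=1..N. e k))"
    using circ_int_eq_m[OF xneg[of "Suc N"]] unfolding xN r_eq by (simp add: ennreal_leI)
  define l where "l k = exp (x k / 2)" for k
  let ?F = "\<lambda>s. ennreal ((1 - s) powr (p - 1) * \<Psi> s)"
  \<comment> \<open>On the interval from \<open>l k\<close> to \<open>l (Suc k)\<close>, with u = |x
    k|, one has 1 - s \<ge> u / 5 and the length is at least u / 40; \<open>K\<close> collects these
    factors and 2^(-p) from the half in \<open>e\<close>. The intervals are adjacent, so their
    integrals add up.\<close>
  define K where "K = 24 * pi * 2 powr (- p) * 5 powr (p - 1) * 40"
  have K: "0 \<le> K" by (simp add: K_def)
  have l_mono: "l k \<le> l (Suc k)" for k using xneg[of k] by (simp add: l_def xs)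
  have l_bds: "0 < l k" "l k < 1" for k using xneg[of k] by (simp_all add: l_def)
  have e_int: "ennreal (e k) \<le> ennreal K * (\<integral>\<^sup>+s\<in>{l k..<l (Suc k)}. ?F s \<partial>lborel)" if k: "1 \<le> k" for k
  proof -
    define u where "u = - x k"
    have u: "0 < u" "u < 5 / 4" using xneg[of k] x_small[OF k] by (auto simp: u_def)
    have l': "l (Suc k) = exp (- (2 / 5 * u))" "l k = exp (- (u / 2))" by (simp_all add: l_def xs u_def)
    have one_minus: "u / 5 \<le> 1 - l (Suc k)"
      using exp_neg_le_one_minus_half[of "2 / 5 * u"] u unfolding l' by simp
    have len: "u / 40 \<le> l (Suc k) - l k"
    proof -
      have "l (Suc k) = l k * exp (u / 10)" unfolding l' by (simp add: exp_add[symmetric])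
      then have eq: "l (Suc k) - l k = l k * (exp (u / 10) - 1)" by (simp add: algebra_simps)
      have "1 / 4 \<le> 1 - u / 2" using u by simp
      also have "\<dots> \<le> l k" using exp_ge_add_one_self[of "- (u / 2)"] by (simp add: l')
      finally have l4: "1 / 4 \<le> l k" .
      have e10: "u / 10 \<le> exp (u / 10) - 1" using exp_ge_add_one_self[of "u / 10"] by linarith
      have "1 / 4 * (u / 10) \<le> l k * (exp (u / 10) - 1)"
        by (rule mult_mono[OF l4 e10]) (use u l_bds[of k] in auto)
      then show ?thesis by (simp add: eq)
    qed
    define c where "c = (u / 5) powr (p - 1) * \<Psi> (l k)"
    have c: "0 \<le> c" by (simp add: c_def \<Psi>0)
    have "ennreal (c * (u / 40)) \<le> ennreal (c * (l (Suc k) - l k))" using len c by (intro ennreal_leI mult_left_mono)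
    also have "\<dots> = (\<integral>\<^sup>+s\<in>{l k..<l (Suc k)}. ennreal c \<partial>lborel)"
      using l_mono[of k] c by (subst nn_integral_cmult_indicator) (auto simp: ennreal_mult')
    also have "\<dots> \<le> (\<integral>\<^sup>+s\<in>{l k..<l (Suc k)}. ?F s \<partial>lborel)"
    proof (rule nn_integral_Icc_mono)
      fix s assume s: "s \<in> {l k..<l (Suc k)}"
      have "c \<le> (1 - s) powr (p - 1) * \<Psi> s"
        unfolding c_def using s one_minus u p l_bds[of k] l_bds[of "Suc k"] \<Psi>0
        by (intro mult_mono powr_mono2 mono) auto
      then show "ennreal c \<le> ?F s" by (rule ennreal_leI)
    qed
    finally have "ennreal K * ennreal (c * (u / 40)) \<le> ennreal K * (\<integral>\<^sup>+s\<in>{l k..<l (Suc k)}. ?F s \<partial>lborel)"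
      by (rule mult_left_mono) simp
    moreover have "ennreal K * ennreal (c * (u / 40)) = ennreal (e k)"
    proof -
      have "u powr p = u powr (p - 1) * u" using u powr_add[of u "p - 1" 1] by simp
      moreover have "(u / 2) powr p = 2 powr (- p) * u powr p" by (simp add: powr_divide powr_minus_divide)
      moreover have "(u / 5) powr (p - 1) * 5 powr (p - 1) = u powr (p - 1)" by (simp add: powr_divide)
      ultimately have u2: "(u / 2) powr p = 2 powr (- p) * ((u / 5) powr (p - 1) * 5 powr (p - 1) * u)"
        by (simp only:)
      have "e k = 24 * pi * ((u / 2) powr p * \<Psi> (l k))" by (simp only: e_def u_def l_def)
      then have "e k = K * (c * (u / 40))" unfolding u2 by (simp add: K_def c_def)
      then show ?thesis using K by (simp only: ennreal_mult'[symmetric])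
    qed
    ultimately show ?thesis by simp
  qed
  have e0: "0 \<le> e k" for k by (simp add: e_def \<Psi>0)
  have "ennreal (\<Sum>k=1..N. e k) = (\<Sum>k=1..N. ennreal (e k))" by (rule sum_ennreal[symmetric]) (rule e0)
  also have "\<dots> \<le> (\<Sum>k=1..N. ennreal K * (\<integral>\<^sup>+s\<in>{l k..<l (Suc k)}. ?F s \<partial>lborel))"
    by (intro sum_mono e_int) auto
  also have "\<dots> = ennreal K * (\<integral>\<^sup>+s\<in>{l 1..<l (Suc N)}. ?F s \<partial>lborel)"
    by (subst sum_distrib_left[symmetric], subst nn_integral_Ico_sum) (use l_mono in auto)
  also have "\<dots> \<le> ennreal K * (\<integral>\<^sup>+s\<in>{0..<1}. ?F s \<partial>lborel)"
    using l_bds[of 1] l_bds[of "Suc N"] by (intro mult_left_mono nn_set_integral_set_mono) auto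
  finally have sum_le: "ennreal (\<Sum>k=1..N. e k) \<le> ennreal K * (\<integral>\<^sup>+s\<in>{0..<1}. ?F s \<partial>lborel)" .
  have "ennreal (11 * B + 4 * (\<Sum>k=1..N. e k)) = ennreal (11 * B) + ennreal 4 * ennreal (\<Sum>k=1..N. e k)"
  proof -
    have "0 \<le> (\<Sum>k=1..N. e k)" by (intro sum_nonneg e0)
    then show ?thesis using B(1) by (simp add: ennreal_plus ennreal_mult')
  qed
  also have "\<dots> \<le> ennreal (11 * B) + ennreal 4 * (ennreal K * (\<integral>\<^sup>+s\<in>{0..<1}. ?F s \<partial>lborel))"
    by (intro add_left_mono mult_left_mono sum_le) simp
  also have "\<dots> = ennreal (11 * B) + ennreal (4 * K) * (\<integral>\<^sup>+s\<in>{0..<1}. ?F s \<partial>lborel)"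
  proof -
    have "ennreal (4 * K) = ennreal 4 * ennreal K" by (rule ennreal_mult') simp
    then show ?thesis by (simp only: mult.assoc)
  qed
  finally show ?thesis using m_le order_trans unfolding K_def by blast
qed

end

section \<open>The Hardy space case and the theorem\<close>

text \<open>In the Hardy case the weighted Hardy inequality ends with \<open>Phi a 2\<close> and the
  weight (1 - r)^p; this returns to \<open>Phi a 1\<close> without weight.\<close>

lemma (in radial_mass) one_minus_times_Phi_2_le:
  assumes r: "0 \<le> r" "r < 1"
  shows "(1 - r) * Phi a 2 r \<le> Phi a 1 r"
proof -
  have "(1 - r) * Phi a 2 r = (LINT t|lborel. (1 - r) * (a t * (1 - t * r) powr (- 2)))"
    by (simp add: Phi_def)
  also have "\<dots> \<le> Phi a 1 r" unfolding Phi_def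
  proof (rule integral_mono)
    show "integrable lborel (\<lambda>t. (1 - r) * (a t * (1 - t * r) powr (- 2)))" "integrable lborel (\<lambda>t. a t * (1 - t * r) powr (- 1))"
      using Phi_integrable[OF r, of 2] Phi_integrable[OF r, of 1] by auto
    fix t
    show "(1 - r) * (a t * (1 - t * r) powr (- 2)) \<le> a t * (1 - t * r) powr (- 1)"
    proof (cases "t \<in> {0..<1}")
      case True
      define A where "A = 1 - t * r"
      have A: "0 < A" "1 - r \<le> A" using kernel_bounds[OF True r] by (auto simp: A_def)
      have "(1 - r) * A powr (- 2) \<le> A powr 1 * A powr (- 2)" using A by (intro mult_right_mono) auto
      also have "\<dots> = A powr (- 1)" by (subst powr_add[symmetric]) simp
      finally have "a t * ((1 - r) * A powr (- 2)) \<le> a t * A powr (- 1)" by (intro mult_left_mono mass_nonneg)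
      then show ?thesis by (simp only: A_def[symmetric] mult.left_commute)
    qed (simp add: mass_supp)
  qed
  finally show ?thesis .
qed

text \<open>\<open>littlewood_paley\<close> for the transform of g', with the n = 2 bound as
  majorant for its derivative. The Hardy inequality with \<alpha> = p - 1 and b = 2 then applies to
  that majorant.\<close>

lemma circ_int_gen_hilbert_le:
  assumes p: "1 < p" "p \<le> 2" and g: "g \<in> mean_lipschitz p (1 / p)"
  shows "\<exists>K>0. \<forall>f r. f holomorphic_on unit_disc \<longrightarrow> integrable lborel (path_density f) \<longrightarrow> 0 < r \<longrightarrow> r < 1 \<longrightarrow>
    circ_int p r (gen_hilbert g f) \<le> ennreal K * (\<integral>\<^sup>+s\<in>{0..<1}. ennreal (Phi (path_mass f) 1 s powr p) \<partial>lborel)"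
proof -
  have hol: "g holomorphic_on unit_disc" using g by (auto simp: mean_lipschitz_def hardy_space_def)
  have hg: "deriv g holomorphic_on unit_disc" by (intro holomorphic_deriv hol) auto
  have hg2: "deriv (deriv g) holomorphic_on unit_disc" by (intro holomorphic_deriv hg) auto
  note cg = holomorphic_on_imp_continuous_on[OF hg] and cg2 = holomorphic_on_imp_continuous_on[OF hg2]
  obtain C1 where C1: "0 < C1" and gr1: "\<And>r. 0 \<le> r \<Longrightarrow> r < 1 \<Longrightarrow> circ_int p r (deriv g) \<le> ennreal (C1 * (1 - r) powr (1 - real 1 * p))"
    using mean_lipschitz_growth[OF p(1) g, of 1] by auto
  obtain C2 where C2: "0 < C2" and gr2: "\<And>r. 0 \<le> r \<Longrightarrow> r < 1 \<Longrightarrow> circ_int p r (deriv (deriv g)) \<le> ennreal (C2 * (1 - r) powr (1 - real 2 * p))"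
    using mean_lipschitz_growth[OF p(1) g, of 2] by (auto simp: numeral_2_eq_2)
  have ip: "1 / p < 1" using p by simp
  then have ip2: "0 \<le> 2 - 1 / p" by linarith
  have "-1 < p - 1" "1 / p < 2" using p ip by linarith+
  from Phi_hardy[OF p(1) this] obtain K where K: "0 < K" and hardy: "\<And>a. radial_mass a \<Longrightarrow>
    (\<integral>\<^sup>+r\<in>{0..<1}. ennreal ((1 - r) powr (p - 1) * Phi a (2 - 1 / p) r powr p) \<partial>lborel) \<le>
      ennreal K * (\<integral>\<^sup>+r\<in>{0..<1}. ennreal ((1 - r) powr (p - 1 + 1) * Phi a 2 r powr p) \<partial>lborel)"
    by blast
  define L where "L = 4 * (24 * pi * 2 powr (- p) * 5 powr (p - 1) * 40)"
  have L: "0 < L" by (simp add: L_def)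
  show ?thesis
  proof (intro exI[of _ "22 * C1 + L * (C2 * K)"] conjI allI impI)
    show "0 < 22 * C1 + L * (C2 * K)" using C1 C2 K L by (intro add_pos_pos mult_pos_pos) auto
    fix f and r :: real assume f: "f holomorphic_on unit_disc" and int: "integrable lborel (path_density f)" and r: "0 < r" "r < 1"
    interpret radial_density "path_mass f" "path_density f" by (rule radial_density_path[OF f int])
    interpret bt: radial_density "path_mass f" "\<lambda>t. path_density f t * of_real t" by (rule radial_density_times_t)
    have rm: "radial_mass (path_mass f)" by unfold_locales
    let ?a = "path_mass f"
    let ?h = "transform (deriv g)"
    interpret disc_function ?h p
      by unfold_locales (use transform_holomorphic[OF hg] p in auto)
    define V where "V = (\<integral>\<^sup>+s\<in>{0..<1}. ennreal (Phi ?a 1 s powr p) \<partial>lborel)"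
    define \<Psi> where "\<Psi> s = C2 * Phi ?a (2 - 1 / p) s powr p" for s
    define B where "B = C1 * Phi ?a 1 (1 / 2) powr p"
    have B0: "0 \<le> B" using C1 by (simp add: B_def)
    have dh: "circ_int p s (deriv ?h) \<le> ennreal (\<Psi> s)" if s: "0 < s" "s < 1" for s
    proof -
      have "circ_int p s (deriv ?h) = circ_int p s (bt.transform (deriv (deriv g)))"
        using s by (intro circ_int_cong DERIV_imp_deriv transform_has_field_derivative hg) auto
      also have "\<dots> \<le> ennreal (C2 * Phi ?a (real 2 - 1 / p) s powr p)"
        using s C2 by (intro bt.circ_int_transform_le[OF p(1) cg2 _ _ gr2]) auto
      finally show ?thesis by (simp add: \<Psi>_def)
    qed
    have hB: "circ_int p s ?h \<le> ennreal B" if s: "0 < s" "s \<le> exp (- 1)" for s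
    proof -
      \<comment> \<open>All radii up to exp (-1) lie below 1 / 2, so one value of \<open>Phi\<close>
        bounds the means there.\<close>
      have "2 \<le> exp (1::real)" using exp_ge_add_one_self[of "1::real"] by simp
      then have "exp (- 1) \<le> (1 / 2 :: real)" by (simp add: exp_minus inverse_eq_divide divide_le_eq)
      then have s2: "s \<le> 1 / 2" using s by linarith
      have "circ_int p s ?h \<le> ennreal (C1 * Phi ?a (real 1 - 1 / p) s powr p)"
        using s s2 C1 by (intro circ_int_transform_le[OF p(1) cg _ _ gr1]) auto
      also have "\<dots> \<le> ennreal B"
      proof -
        have "Phi ?a (real 1 - 1 / p) s \<le> Phi ?a 1 s" using s s2 ip p by (intro Phi_mono_exp) auto
        also have "\<dots> \<le> Phi ?a 1 (1 / 2)" using s s2 by (intro Phi_mono) auto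
        finally show ?thesis unfolding B_def using C1 p Phi_nonneg
          by (intro ennreal_leI mult_left_mono powr_mono2) auto
      qed
      finally show ?thesis .
    qed
    have "circ_int p r ?h \<le> ennreal (11 * B) + ennreal L * (\<integral>\<^sup>+s\<in>{0..<1}. ennreal ((1 - s) powr (p - 1) * \<Psi> s) \<partial>lborel)"
      unfolding L_def
    proof (rule littlewood_paley[OF _ _ _ dh B0 hB r])
      show "\<Psi> \<in> borel_measurable borel" unfolding \<Psi>_def by measurable
      show "0 \<le> \<Psi> s" for s using C2 by (simp add: \<Psi>_def)
      show "\<Psi> s \<le> \<Psi> t" if "0 < s" "s \<le> t" "t < 1" for s t
        unfolding \<Psi>_def using that C2 p ip2 Phi_nonneg by (intro mult_left_mono powr_mono2 Phi_mono ip2) auto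
    qed
    also have "\<dots> \<le> ennreal (22 * C1) * V + ennreal L * (ennreal C2 * (ennreal K * V))"
    proof (intro add_mono mult_left_mono)
      \<comment> \<open>\<open>Phi\<close> increases, so V is at least half of its p-th power at 1 /
        2; this doubles 11 to 22.\<close>
      have "ennreal (Phi ?a 1 (1/2) powr p) * ennreal (1 / 2) = (\<integral>\<^sup>+s\<in>{1/2..<1::real}. ennreal (Phi ?a 1 (1/2) powr p) \<partial>lborel)"
        by (subst nn_integral_cmult_indicator) auto
      also have "\<dots> \<le> V" unfolding V_def
      proof (rule nn_integral_mono)
        fix s :: real
        show "ennreal (Phi ?a 1 (1/2) powr p) * indicator {1/2..<1} s \<le> ennreal (Phi ?a 1 s powr p) * indicator {0..<1} s"
          using p Phi_mono[of "1/2" s 1] Phi_nonneg by (auto simp: indicator_def intro!: ennreal_leI powr_mono2)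
      qed
      finally have "ennreal (22 * C1) * (ennreal (Phi ?a 1 (1/2) powr p) * ennreal (1 / 2)) \<le> ennreal (22 * C1) * V"
        by (rule mult_left_mono) simp
      moreover have "ennreal (22 * C1) * (ennreal (Phi ?a 1 (1/2) powr p) * ennreal (1 / 2)) = ennreal (11 * B)"
      proof -
        have "0 \<le> 22 * C1" using C1 by simp
        then have "ennreal (22 * C1) * (ennreal (Phi ?a 1 (1/2) powr p) * ennreal (1 / 2)) = ennreal (22 * C1 * (Phi ?a 1 (1/2) powr p * (1 / 2)))"
          by (simp only: ennreal_mult'[symmetric] powr_ge_zero)
        also have "22 * C1 * (Phi ?a 1 (1/2) powr p * (1 / 2)) = 11 * B" by (simp add: B_def)
        finally show ?thesis .
      qed
      ultimately show "ennreal (11 * B) \<le> ennreal (22 * C1) * V" by simp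
    next
      have "(\<integral>\<^sup>+s\<in>{0..<1}. ennreal ((1 - s) powr (p - 1) * \<Psi> s) \<partial>lborel) =
          (\<integral>\<^sup>+s. ennreal C2 * (ennreal ((1 - s) powr (p - 1) * Phi ?a (2 - 1 / p) s powr p) * indicator {0..<1} s) \<partial>lborel)"
      proof (rule nn_integral_cong)
        fix s
        have "(1 - s) powr (p - 1) * \<Psi> s = C2 * ((1 - s) powr (p - 1) * Phi ?a (2 - 1 / p) s powr p)" by (simp add: \<Psi>_def)
        then show "ennreal ((1 - s) powr (p - 1) * \<Psi> s) * indicator {0..<1} s =
            ennreal C2 * (ennreal ((1 - s) powr (p - 1) * Phi ?a (2 - 1 / p) s powr p) * indicator {0..<1} s)"
          using C2 by (simp only: ennreal_mult' less_imp_le mult.assoc)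
      qed
      also have "\<dots> = ennreal C2 * (\<integral>\<^sup>+s\<in>{0..<1}. ennreal ((1 - s) powr (p - 1) * Phi ?a (2 - 1 / p) s powr p) \<partial>lborel)"
        by (rule nn_integral_cmult) measurable
      also have "\<dots> \<le> ennreal C2 * (ennreal K * (\<integral>\<^sup>+s\<in>{0..<1}. ennreal ((1 - s) powr (p - 1 + 1) * Phi ?a 2 s powr p) \<partial>lborel))"
        by (intro mult_left_mono hardy rm) simp
      also have "\<dots> \<le> ennreal C2 * (ennreal K * V)"
        unfolding V_def
      proof (intro mult_left_mono nn_integral_Icc_mono)
        fix s :: real assume s: "s \<in> {0..<1}"
        have "(1 - s) powr (p - 1 + 1) * Phi ?a 2 s powr p = ((1 - s) * Phi ?a 2 s) powr p"
          by (simp add: powr_mult)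
        also have "\<dots> \<le> Phi ?a 1 s powr p"
          using s p one_minus_times_Phi_2_le[of s] Phi_nonneg by (intro powr_mono2) auto
        finally show "ennreal ((1 - s) powr (p - 1 + 1) * Phi ?a 2 s powr p) \<le> ennreal (Phi ?a 1 s powr p)"
          by (rule ennreal_leI)
      qed auto
      finally show "(\<integral>\<^sup>+s\<in>{0..<1}. ennreal ((1 - s) powr (p - 1) * \<Psi> s) \<partial>lborel) \<le> ennreal C2 * (ennreal K * V)" .
    qed simp
    also have "\<dots> = ennreal (22 * C1 + L * (C2 * K)) * V"
    proof -
      have "ennreal (22 * C1 + L * (C2 * K)) = ennreal (22 * C1) + ennreal (L * (C2 * K))"
        using C1 C2 K L by (intro ennreal_plus) auto
      also have "ennreal (L * (C2 * K)) = ennreal L * (ennreal C2 * ennreal K)"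
        using C2 L by (simp only: ennreal_mult' less_imp_le)
      finally show ?thesis by (simp only: distrib_right mult.assoc)
    qed
    finally show "circ_int p r (gen_hilbert g f) \<le> ennreal (22 * C1 + L * (C2 * K)) * (\<integral>\<^sup>+s\<in>{0..<1}. ennreal (Phi ?a 1 s powr p) \<partial>lborel)"
      by (simp only: gen_hilbert_eq_transform[OF f int] V_def)
  qed
qed

theorem hardy_norm_gen_hilbert_le:
  assumes p: "1 < p" "p \<le> 2" and g: "g \<in> mean_lipschitz p (1 / p)"
  shows "\<exists>C>0. \<forall>f. f holomorphic_on unit_disc \<longrightarrow>
    hardy_norm p (gen_hilbert g f) \<le> ennreal C * hardy_norm p (sub_hilbert f)"
proof -
  have hol: "g holomorphic_on unit_disc" using g by (auto simp: mean_lipschitz_def hardy_space_def)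
  have p0: "0 < p" using p by simp
  from circ_int_gen_hilbert_le[OF p g] obtain K where K: "0 < K" and up: "\<And>f r. f holomorphic_on unit_disc \<Longrightarrow>
      integrable lborel (path_density f) \<Longrightarrow> 0 < r \<Longrightarrow> r < 1 \<Longrightarrow>
      circ_int p r (gen_hilbert g f) \<le> ennreal K * (\<integral>\<^sup>+s\<in>{0..<1}. ennreal (Phi (path_mass f) 1 s powr p) \<partial>lborel)"
    by blast
  define C where "C = (K * 8 powr p) powr (1 / p)"
  have C: "0 < C" using K by (simp add: C_def)
  show ?thesis
  proof (intro exI[of _ C] conjI C allI impI)
    fix f assume f: "f holomorphic_on unit_disc"
    show "hardy_norm p (gen_hilbert g f) \<le> ennreal C * hardy_norm p (sub_hilbert f)"
    proof (cases "integrable lborel (path_density f)")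
      case False
      from gen_hilbert_eq_0_off_countable[OF f hol this] obtain Z where
        Z: "countable Z" "\<And>z. norm z < 1 \<Longrightarrow> z \<notin> Z \<Longrightarrow> gen_hilbert g f z = 0" by metis
      have "int_mean p r (gen_hilbert g f) = 0" if "0 < r" "r < 1" for r
        using circ_int_eq_0_off_countable[OF Z that] p0 by (simp add: int_mean_eq ennpowr_0)
      then have "hardy_norm p (gen_hilbert g f) \<le> 0" unfolding hardy_norm_def by (intro SUP_least) auto
      then show ?thesis using order_trans zero_le by blast
    next
      case True
      interpret radial_mass "path_mass f" by (rule radial_mass_path[OF True])
      show ?thesis
      proof (cases "hardy_norm p (sub_hilbert f)")
        case top
        then show ?thesis using C by (simp add: ennreal_mult_top)
      next
        case (real N)
        define V where "V = (\<integral>\<^sup>+s\<in>{0..<1}. ennreal (Phi (path_mass f) 1 s powr p) \<partial>lborel)"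
        have circ_S: "circ_int p r stieltjes \<le> ennreal (2 * pi * N powr p)" if "0 < r" "r < 1" for r
        proof (rule int_mean_le_imp_circ_int_le[OF p0 _ real(1)])
          have "int_mean p r stieltjes \<le> hardy_norm p stieltjes"
            unfolding hardy_norm_def using that by (intro SUP_upper) auto
          then show "int_mean p r stieltjes \<le> ennreal N" using real sub_hilbert_eq_stieltjes[OF True] by simp
        qed
        have V_le: "(\<integral>\<^sup>+s\<in>{0..<1}. ennreal ((Phi (path_mass f) 1 s / 8) powr p) \<partial>lborel) \<le> ennreal (2 * pi * N powr p)"
        proof (rule nn_integral_Ico_le_if_Icc_le)
          fix r :: real assume r: "0 \<le> r" "r < 1"
          \<comment> \<open>The Hardy norm involves positive radii only, so r = 0 is moved up to 1 /
            2.\<close>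
          define r' where "r' = max r (1 / 2)"
          have r': "0 < r'" "r' < 1" "r \<le> r'" using r by (auto simp: r'_def)
          have "(\<integral>\<^sup>+s\<in>{0..r}. ennreal ((Phi (path_mass f) 1 s / 8) powr p) \<partial>lborel) \<le> (\<integral>\<^sup>+s\<in>{0..r'}. ennreal ((Phi (path_mass f) 1 s / 8) powr p) \<partial>lborel)"
            using r' by (intro nn_integral_mono) (auto simp: indicator_def)
          also have "\<dots> \<le> circ_int p r' stieltjes" using r' p0 by (intro circ_int_stieltjes_ge_integral) auto
          also have "\<dots> \<le> ennreal (2 * pi * N powr p)" using r' by (intro circ_S)
          finally show "(\<integral>\<^sup>+s\<in>{0..r}. ennreal ((Phi (path_mass f) 1 s / 8) powr p) \<partial>lborel) \<le> ennreal (2 * pi * N powr p)" .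
        qed measurable
        have "V = (\<integral>\<^sup>+s. ennreal (8 powr p) * (ennreal ((Phi (path_mass f) 1 s / 8) powr p) * indicator {0..<1} s) \<partial>lborel)"
          unfolding V_def
        proof (rule nn_integral_cong)
          fix s
          have "Phi (path_mass f) 1 s powr p = 8 powr p * (Phi (path_mass f) 1 s / 8) powr p" by (simp add: powr_divide)
          then show "ennreal (Phi (path_mass f) 1 s powr p) * indicator {0..<1} s =
              ennreal (8 powr p) * (ennreal ((Phi (path_mass f) 1 s / 8) powr p) * indicator {0..<1} s)"
            by (simp only: ennreal_mult' powr_ge_zero mult.assoc)
        qed
        also have "\<dots> = ennreal (8 powr p) * (\<integral>\<^sup>+s\<in>{0..<1}. ennreal ((Phi (path_mass f) 1 s / 8) powr p) \<partial>lborel)"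
          by (rule nn_integral_cmult) measurable
        also have "\<dots> \<le> ennreal (8 powr p) * ennreal (2 * pi * N powr p)" by (intro mult_left_mono V_le) simp
        finally have V: "V \<le> ennreal (8 powr p) * ennreal (2 * pi * N powr p)" .
        have "int_mean p r (gen_hilbert g f) \<le> ennreal (C * N)" if r: "0 < r" "r < 1" for r
        proof -
          have "circ_int p r (gen_hilbert g f) \<le> ennreal K * V" unfolding V_def by (rule up[OF f True r])
          also have "\<dots> \<le> ennreal K * (ennreal (8 powr p) * ennreal (2 * pi * N powr p))" by (intro mult_left_mono V) simp
          finally have "ennreal (1 / (2 * pi)) * circ_int p r (gen_hilbert g f) \<le> ennreal (1 / (2 * pi)) * (ennreal K * (ennreal (8 powr p) * ennreal (2 * pi * N powr p)))"
            by (rule mult_left_mono) simp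
          also have "\<dots> = ennreal (1 / (2 * pi) * (K * (8 powr p * (2 * pi * N powr p))))"
            using K by (simp only: ennreal_mult'[symmetric] powr_ge_zero less_imp_le) (simp only: ennreal_mult'[symmetric] zero_le_divide_iff zero_le_one pi_ge_zero mult_nonneg_nonneg zero_le_numeral simp_thms)
          also have "1 / (2 * pi) * (K * (8 powr p * (2 * pi * N powr p))) = K * 8 powr p * N powr p" by simp
          also have "ennreal (K * 8 powr p * N powr p) = ennreal (K * 8 powr p) * ennreal (N powr p)"
            using K by (intro ennreal_mult') simp
          finally have "ennpowr (ennreal (1 / (2 * pi)) * circ_int p r (gen_hilbert g f)) (1 / p) \<le> ennreal ((K * 8 powr p) powr (1 / p)) * ennpowr (ennreal (N powr p)) (1 / p)"
            using K p0 by (intro ennpowr_mono_mult) auto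
          also have "ennpowr (ennreal (N powr p)) (1 / p) = ennreal N"
            using p0 real by (simp add: ennpowr_ennreal powr_powr)
          also have "ennreal ((K * 8 powr p) powr (1 / p)) * ennreal N = ennreal (C * N)"
            by (simp add: C_def ennreal_mult')
          finally show ?thesis by (simp add: int_mean_eq)
        qed
        then have "hardy_norm p (gen_hilbert g f) \<le> ennreal (C * N)"
          unfolding hardy_norm_def by (intro SUP_least) auto
        then show ?thesis using real C by (simp add: ennreal_mult')
      qed
    qed
  qed
qed

theorem mainTheorem8:
  fixes p :: real and g :: "complex \<Rightarrow> complex"
  assumes "1 < p" and "g \<in> mean_lipschitz p (1 / p)"
  shows "(p \<le> 2 \<longrightarrow>
      (\<exists>C>0::real. \<forall>f\<in>hardy_space p.
        hardy_norm p (gen_hilbert g f) \<le> ennreal C * hardy_norm p (sub_hilbert f)))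
    \<and> (\<forall>\<alpha>. -1 < \<alpha> \<and> \<alpha> < p - 2 \<longrightarrow>
      (\<exists>C>0::real. \<forall>f\<in>bergman_space p \<alpha>.
        bergman_norm p \<alpha> (gen_hilbert g f) \<le> ennreal C * bergman_norm p \<alpha> (sub_hilbert f)))
    \<and> (\<forall>\<alpha>. p - 2 < \<alpha> \<and> \<alpha> \<le> p - 1 \<longrightarrow>
      (\<exists>C>0::real. \<forall>f\<in>dirichlet_space p \<alpha>.
        dirichlet_norm p \<alpha> (gen_hilbert g f) \<le> ennreal C * dirichlet_norm p \<alpha> (sub_hilbert f)))"
proof (intro conjI allI impI)
  assume "p \<le> 2"
  then show "\<exists>C>0::real. \<forall>f\<in>hardy_space p.
      hardy_norm p (gen_hilbert g f) \<le> ennreal C * hardy_norm p (sub_hilbert f)"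
    using hardy_norm_gen_hilbert_le[OF assms(1) _ assms(2)] unfolding hardy_space_def by blast
next
  fix \<alpha> assume "-1 < \<alpha> \<and> \<alpha> < p - 2"
  then show "\<exists>C>0::real. \<forall>f\<in>bergman_space p \<alpha>.
      bergman_norm p \<alpha> (gen_hilbert g f) \<le> ennreal C * bergman_norm p \<alpha> (sub_hilbert f)"
    using bergman_norm_gen_hilbert_le[OF assms] unfolding bergman_space_def by blast
next
  fix \<alpha> assume "p - 2 < \<alpha> \<and> \<alpha> \<le> p - 1"
  then have "-1 < \<alpha>" using assms(1) by simp
  then show "\<exists>C>0::real. \<forall>f\<in>dirichlet_space p \<alpha>.
      dirichlet_norm p \<alpha> (gen_hilbert g f) \<le> ennreal C * dirichlet_norm p \<alpha> (sub_hilbert f)"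
    using dirichlet_norm_gen_hilbert_le[OF assms] unfolding dirichlet_space_def by blast
qed

end
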